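(* Let $R$ be a Noetherian local ring, and let $S$ be a seed over $R$. Then $S/I$ is a minimal seed over $R$ for some ideal $I\subseteq S$.
   Context: All rings are commutative with identity. For a Noetherian local ring $(R,m)$, a big Cohen-Macaulay $R$-algebra is an $R$-algebra $B$ (not necessarily Noetherian or finitely generated) such that some system of parameters of $R$ is a regular sequence on $B$ (a regular sequence $x_1,\ldots,x_d$ on $B$ is required to satisfy $(x_1,\ldots,x_d)B\neq B$). An $R$-algebra $S$ is a seed over $R$ if there is an $R$-algebra homomorphism from $S$ to some big Cohen-Macaulay $R$-algebra. An $R$-algebra $S$ is a minimal seed over $R$ if $S$ is a seed over $R$ and no proper homomorphic image of $S$ (i.e. no $S/J$ with $J$ a nonzero ideal of $S$) is a seed over $R$. *)

theory Defs
  imports "HOL-Algebra.Algebra" "HOL-Library.Extended_Nat"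
begin

section \<open>Noetherian local rings and systems of parameters\<close>

locale local_ring = cring +
  assumes unique_maximalideal: "\<exists>!m. maximalideal m R"

locale noetherian_local_ring = noetherian_ring R + local_ring R for R (structure)

definition krull_dim :: "('r, 'm) ring_scheme \<Rightarrow> enat" where
  "krull_dim R = Sup {enat n | n. \<exists>P. (\<forall>i\<le>n. primeideal (P i) R) \<and> (\<forall>i<n. P i \<subset> P (Suc i))}"

definition radical :: "('r, 'm) ring_scheme \<Rightarrow> 'r set \<Rightarrow> 'r set" where
  "radical R I = {x \<in> carrier R. \<exists>n::nat. x [^]\<^bsub>R\<^esub> n \<in> I}"

text \<open>For a local ring, the ideal \<^term>\<open>m\<close> below is the unique maximal ideal.\<close>

definition system_of_parameters :: "('r, 'm) ring_scheme \<Rightarrow> 'r list \<Rightarrow> bool" where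
  "system_of_parameters R xs \<longleftrightarrow>
     enat (length xs) = krull_dim R \<and>
     (\<exists>m. maximalideal m R \<and> set xs \<subseteq> m \<and> radical R (genideal R (set xs)) = m)"


section \<open>Algebras\<close>

definition alg_hom ::
    "('r, 'm) ring_scheme \<Rightarrow> ('r, 's, 'n) module_scheme \<Rightarrow> ('r, 'b, 'k) module_scheme \<Rightarrow> ('s \<Rightarrow> 'b) set"
  where
  "alg_hom R S B =
     {f \<in> ring_hom S B. \<forall>r\<in>carrier R. \<forall>s\<in>carrier S. f (r \<odot>\<^bsub>S\<^esub> s) = r \<odot>\<^bsub>B\<^esub> f s}"

text \<open>The quotient ring \<^term>\<open>S Quot I\<close> with the induced scalar multiplication.\<close>

definition quot_algebra :: "('r, 's, 'n) module_scheme \<Rightarrow> 's set \<Rightarrow> ('r, 's set) module" where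
  "quot_algebra S I =
     ring.extend (S Quot I) (module.fields (\<lambda>r Y. \<Union>x\<in>Y. I +>\<^bsub>S\<^esub> (r \<odot>\<^bsub>S\<^esub> x)))"

text \<open>The ideal $(x_1,\ldots,x_n)B$ of an algebra $B$, for a set of elements of the base ring.\<close>

definition expansion :: "('r, 'b, 'k) module_scheme \<Rightarrow> 'r set \<Rightarrow> 'b set" where
  "expansion B Y = genideal B ((\<lambda>x. x \<odot>\<^bsub>B\<^esub> \<one>\<^bsub>B\<^esub>) ` Y)"

definition nonzerodivisor_on :: "('r, 'b, 'k) module_scheme \<Rightarrow> 'r \<Rightarrow> bool" where
  "nonzerodivisor_on M x \<longleftrightarrow> (\<forall>u\<in>carrier M. x \<odot>\<^bsub>M\<^esub> u = \<zero>\<^bsub>M\<^esub> \<longrightarrow> u = \<zero>\<^bsub>M\<^esub>)"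

definition regular_sequence :: "('r, 'b, 'k) module_scheme \<Rightarrow> 'r list \<Rightarrow> bool" where
  "regular_sequence B xs \<longleftrightarrow>
     (\<forall>i<length xs. nonzerodivisor_on (quot_algebra B (expansion B (set (take i xs)))) (xs ! i)) \<and>
     expansion B (set xs) \<noteq> carrier B"

definition big_cohen_macaulay :: "('r, 'm) ring_scheme \<Rightarrow> ('r, 'b, 'k) module_scheme \<Rightarrow> bool" where
  "big_cohen_macaulay R B \<longleftrightarrow>
     algebra R B \<and> (\<exists>xs. system_of_parameters R xs \<and> regular_sequence B xs)"


section \<open>Seeds\<close>

text \<open>
  HOL cannot quantify over types, so the big Cohen-Macaulay algebra is taken over the fixed
  type \<^typ>\<open>'s list\<close>, where \<^typ>\<open>'s\<close> is the type of the elements of \<^term>\<open>S\<close>.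
  This is no restriction: by \<open>seedI\<close> at the end of this theory, an algebra that maps to a big
  Cohen-Macaulay algebra over an arbitrary type is a seed in the sense of this definition.
\<close>

definition seed :: "('r, 'm) ring_scheme \<Rightarrow> ('r, 's, 'n) module_scheme \<Rightarrow> bool" where
  "seed R S \<longleftrightarrow>
     algebra R S \<and>
     (\<exists>B :: ('r, 's list) module. big_cohen_macaulay R B \<and> alg_hom R S B \<noteq> {})"

definition minimal_seed :: "('r, 'm) ring_scheme \<Rightarrow> ('r, 's, 'n) module_scheme \<Rightarrow> bool" where
  "minimal_seed R S \<longleftrightarrow>
     seed R S \<and> (\<forall>J. ideal J S \<and> J \<noteq> {\<zero>\<^bsub>S\<^esub>} \<longrightarrow> \<not> seed R (quot_algebra S J))"


section \<open>Quotient algebras are algebras\<close>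

lemma quot_algebra_sel:
  "carrier (quot_algebra S I) = carrier (S Quot I)"
  "monoid.mult (quot_algebra S I) = monoid.mult (S Quot I)"
  "monoid.one (quot_algebra S I) = monoid.one (S Quot I)"
  "ring.zero (quot_algebra S I) = ring.zero (S Quot I)"
  "ring.add (quot_algebra S I) = ring.add (S Quot I)"
  "smult (quot_algebra S I) = (\<lambda>r Y. \<Union>x\<in>Y. I +>\<^bsub>S\<^esub> (r \<odot>\<^bsub>S\<^esub> x))"
  by (simp_all add: quot_algebra_def ring.defs module.defs)

lemma cring_cong:
  assumes "cring R" "carrier S = carrier R" "monoid.mult S = monoid.mult R" "monoid.one S = monoid.one R"
    "ring.zero S = ring.zero R" "ring.add S = ring.add R"
  shows "cring S"
proof -
  interpret cring R by fact
  have "abelian_group S"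
    by (rule abelian_groupI) (auto simp: assms(2-) a_ac intro: l_neg bexI[of _ "\<ominus>\<^bsub>R\<^esub> x" for x])
  moreover have "comm_monoid S" by (rule comm_monoidI) (auto simp: assms(2-) m_ac)
  ultimately show ?thesis by (rule cringI) (auto simp: assms(2-) l_distr)
qed

lemma smult_conv_mult:
  assumes "algebra R B" "r \<in> carrier R" "x \<in> carrier B"
  shows "r \<odot>\<^bsub>B\<^esub> x = (r \<odot>\<^bsub>B\<^esub> \<one>\<^bsub>B\<^esub>) \<otimes>\<^bsub>B\<^esub> x"
proof -
  interpret M: cring B using assms(1) by (rule algebra.M_cring)
  interpret algebra R B by fact
  show ?thesis using assms by (simp add: smult_assoc2)
qed

lemma ideal_smult_closed:
  assumes "algebra R B" "ideal I B" "r \<in> carrier R" "x \<in> I"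
  shows "r \<odot>\<^bsub>B\<^esub> x \<in> I"
proof -
  interpret M: cring B using assms(1) by (rule algebra.M_cring)
  interpret algebra R B by fact
  interpret ideal I B by fact
  show ?thesis using assms smult_conv_mult[OF assms(1,3)]
    by (metis I_l_closed Icarr M.one_closed smult_closed)
qed

lemma quot_algebra_smult:
  assumes "algebra R B" "ideal I B" "r \<in> carrier R" "b \<in> carrier B"
  shows "r \<odot>\<^bsub>quot_algebra B I\<^esub> (I +>\<^bsub>B\<^esub> b) = I +>\<^bsub>B\<^esub> (r \<odot>\<^bsub>B\<^esub> b)"
proof -
  interpret M: cring B using assms(1) by (rule algebra.M_cring)
  interpret algebra R B by fact
  interpret I: ideal I B by fact
  have "I +>\<^bsub>B\<^esub> (r \<odot>\<^bsub>B\<^esub> x) = I +>\<^bsub>B\<^esub> (r \<odot>\<^bsub>B\<^esub> b)" if x: "x \<in> I +>\<^bsub>B\<^esub> b" for x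
  proof -
    obtain i where i: "i \<in> I" "x = i \<oplus>\<^bsub>B\<^esub> b" using x by (auto simp: a_r_coset_def')
    have ri: "r \<odot>\<^bsub>B\<^esub> i \<in> I" by (rule ideal_smult_closed[OF assms(1-3) i(1)])
    have "r \<odot>\<^bsub>B\<^esub> x = r \<odot>\<^bsub>B\<^esub> i \<oplus>\<^bsub>B\<^esub> r \<odot>\<^bsub>B\<^esub> b"
      using i assms I.Icarr by (simp add: smult_r_distr)
    moreover have "(r \<odot>\<^bsub>B\<^esub> i \<oplus>\<^bsub>B\<^esub> r \<odot>\<^bsub>B\<^esub> b) \<ominus>\<^bsub>B\<^esub> (r \<odot>\<^bsub>B\<^esub> b) = r \<odot>\<^bsub>B\<^esub> i"
      using I.Icarr[OF ri] smult_closed[OF assms(3,4)] by algebra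
    ultimately show ?thesis
      using M.quotient_eq_iff_same_a_r_cos[OF assms(2), of "r \<odot>\<^bsub>B\<^esub> x" "r \<odot>\<^bsub>B\<^esub> b"]
        ri I.Icarr[OF ri] smult_closed[OF assms(3,4)] by simp
  qed
  moreover have "b \<in> I +>\<^bsub>B\<^esub> b" using assms(4) by (rule I.a_rcos_self)
  ultimately show ?thesis unfolding quot_algebra_sel by blast
qed

lemma quot_carrier:
  "carrier (quot_algebra B I) = (\<lambda>b. I +>\<^bsub>B\<^esub> b) ` carrier B"
  by (auto simp: quot_algebra_sel FactRing_def A_RCOSETS_def')

lemma quot_algebra_is_algebra:
  assumes "algebra R B" "ideal I B"
  shows "algebra R (quot_algebra B I)"
proof -
  interpret M: cring B using assms(1) by (rule algebra.M_cring)
  interpret algebra R B by fact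
  interpret I: ideal I B by fact
  let ?Q = "quot_algebra B I"
  have add: "(I +>\<^bsub>B\<^esub> x) \<oplus>\<^bsub>?Q\<^esub> (I +>\<^bsub>B\<^esub> y) = I +>\<^bsub>B\<^esub> (x \<oplus>\<^bsub>B\<^esub> y)"
    if "x \<in> carrier B" "y \<in> carrier B" for x y
    using that by (simp add: quot_algebra_sel FactRing_def I.a_rcos_sum)
  have mult: "(I +>\<^bsub>B\<^esub> x) \<otimes>\<^bsub>?Q\<^esub> (I +>\<^bsub>B\<^esub> y) = I +>\<^bsub>B\<^esub> (x \<otimes>\<^bsub>B\<^esub> y)"
    if "x \<in> carrier B" "y \<in> carrier B" for x y
    using that by (simp add: quot_algebra_sel FactRing_def I.rcoset_mult_add)
  note sm = quot_algebra_smult[OF assms]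
  have Q: "cring ?Q"
    by (rule cring_cong[OF I.quotient_is_cring[OF M_cring]]) (simp_all only: quot_algebra_sel)
  show ?thesis
    by (rule algebraI[OF R_cring Q])
      (auto simp: quot_carrier sm add mult smult_l_distr smult_r_distr smult_assoc1 smult_assoc2)
qed

lemma quot_map_alg_hom:
  assumes "algebra R B" "ideal I B"
  shows "(\<lambda>b. I +>\<^bsub>B\<^esub> b) \<in> alg_hom R B (quot_algebra B I)"
proof -
  have "(+>\<^bsub>B\<^esub>) I \<in> ring_hom B (quot_algebra B I)"
    using ideal.rcos_ring_hom[OF assms(2)] unfolding ring_hom_def quot_algebra_sel .
  then show ?thesis using quot_algebra_smult[OF assms] unfolding alg_hom_def by blast
qed


section \<open>The type chosen in the definition of seeds is immaterial\<close>

lemma small_closure: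
  fixes f :: "'s \<Rightarrow> 'b" and G :: "'b \<Rightarrow> 'b \<Rightarrow> 'b set"
  assumes fin: "\<And>a b. finite (G a b)"
  obtains A where "f ` S \<subseteq> A" "\<And>a b. a \<in> A \<Longrightarrow> b \<in> A \<Longrightarrow> G a b \<subseteq> A"
    "|A| \<le>o |UNIV :: 's list set|"
proof -
  define U where "U = (UNIV :: 's list set)"
  have inf: "infinite U" unfolding U_def by (rule infinite_UNIV_listI)
  define A where "A = rec_nat (f ` S) (\<lambda>_ Y. Y \<union> (\<Union>p\<in>Y \<times> Y. G (fst p) (snd p)))"
  have A0: "A 0 = f ` S" and AS: "A (Suc n) = A n \<union> (\<Union>p\<in>A n \<times> A n. G (fst p) (snd p))" for n
    by (simp_all add: A_def)
  have "mono A" unfolding mono_iff_le_Suc AS by blast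
  then have mono: "A m \<subseteq> A n" if "m \<le> n" for m n using that by (rule monoD)
  have card: "|A n| \<le>o |U|" for n
  proof (induction n)
    case 0
    have "|S| \<le>o |U|" unfolding U_def by (rule card_of_ordLeqI[of "\<lambda>s. [s]"]) (auto simp: inj_on_def)
    then show ?case unfolding A0 using card_of_image ordLeq_transitive by blast
  next
    case (Suc n)
    have "|G a b| \<le>o |U|" for a b
      using fin inf finite_ordLess_infinite2 ordLess_imp_ordLeq by blast
    then have "|\<Union>p\<in>A n \<times> A n. G (fst p) (snd p)| \<le>o |U|"
      by (intro card_of_UNION_ordLeq_infinite[OF inf card_of_Times_ordLeq_infinite[OF inf Suc Suc]] ballI)
    then show ?case unfolding AS by (rule card_of_Un_ordLeq_infinite[OF inf Suc])
  qed
  have "|UNIV :: nat set| \<le>o |U|" using inf infinite_iff_card_of_nat by blast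
  then have 3: "|\<Union>n. A n| \<le>o |U|"
    by (rule card_of_UNION_ordLeq_infinite[OF inf]) (simp add: card)
  have 1: "f ` S \<subseteq> (\<Union>n. A n)" using A0 by blast
  have 2: "G a b \<subseteq> (\<Union>n. A n)" if ab: "a \<in> (\<Union>n. A n)" "b \<in> (\<Union>n. A n)" for a b
  proof -
    obtain k l where kl: "a \<in> A k" "b \<in> A l" using ab by blast
    then have "a \<in> A (max k l)" "b \<in> A (max k l)"
      using mono[of k "max k l"] mono[of l "max k l"] by auto
    then have "G a b \<subseteq> A (Suc (max k l))" unfolding AS by force
    then show ?thesis by blast
  qed
  show thesis using that[OF 1 2] 3 unfolding U_def by blast
qed

lemma (in cring) genideal_finite_witness:
  assumes T: "T \<subseteq> carrier R" and b: "b \<in> Idl T"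
  shows "\<exists>F. finite F \<and> F \<subseteq> carrier R \<and>
    (\<forall>A K. F \<subseteq> A \<longrightarrow> T \<subseteq> K \<longrightarrow> \<zero> \<in> K \<longrightarrow> (\<forall>x\<in>K. \<forall>y\<in>K. x \<oplus> y \<in> K) \<longrightarrow>
       (\<forall>a\<in>A. \<forall>x\<in>K. a \<otimes> x \<in> K) \<longrightarrow> b \<in> K)"
proof -
  define Q where "Q = (\<lambda>F b. finite F \<and> F \<subseteq> carrier R \<and>
    (\<forall>A K. F \<subseteq> A \<longrightarrow> T \<subseteq> K \<longrightarrow> \<zero> \<in> K \<longrightarrow> (\<forall>x\<in>K. \<forall>y\<in>K. x \<oplus> y \<in> K) \<longrightarrow>
       (\<forall>a\<in>A. \<forall>x\<in>K. a \<otimes> x \<in> K) \<longrightarrow> b \<in> K))"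
  define I where "I = {b \<in> carrier R. \<exists>F. Q F b}"
  have mult: "a \<otimes> x \<in> I" if xa: "x \<in> I" "a \<in> carrier R" for a x
  proof -
    obtain F where F: "Q F x" "x \<in> carrier R" using xa unfolding I_def by blast
    have "Q (insert a F) (a \<otimes> x)" using F xa unfolding Q_def by auto
    then show ?thesis using F xa by (auto simp: I_def)
  qed
  have add: "x \<oplus> y \<in> I" if xy: "x \<in> I" "y \<in> I" for x y
  proof -
    obtain F where F: "Q F x" "x \<in> carrier R" using xy unfolding I_def by blast
    obtain F' where F': "Q F' y" "y \<in> carrier R" using xy unfolding I_def by blast
    have "Q (F \<union> F') (x \<oplus> y)" using F F' unfolding Q_def by auto
    then show ?thesis using F F' by (auto simp: I_def)
  qed
  have "Q {} \<zero>" unfolding Q_def by auto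
  then have zero: "\<zero> \<in> I" by (auto simp: I_def)
  have neg: "\<ominus> x \<in> I" if x: "x \<in> I" for x
  proof -
    have "x \<in> carrier R" using x by (auto simp: I_def)
    then have "\<ominus> x = (\<ominus> \<one>) \<otimes> x" by (simp add: l_minus)
    then show ?thesis using mult[OF x, of "\<ominus> \<one>"] by simp
  qed
  have "ideal I R"
  proof (rule idealI)
    show "ring R" by (rule ring_axioms)
    show "subgroup I (add_monoid R)"
      by (rule add.subgroupI)
        (use zero neg add in \<open>auto simp: I_def a_inv_def[symmetric]\<close>)
    show "x \<otimes> a \<in> I" if "a \<in> I" "x \<in> carrier R" for a x using mult that by blast
    show "a \<otimes> x \<in> I" if "a \<in> I" "x \<in> carrier R" for a x
    proof -
      have "a \<in> carrier R" using that by (simp add: I_def)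
      then show ?thesis using mult[OF that] m_comm that by simp
    qed
  qed
  moreover have "T \<subseteq> I"
  proof
    fix t assume t: "t \<in> T"
    have "Q {} t" unfolding Q_def using t by auto
    then show "t \<in> I" using t T by (auto simp: I_def)
  qed
  ultimately have "Idl T \<subseteq> I" by (rule genideal_minimal)
  then obtain F where "Q F b" using b by (auto simp: I_def)
  then show ?thesis unfolding Q_def by blast
qed

lemma regular_sequence_iff:
  assumes "algebra R B" "set xs \<subseteq> carrier R"
  shows "regular_sequence B xs \<longleftrightarrow>
    (\<forall>i<length xs. \<forall>b\<in>carrier B. xs ! i \<odot>\<^bsub>B\<^esub> b \<in> expansion B (set (take i xs)) \<longrightarrow>
       b \<in> expansion B (set (take i xs))) \<and> \<one>\<^bsub>B\<^esub> \<notin> expansion B (set xs)"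
proof -
  interpret M: cring B using assms(1) by (rule algebra.M_cring)
  interpret algebra R B by fact
  have id: "ideal (expansion B (set (take i xs))) B" for i
    unfolding expansion_def
    by (rule M.genideal_ideal) (use assms set_take_subset[of i xs] in auto)
  have nz: "nonzerodivisor_on (quot_algebra B I) r \<longleftrightarrow> (\<forall>b\<in>carrier B. r \<odot>\<^bsub>B\<^esub> b \<in> I \<longrightarrow> b \<in> I)"
    if I: "ideal I B" and r: "r \<in> carrier R" for I r
  proof -
    have "I +>\<^bsub>B\<^esub> b = I \<longleftrightarrow> b \<in> I" if "b \<in> carrier B" for b
      using that I M.a_rcos_zero ideal.rcos_const_imp_mem by metis
    then show ?thesis
      unfolding nonzerodivisor_on_def quot_carrier
      by (simp add: quot_algebra_smult[OF assms(1) I r] quot_algebra_sel(4) FactRing_def r)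
  qed
  have r: "xs ! i \<in> carrier R" if "i < length xs" for i using assms that nth_mem by blast
  have "expansion B (set xs) \<noteq> carrier B \<longleftrightarrow> \<one>\<^bsub>B\<^esub> \<notin> expansion B (set xs)"
    using ideal.one_imp_carrier[OF id[of "length xs"]] M.one_closed by auto
  moreover have "nonzerodivisor_on (quot_algebra B (expansion B (set (take i xs)))) (xs ! i) \<longleftrightarrow>
      (\<forall>b\<in>carrier B. xs ! i \<odot>\<^bsub>B\<^esub> b \<in> expansion B (set (take i xs)) \<longrightarrow>
         b \<in> expansion B (set (take i xs)))" if "i < length xs" for i
    using id r[OF that] by (rule nz)
  ultimately show ?thesis unfolding regular_sequence_def by simp
qed

lemma algebra_transport:
  fixes g :: "'b \<Rightarrow> 'c"
  assumes B: "algebra R B" and AB: "A \<subseteq> carrier B" and inj: "inj_on g A"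
    and one: "\<one>\<^bsub>B\<^esub> \<in> A" and neg: "\<And>x. x \<in> A \<Longrightarrow> \<ominus>\<^bsub>B\<^esub> x \<in> A"
    and add: "\<And>x y. x \<in> A \<Longrightarrow> y \<in> A \<Longrightarrow> x \<oplus>\<^bsub>B\<^esub> y \<in> A"
    and mult: "\<And>x y. x \<in> A \<Longrightarrow> y \<in> A \<Longrightarrow> x \<otimes>\<^bsub>B\<^esub> y \<in> A"
    and smult: "\<And>r x. r \<in> carrier R \<Longrightarrow> x \<in> A \<Longrightarrow> r \<odot>\<^bsub>B\<^esub> x \<in> A"
  obtains B' :: "('a, 'c) module" where "algebra R B'" "carrier B' = g ` A"
    "g \<in> alg_hom R (B\<lparr>carrier := A\<rparr>) B'" "g \<zero>\<^bsub>B\<^esub> = \<zero>\<^bsub>B'\<^esub>"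
proof -
  interpret M: cring B using assms(1) by (rule algebra.M_cring)
  interpret algebra R B by fact
  define h where "h = inv_into A g"
  have hg: "h (g a) = a" if "a \<in> A" for a using that inj by (simp add: h_def)
  define B' :: "('a, 'c) module" where "B' = \<lparr>carrier = g ` A, monoid.mult = \<lambda>x y. g (h x \<otimes>\<^bsub>B\<^esub> h y),
    monoid.one = g \<one>\<^bsub>B\<^esub>, ring.zero = g \<zero>\<^bsub>B\<^esub>, ring.add = \<lambda>x y. g (h x \<oplus>\<^bsub>B\<^esub> h y), smult = \<lambda>r x. g (r \<odot>\<^bsub>B\<^esub> h x)\<rparr>"
  have zero: "\<zero>\<^bsub>B\<^esub> \<in> A" using add[OF one neg[OF one]] by (simp add: M.r_neg)
  have C: "a \<in> A \<Longrightarrow> a \<in> carrier B" for a using AB by blast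
  note s = B'_def hg add mult smult zero one neg C
  have "abelian_group B'"
  proof (rule abelian_groupI)
    fix x assume "x \<in> carrier B'"
    then obtain a where a: "a \<in> A" "x = g a" by (auto simp: B'_def)
    then show "\<exists>y\<in>carrier B'. y \<oplus>\<^bsub>B'\<^esub> x = \<zero>\<^bsub>B'\<^esub>"
      by (intro bexI[of _ "g (\<ominus>\<^bsub>B\<^esub> a)"]) (auto simp: s M.l_neg)
  qed (auto simp: s M.a_ac)
  moreover have "comm_monoid B'"
    by (rule comm_monoidI) (auto simp: s M.m_ac)
  ultimately have "cring B'"
    by (rule cringI) (auto simp: s M.l_distr)
  with R_cring have 1: "algebra R B'"
    by (rule algebraI) (auto simp: s smult_l_distr smult_r_distr smult_assoc1 smult_assoc2)
  show thesis
    by (rule that[OF 1]) (auto simp: s alg_hom_def ring_hom_def)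
qed

theorem seedI:
  fixes S :: "('r, 's, 'n) module_scheme" and B :: "('r, 'b, 'k) module_scheme"
  assumes S: "algebra R S" and bcm: "big_cohen_macaulay R B" and f: "f \<in> alg_hom R S B"
  shows "seed R S"
proof -
  have B: "algebra R B" using bcm by (simp add: big_cohen_macaulay_def)
  obtain xs where sop: "system_of_parameters R xs" and reg: "regular_sequence B xs"
    using bcm by (auto simp: big_cohen_macaulay_def)
  interpret M: cring B using B by (rule algebra.M_cring)
  interpret algebra R B by (rule B)
  interpret S: algebra R S by (rule S)
  obtain m where m: "maximalideal m R" "set xs \<subseteq> m"
    using sop unfolding system_of_parameters_def by blast
  have xs: "set xs \<subseteq> carrier R"
    using m(2) ideal.Icarr[OF maximalideal.axioms(1)[OF m(1)]] by blast
  have fh: "f \<in> ring_hom S B" and fs: "\<And>r s. r \<in> carrier R \<Longrightarrow> s \<in> carrier S \<Longrightarrow> f (r \<odot>\<^bsub>S\<^esub> s) = r \<odot>\<^bsub>B\<^esub> f s"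
    using f by (auto simp: alg_hom_def)
  define Y where "Y = (\<lambda>i. set (take i xs))"
  define T where "T = (\<lambda>i. (\<lambda>x. x \<odot>\<^bsub>B\<^esub> \<one>\<^bsub>B\<^esub>) ` Y i)"
  have Y: "Y i \<subseteq> carrier R" for i using xs set_take_subset[of i xs] by (auto simp: Y_def)
  have T: "T i \<subseteq> carrier B" for i using Y by (auto simp: T_def)
  have E: "expansion B (Y i) = genideal B (T i)" for i by (simp add: expansion_def T_def)
  define W where "W = (\<lambda>i b F. finite F \<and> F \<subseteq> carrier B \<and>
    (\<forall>A K. F \<subseteq> A \<longrightarrow> T i \<subseteq> K \<longrightarrow> \<zero>\<^bsub>B\<^esub> \<in> K \<longrightarrow> (\<forall>x\<in>K. \<forall>y\<in>K. x \<oplus>\<^bsub>B\<^esub> y \<in> K) \<longrightarrow>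
       (\<forall>a\<in>A. \<forall>x\<in>K. a \<otimes>\<^bsub>B\<^esub> x \<in> K) \<longrightarrow> b \<in> K))"
  define F where "F = (\<lambda>i b. SOME F. W i b F)"
  have W: "W i b (F i b)" if b: "b \<in> genideal B (T i)" for i b
  proof -
    have "\<exists>F. W i b F" unfolding W_def by (rule M.genideal_finite_witness[OF T b])
    then show ?thesis unfolding F_def by (rule someI_ex)
  qed
  have F: "finite (F i b)" "F i b \<subseteq> carrier B" if "b \<in> genideal B (T i)" for i b
    using W[OF that] unfolding W_def by simp_all
  have Fwit: "b \<in> K" if b: "b \<in> genideal B (T i)" and "F i b \<subseteq> A" "T i \<subseteq> K" "\<zero>\<^bsub>B\<^esub> \<in> K"
    "\<forall>x\<in>K. \<forall>y\<in>K. x \<oplus>\<^bsub>B\<^esub> y \<in> K" "\<forall>a\<in>A. \<forall>x\<in>K. a \<otimes>\<^bsub>B\<^esub> x \<in> K" for i b A K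
    using W[OF b] that(2-) unfolding W_def by simp
  define G where "G = (\<lambda>a b. {a \<oplus>\<^bsub>B\<^esub> b, a \<otimes>\<^bsub>B\<^esub> b, \<ominus>\<^bsub>B\<^esub> a} \<union>
    (\<Union>i\<in>{i. i < length xs \<and> a \<in> genideal B (T i)}. F i a))"
  have Gfin: "finite (G a b)" for a b unfolding G_def using F(1) by auto
  obtain A' where A': "f ` carrier S \<subseteq> A'" "\<And>a b. a \<in> A' \<Longrightarrow> b \<in> A' \<Longrightarrow> G a b \<subseteq> A'"
    and card: "|A'| \<le>o |UNIV :: 's list set|"
    using small_closure[of G f "carrier S", OF Gfin] by blast
  define A where "A = A' \<inter> carrier B"
  have AB: "A \<subseteq> carrier B" by (simp add: A_def)
  have GA: "G a b \<subseteq> A" if "a \<in> A" "b \<in> A" for a b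
    using A'(2)[of a b] F(2) that unfolding A_def G_def by auto
  have fA: "f s \<in> A" if "s \<in> carrier S" for s
    using that A'(1) ring_hom_closed[OF fh that] by (auto simp: A_def)
  have f1: "f \<one>\<^bsub>S\<^esub> = \<one>\<^bsub>B\<^esub>" using fh by (rule ring_hom_one)
  have one: "\<one>\<^bsub>B\<^esub> \<in> A" using fA[of "\<one>\<^bsub>S\<^esub>"] f1 by simp
  have add: "x \<oplus>\<^bsub>B\<^esub> y \<in> A" and mult: "x \<otimes>\<^bsub>B\<^esub> y \<in> A" and neg: "\<ominus>\<^bsub>B\<^esub> x \<in> A"
    if "x \<in> A" "y \<in> A" for x y using GA[OF that] by (auto simp: G_def)
  have FA: "F i a \<subseteq> A" if "a \<in> A" "i < length xs" "a \<in> genideal B (T i)" for i a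
    using GA[OF that(1) that(1)] that by (auto simp: G_def)
  have smult: "r \<odot>\<^bsub>B\<^esub> x \<in> A" if "r \<in> carrier R" "x \<in> A" for r x
  proof -
    have "r \<odot>\<^bsub>B\<^esub> \<one>\<^bsub>B\<^esub> \<in> A" using fs[OF that(1), of "\<one>\<^bsub>S\<^esub>"] fA[of "r \<odot>\<^bsub>S\<^esub> \<one>\<^bsub>S\<^esub>"] f1 that by simp
    then have "(r \<odot>\<^bsub>B\<^esub> \<one>\<^bsub>B\<^esub>) \<otimes>\<^bsub>B\<^esub> x \<in> A" using that(2) by (rule mult)
    then show ?thesis unfolding smult_conv_mult[OF B that(1) subsetD[OF AB that(2)]] .
  qed
  have "|A| \<le>o |UNIV :: 's list set|"
    by (rule ordLeq_transitive[OF card_of_mono1 card]) (simp add: A_def)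
  then obtain g :: "'b \<Rightarrow> 's list" where inj: "inj_on g A" unfolding card_of_ordLeq[symmetric] by blast
  obtain B' :: "('r, 's list) module" where B': "algebra R B'" and car: "carrier B' = g ` A"
    and g: "g \<in> alg_hom R (B\<lparr>carrier := A\<rparr>) B'" and g0: "g \<zero>\<^bsub>B\<^esub> = \<zero>\<^bsub>B'\<^esub>"
    by (rule algebra_transport[OF B AB inj one]) (use neg add mult smult in simp_all)
  interpret B'M: cring B' using B' by (rule algebra.M_cring)
  interpret B': algebra R B' by (rule B')
  have gadd: "g (x \<oplus>\<^bsub>B\<^esub> y) = g x \<oplus>\<^bsub>B'\<^esub> g y" and gmult: "g (x \<otimes>\<^bsub>B\<^esub> y) = g x \<otimes>\<^bsub>B'\<^esub> g y"
    if "x \<in> A" "y \<in> A" for x y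
    using g that by (auto simp: alg_hom_def ring_hom_def)
  have g1: "g \<one>\<^bsub>B\<^esub> = \<one>\<^bsub>B'\<^esub>" using g by (auto simp: alg_hom_def ring_hom_def)
  have gsm: "g (r \<odot>\<^bsub>B\<^esub> x) = r \<odot>\<^bsub>B'\<^esub> g x" if "r \<in> carrier R" "x \<in> A" for r x
    using g that by (auto simp: alg_hom_def)
  have zero: "\<zero>\<^bsub>B\<^esub> \<in> A" using add[OF one neg[OF one one]] by (simp add: M.r_neg)
  have gneg: "g (\<ominus>\<^bsub>B\<^esub> x) = \<ominus>\<^bsub>B'\<^esub> g x" if x: "x \<in> A" for x
  proof -
    have "g (\<ominus>\<^bsub>B\<^esub> x) \<oplus>\<^bsub>B'\<^esub> g x = \<zero>\<^bsub>B'\<^esub>"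
      using gadd[OF neg[OF x x] x] g0 x AB by (auto simp: M.l_neg)
    then show ?thesis using car x neg[OF x x] by (simp add: B'M.minus_equality)
  qed
  define I' where "I' = (\<lambda>i. genideal B' ((\<lambda>x. x \<odot>\<^bsub>B'\<^esub> \<one>\<^bsub>B'\<^esub>) ` Y i))"
  have I'id: "ideal (I' i) B'" for i
    unfolding I'_def by (rule B'M.genideal_ideal) (use Y in auto)
  have T': "(\<lambda>x. x \<odot>\<^bsub>B'\<^esub> \<one>\<^bsub>B'\<^esub>) ` Y i = g ` T i" for i
    unfolding T_def image_image
    by (rule image_cong) (use Y[of i] gsm[OF _ one] g1 in auto)
  have TA: "T i \<subseteq> A" for i using Y smult one by (auto simp: T_def)
  have up: "a \<in> genideal B (T i)" if a: "a \<in> A" "g a \<in> I' i" for a i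
  proof -
    interpret J: ideal "genideal B (T i)" B using T by (rule M.genideal_ideal)
    let ?J = "g ` (A \<inter> genideal B (T i))"
    have "ideal ?J B'"
    proof (rule idealI)
      show "ring B'" by (rule B'M.ring_axioms)
      have Jcar: "?J \<subseteq> carrier B'" using car by auto
      have Jne: "?J \<noteq> {}" using zero J.zero_closed by blast
      have Jneg: "\<ominus>\<^bsub>B'\<^esub> y \<in> ?J" if y: "y \<in> ?J" for y
      proof -
        obtain x where x: "x \<in> A" "x \<in> genideal B (T i)" "y = g x" using y by blast
        have "\<ominus>\<^bsub>B'\<^esub> y = g (\<ominus>\<^bsub>B\<^esub> x)" using gneg[OF x(1)] x(3) by simp
        then show ?thesis using neg[OF x(1) x(1)] J.a_inv_closed[OF x(2)] by blast
      qed
      have Jadd: "x \<oplus>\<^bsub>B'\<^esub> y \<in> ?J" if "x \<in> ?J" "y \<in> ?J" for x y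
        using that by (auto simp: gadd[symmetric] add)
      show "subgroup ?J (add_monoid B')"
        by (rule B'M.add.subgroupI[OF Jcar Jne])
          (use Jneg Jadd in \<open>simp_all only: a_inv_def monoid.simps\<close>)
      show "x \<otimes>\<^bsub>B'\<^esub> a \<in> ?J" "a \<otimes>\<^bsub>B'\<^esub> x \<in> ?J" if ax: "a \<in> ?J" "x \<in> carrier B'" for a x
      proof -
        obtain a0 x0 where "a0 \<in> A" "a0 \<in> genideal B (T i)" "a = g a0" "x0 \<in> A" "x = g x0"
          using ax car by blast
        then show "x \<otimes>\<^bsub>B'\<^esub> a \<in> ?J" "a \<otimes>\<^bsub>B'\<^esub> x \<in> ?J"
          using AB by (auto simp: gmult[symmetric] mult J.I_l_closed J.I_r_closed)
      qed
    qed
    moreover have "g ` T i \<subseteq> ?J" using TA M.genideal_self[OF T] by blast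
    ultimately have "I' i \<subseteq> ?J" unfolding I'_def T' by (rule B'M.genideal_minimal)
    then obtain a' where "a' \<in> A" "a' \<in> genideal B (T i)" "g a = g a'" using a by blast
    then show ?thesis using inj_onD[OF inj _ a(1)] by blast
  qed
  have down: "g a \<in> I' i" if a: "a \<in> A" "i < length xs" "a \<in> genideal B (T i)" for a i
  proof -
    interpret J: ideal "I' i" B' by (rule I'id)
    have gT: "g ` T i \<subseteq> I' i" unfolding I'_def T'
      by (rule B'M.genideal_self) (use TA car in auto)
    have "a \<in> {x \<in> A. g x \<in> I' i}"
    proof (rule Fwit[OF a(3) FA[OF a]])
      show "T i \<subseteq> {x \<in> A. g x \<in> I' i}" using gT TA by auto
      show "\<zero>\<^bsub>B\<^esub> \<in> {x \<in> A. g x \<in> I' i}" using zero g0 J.zero_closed by simp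
    qed (use add mult car in \<open>auto simp: gadd gmult J.I_l_closed\<close>)
    then show ?thesis by blast
  qed
  have E': "expansion B' (Y i) = I' i" for i by (simp add: expansion_def I'_def)
  have Xn: "Y (length xs) = set xs" by (simp add: Y_def)
  have reg': "regular_sequence B' xs"
    unfolding regular_sequence_iff[OF B' xs]
  proof (intro conjI allI impI ballI)
    fix i b
    assume i: "i < length xs" and b: "b \<in> carrier B'"
      and m: "xs ! i \<odot>\<^bsub>B'\<^esub> b \<in> expansion B' (set (take i xs))"
    obtain a where a: "a \<in> A" "b = g a" using b car by blast
    have xi: "xs ! i \<in> carrier R" using xs i nth_mem by blast
    have "g (xs ! i \<odot>\<^bsub>B\<^esub> a) \<in> I' i" using m gsm[OF xi a(1)] E'[of i] a by (simp add: Y_def)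
    then have "xs ! i \<odot>\<^bsub>B\<^esub> a \<in> genideal B (T i)" using up smult[OF xi a(1)] by blast
    then have "a \<in> genideal B (T i)"
      using reg i a AB E[of i] unfolding regular_sequence_iff[OF B xs] Y_def by blast
    then show "b \<in> expansion B' (set (take i xs))" using down a i E'[of i] by (simp add: Y_def)
  next
    show "\<one>\<^bsub>B'\<^esub> \<notin> expansion B' (set xs)"
    proof
      assume "\<one>\<^bsub>B'\<^esub> \<in> expansion B' (set xs)"
      then have "g \<one>\<^bsub>B\<^esub> \<in> I' (length xs)" using E'[of "length xs"] Xn g1 by simp
      then have "\<one>\<^bsub>B\<^esub> \<in> expansion B (set xs)" using up[OF one] E[of "length xs"] Xn by simp
      then show False using reg unfolding regular_sequence_iff[OF B xs] by blast
    qed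
  qed
  have "big_cohen_macaulay R B'"
    using B' sop reg' by (auto simp: big_cohen_macaulay_def)
  moreover have "(\<lambda>s. g (f s)) \<in> alg_hom R S B'"
    using fA car ring_hom_add[OF fh] ring_hom_mult[OF fh]
    by (auto simp: alg_hom_def ring_hom_def fs gadd gmult gsm f1 g1)
  ultimately show ?thesis using S unfolding seed_def by blast
qed

end

theory Submission
  imports Defs
begin

text \<open>
  The ideals \<open>I\<close> for which \<open>S / I\<close> is a seed are partially ordered by inclusion, and a maximal one
  gives a minimal seed. By Zorn's lemma it remains to see that the union \<open>U\<close> of a nonempty chain of such
  ideals is again one of them (\<open>seed_witness_Union\<close>).

  For each \<open>I\<close> in the chain, \<open>S / I\<close> maps to a big Cohen-Macaulay algebra \<open>C I\<close>. If one and the same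
  system of parameters \<open>xs\<close> is regular on all of them, then \<open>U\<close> goes to zero in the product of the
  \<open>C I\<close> modulo the families that vanish from some member of the chain on, and \<open>xs\<close> is regular on this
  reduced product: regularity says that solvable linear equations have solutions of a certain form, and
  such a statement can be checked in every factor separately. The real work is to arrange that \<open>xs\<close> is
  the same for all \<open>I\<close>, because the definition of a big Cohen-Macaulay algebra lets the system of
  parameters depend on the algebra.

  So let \<open>x\<close> be regular on a ring \<open>B\<close> and let \<open>y\<close> be another sequence of the same length such
  that \<open>x\<close> and \<open>y\<close> generate ideals with the same radical. Then \<open>y\<close> becomes regular on some
  \<open>B\<close>-algebra (\<open>exchange_regular\<close>). The proof replaces the \<open>x k\<close> by the \<open>y k\<close> one at a time, in
  the spirit of the classical proof that a completed big Cohen-Macaulay module is balanced, with generic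
  polynomials in the role of prime avoidance. Two extensions of rings carry it.

  \<^item> If a sequence is regular, it stays regular in every order on the ring of all sequences in \<open>B\<close>
  modulo those whose \<open>n\<close>-th term lies in the \<open>(n - m)\<close>-th step of the filtration by the ideals of
  powers, for some fixed shift \<open>m\<close> (\<open>regular_imp_permutable_extension\<close>).
  This plays the role of a completion. The reason is that in \<open>B\<close> itself each \<open>x k\<close> is a nonzerodivisor
  modulo the other ones, even if these are raised to powers, so that divisibility by \<open>x k\<close> loses only one
  step of the filtration.

  \<^item> If \<open>x k\<close> is a nonzerodivisor modulo an ideal and some power of \<open>x k\<close> lies in the ideal of
  \<open>w 0, w 1, \<dots>\<close>, then by McCoy's theorem the generic combination \<open>z = w 0 + w 1 T + w 2 T^2 + \<dots>\<close> is a
  nonzerodivisor in \<open>B[T]\<close> modulo the extended ideal (\<open>nzd_mod_of_pow_mem\<close> and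
  \<open>nzd_mod_generic_combination\<close>).

  Taking for the \<open>w i\<close> the element \<open>y k\<close> first and then all the elements that will stand beside it at
  the end, \<open>x k\<close> can be replaced by \<open>z\<close>, then by induction the remaining \<open>x i\<close> by the \<open>y i\<close>, and
  finally \<open>z\<close> by \<open>y k\<close>, because by then the difference of \<open>z\<close> and \<open>y k\<close> lies in the ideal of the
  others (\<open>exchange_permutable_regular\<close>).
\<close>

section \<open>Regular sequences modulo ideals\<close>

definition nzd_mod :: "('a, 'm) ring_scheme \<Rightarrow> 'a set \<Rightarrow> 'a \<Rightarrow> bool" where
  "nzd_mod R J x \<longleftrightarrow> (\<forall>u\<in>carrier R. x \<otimes>\<^bsub>R\<^esub> u \<in> J \<longrightarrow> u \<in> J)"

text \<open>
  All quotients of a ring by initial segments of a sequence are replaced by ideals of the ring itself,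
  given by a set \<open>G\<close> of generators. Thus \<open>regular_over R G xs\<close> means that \<open>xs\<close> is a (possibly
  improper) regular sequence on \<open>R / (G)\<close>, and inductions along a sequence can stay in one ring.
\<close>
fun regular_over :: "('a, 'm) ring_scheme \<Rightarrow> 'a set \<Rightarrow> 'a list \<Rightarrow> bool" where
  "regular_over R G [] \<longleftrightarrow> True"
| "regular_over R G (x # xs) \<longleftrightarrow>
     nzd_mod R (genideal R G) x \<and> regular_over R (insert x G) xs"

lemma nzd_modD:
  "nzd_mod R J x \<Longrightarrow> u \<in> carrier R \<Longrightarrow> x \<otimes>\<^bsub>R\<^esub> u \<in> J \<Longrightarrow> u \<in> J"
  by (simp add: nzd_mod_def)

lemma regular_over_append:
  "regular_over R G (xs @ ys) \<longleftrightarrow> regular_over R G xs \<and> regular_over R (G \<union> set xs) ys"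
  by (induction xs arbitrary: G) auto

lemma (in cring) idealI_cring:
  assumes "J \<subseteq> carrier R" "\<zero> \<in> J" "\<And>x y. x \<in> J \<Longrightarrow> y \<in> J \<Longrightarrow> x \<oplus> y \<in> J"
    "\<And>a x. a \<in> carrier R \<Longrightarrow> x \<in> J \<Longrightarrow> a \<otimes> x \<in> J"
  shows "ideal J R"
proof (rule idealI)
  have neg: "\<ominus> x \<in> J" if "x \<in> J" for x
    using assms(4)[of "\<ominus> \<one>" x] that assms(1) by (simp add: subset_eq l_minus)
  show "subgroup J (add_monoid R)"
    by (rule add.subgroupI) (use assms neg in \<open>auto simp: a_inv_def[symmetric]\<close>)
  show "x \<otimes> a \<in> J" if "a \<in> J" "x \<in> carrier R" for a x using assms(4) that by blast
  then show "a \<otimes> x \<in> J" if "a \<in> J" "x \<in> carrier R" for a x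
    using that assms(1) by (metis m_comm subsetD)
qed (rule ring_axioms)

context cring
begin

lemma Idl_carrier: "G \<subseteq> carrier R \<Longrightarrow> u \<in> Idl G \<Longrightarrow> u \<in> carrier R"
  using ideal.Icarr[OF genideal_ideal] .

lemma Idl_add: "G \<subseteq> carrier R \<Longrightarrow> u \<in> Idl G \<Longrightarrow> v \<in> Idl G \<Longrightarrow> u \<oplus> v \<in> Idl G"
  using additive_subgroup.a_closed[OF ideal.axioms(1)[OF genideal_ideal]] .

lemma Idl_mult: "G \<subseteq> carrier R \<Longrightarrow> a \<in> carrier R \<Longrightarrow> u \<in> Idl G \<Longrightarrow> a \<otimes> u \<in> Idl G"
  using ideal.I_l_closed[OF genideal_ideal] by blast

lemma Idl_neg: "G \<subseteq> carrier R \<Longrightarrow> u \<in> Idl G \<Longrightarrow> \<ominus> u \<in> Idl G"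
  using additive_subgroup.a_inv_closed[OF ideal.axioms(1)[OF genideal_ideal]] .

lemma Idl_zero: "G \<subseteq> carrier R \<Longrightarrow> \<zero> \<in> Idl G"
  using additive_subgroup.zero_closed[OF ideal.axioms(1)[OF genideal_ideal]] .

lemma Idl_gen: "G \<subseteq> carrier R \<Longrightarrow> g \<in> G \<Longrightarrow> g \<in> Idl G"
  using genideal_self by blast

lemma Idl_least: "ideal J R \<Longrightarrow> G \<subseteq> J \<Longrightarrow> u \<in> Idl G \<Longrightarrow> u \<in> J"
  using genideal_minimal by blast

lemma Idl_subset: "H \<subseteq> carrier R \<Longrightarrow> G \<subseteq> Idl H \<Longrightarrow> u \<in> Idl G \<Longrightarrow> u \<in> Idl H"
  by (rule Idl_least[OF genideal_ideal])

lemma Idl_mono: "H \<subseteq> carrier R \<Longrightarrow> G \<subseteq> H \<Longrightarrow> u \<in> Idl G \<Longrightarrow> u \<in> Idl H"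
  by (rule Idl_subset) (auto intro: Idl_gen)

lemma mem_Idl_insert:
  assumes "a \<in> carrier R" "G \<subseteq> carrier R"
  shows "u \<in> Idl (insert a G) \<longleftrightarrow> (\<exists>c\<in>carrier R. \<exists>w\<in>Idl G. u = a \<otimes> c \<oplus> w)"
proof
  let ?J = "{a \<otimes> c \<oplus> w | c w. c \<in> carrier R \<and> w \<in> Idl G}"
  note C = Idl_carrier[OF assms(2)]
  have "ideal ?J R"
  proof (rule idealI_cring)
    show "?J \<subseteq> carrier R" using assms C by auto
    show "\<zero> \<in> ?J" using assms Idl_zero[OF assms(2)] by (auto intro!: exI[of _ \<zero>])
  next
    fix x y assume "x \<in> ?J" "y \<in> ?J"
    then obtain c w d v where *: "x = a \<otimes> c \<oplus> w" "y = a \<otimes> d \<oplus> v"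
      "c \<in> carrier R" "d \<in> carrier R" "w \<in> Idl G" "v \<in> Idl G" by blast
    moreover have "w \<in> carrier R" "v \<in> carrier R" using * C by auto
    ultimately have "x \<oplus> y = a \<otimes> (c \<oplus> d) \<oplus> (w \<oplus> v)" using assms(1) by algebra
    with * show "x \<oplus> y \<in> ?J" using Idl_add[OF assms(2)] by blast
  next
    fix b x assume "b \<in> carrier R" "x \<in> ?J"
    then obtain c w where *: "x = a \<otimes> c \<oplus> w" "c \<in> carrier R" "w \<in> Idl G" "b \<in> carrier R" by blast
    moreover have "w \<in> carrier R" using * C by auto
    ultimately have "b \<otimes> x = a \<otimes> (b \<otimes> c) \<oplus> b \<otimes> w" using assms(1) by algebra
    with * show "b \<otimes> x \<in> ?J" using Idl_mult[OF assms(2)] by blast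
  qed
  moreover have "insert a G \<subseteq> ?J"
  proof -
    have "a = a \<otimes> \<one> \<oplus> \<zero>" using assms by simp
    moreover have "g = a \<otimes> \<zero> \<oplus> g" if "g \<in> G" for g using assms that by (simp add: subset_eq)
    ultimately show ?thesis using Idl_zero[OF assms(2)] Idl_gen[OF assms(2)] by blast
  qed
  moreover assume "u \<in> Idl (insert a G)"
  ultimately show "\<exists>c\<in>carrier R. \<exists>w\<in>Idl G. u = a \<otimes> c \<oplus> w" using Idl_least by blast
next
  have H: "insert a G \<subseteq> carrier R" using assms by simp
  assume "\<exists>c\<in>carrier R. \<exists>w\<in>Idl G. u = a \<otimes> c \<oplus> w"
  then obtain c w where *: "u = c \<otimes> a \<oplus> w" "c \<in> carrier R" "w \<in> Idl G"
    using assms(1) m_comm by metis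
  then show "u \<in> Idl (insert a G)"
    using Idl_add[OF H] Idl_mult[OF H] Idl_gen[OF H] Idl_mono[OF H, of G] by blast
qed

lemma Idl_insertE:
  assumes "u \<in> Idl (insert a G)" "a \<in> carrier R" "G \<subseteq> carrier R"
  obtains c w where "c \<in> carrier R" "w \<in> carrier R" "w \<in> Idl G" "u = a \<otimes> c \<oplus> w"
  using assms(1)[unfolded mem_Idl_insert[OF assms(2,3)]] Idl_carrier[OF assms(3)] that by auto

lemma Idl_insertI:
  assumes "u \<in> carrier R" "a \<in> carrier R" "G \<subseteq> carrier R" "c \<in> carrier R"
    and "u \<ominus> a \<otimes> c \<in> Idl G"
  shows "u \<in> Idl (insert a G)"
proof -
  have "u = a \<otimes> c \<oplus> (u \<ominus> a \<otimes> c)" using assms by algebra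
  then show ?thesis using mem_Idl_insert[OF assms(2,3), of u] assms(4,5) by metis
qed

lemma Idl_rearrange:
  assumes G: "G \<subseteq> carrier R" and w: "w \<in> Idl G" "v \<in> Idl G" and "x \<in> carrier R"
    and "x \<oplus> w = v"
  shows "x \<in> Idl G"
proof -
  have C: "w \<in> carrier R" "v \<in> carrier R" using w Idl_carrier[OF G] by auto
  have "x = (x \<oplus> w) \<oplus> \<ominus> w" using C assms(4) by algebra
  also have "\<dots> = v \<oplus> \<ominus> w" using assms(5) by simp
  also have "\<dots> \<in> Idl G" using w Idl_add Idl_neg G by auto
  finally show ?thesis .
qed

text \<open>
  The half of the permutability of regular sequences that always holds: if \<open>a, b\<close> is regular, then
  \<open>a\<close> is a nonzerodivisor modulo \<open>b\<close>. From \<open>a u = b v\<close> one gets \<open>v = a v'\<close>, and \<open>a\<close> cancels. (That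
  \<open>b\<close> is a nonzerodivisor can fail, which is what the passage to a larger ring will repair.)
\<close>
lemma nzd_mod_swap:
  assumes G: "G \<subseteq> carrier R" and a: "a \<in> carrier R" and b: "b \<in> carrier R"
    and na: "nzd_mod R (Idl G) a" and nb: "nzd_mod R (Idl (insert a G)) b"
  shows "nzd_mod R (Idl (insert b G)) a"
  unfolding nzd_mod_def
proof (intro ballI impI)
  fix u assume u: "u \<in> carrier R" "a \<otimes> u \<in> Idl (insert b G)"
  obtain v w where vw: "v \<in> carrier R" "w \<in> carrier R" "w \<in> Idl G" "a \<otimes> u = b \<otimes> v \<oplus> w"
    using Idl_insertE[OF u(2) b G] .
  have "b \<otimes> v = a \<otimes> u \<oplus> \<ominus> w" using vw a b u by algebra
  then have "b \<otimes> v \<in> Idl (insert a G)"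
    unfolding mem_Idl_insert[OF a G] using u Idl_neg[OF G vw(3)] by blast
  then have "v \<in> Idl (insert a G)" using nb vw(1) by (rule nzd_modD[rotated 2])
  then obtain v' w' where v': "v' \<in> carrier R" "w' \<in> carrier R" "w' \<in> Idl G" "v = a \<otimes> v' \<oplus> w'"
    by (rule Idl_insertE[OF _ a G])
  have "a \<otimes> (u \<ominus> b \<otimes> v') = a \<otimes> u \<ominus> b \<otimes> (a \<otimes> v')" using a b u v' by algebra
  also have "\<dots> = b \<otimes> w' \<oplus> w"
    unfolding vw(4) v'(4) using a b v' vw by algebra
  also have "\<dots> \<in> Idl G" using Idl_add[OF G Idl_mult[OF G b v'(3)] vw(3)] .
  finally have "u \<ominus> b \<otimes> v' \<in> Idl G" by (rule nzd_modD[OF na, rotated]) (use u b v' in simp)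
  then show "u \<in> Idl (insert b G)" using Idl_insertI[OF u(1) b G v'(1)] by blast
qed

lemma nzd_mod_regular_over:
  assumes "G \<subseteq> carrier R" "a \<in> carrier R" "set xs \<subseteq> carrier R"
    and "nzd_mod R (Idl G) a" "regular_over R (insert a G) xs"
  shows "nzd_mod R (Idl (G \<union> set xs)) a"
  using assms
proof (induction xs arbitrary: G)
  case (Cons b xs)
  have "nzd_mod R (Idl (insert b G)) a"
    by (rule nzd_mod_swap) (use Cons.prems in auto)
  moreover have "regular_over R (insert a (insert b G)) xs"
    using Cons.prems by (simp add: insert_commute)
  ultimately have "nzd_mod R (Idl (insert b G \<union> set xs)) a"
    by (intro Cons.IH) (use Cons.prems in auto)
  then show ?case by simp
qed simp

text \<open>
  With \<open>regular_over_mult\<close> and \<open>regular_over_pow\<close> this shows that the members of a regular sequence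
  may be raised to powers. From \<open>c u = a b w\<close> one gets \<open>u = a u'\<close>, then \<open>c u' = b w\<close> after cancelling
  \<open>a\<close>, and then \<open>u' = b v\<close>.
\<close>
lemma nzd_mod_mult:
  assumes G: "G \<subseteq> carrier R" and abc: "a \<in> carrier R" "b \<in> carrier R" "c \<in> carrier R"
    and n: "nzd_mod R (Idl G) a" "nzd_mod R (Idl (insert a G)) c" "nzd_mod R (Idl (insert b G)) c"
  shows "nzd_mod R (Idl (insert (a \<otimes> b) G)) c"
  unfolding nzd_mod_def
proof (intro ballI impI)
  fix u assume u: "u \<in> carrier R" "c \<otimes> u \<in> Idl (insert (a \<otimes> b) G)"
  have ab: "a \<otimes> b \<in> carrier R" using abc by simp
  obtain w g where w: "w \<in> carrier R" "g \<in> carrier R" "g \<in> Idl G" "c \<otimes> u = (a \<otimes> b) \<otimes> w \<oplus> g"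
    using Idl_insertE[OF u(2) ab G] .
  have "c \<otimes> u = a \<otimes> (b \<otimes> w) \<oplus> g" unfolding w(4) using abc w(1) by (simp add: m_assoc)
  then have "c \<otimes> u \<in> Idl (insert a G)"
    unfolding mem_Idl_insert[OF abc(1) G] using w abc m_closed by blast
  then have "u \<in> Idl (insert a G)" using n(2) u(1) nzd_modD by metis
  then obtain u' g' where u': "u' \<in> carrier R" "g' \<in> carrier R" "g' \<in> Idl G" "u = a \<otimes> u' \<oplus> g'"
    by (rule Idl_insertE[OF _ abc(1) G])
  have "a \<otimes> (c \<otimes> u' \<ominus> b \<otimes> w) = c \<otimes> u \<ominus> c \<otimes> g' \<ominus> (a \<otimes> b) \<otimes> w"
    unfolding u'(4) using abc u' w(1) by algebra
  also have "\<dots> = \<ominus> (c \<otimes> g') \<oplus> g" unfolding w(4) using abc u' w(1,2) by algebra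
  also have "\<dots> \<in> Idl G" using Idl_add[OF G Idl_neg[OF G Idl_mult[OF G abc(3) u'(3)]] w(3)] .
  finally have "c \<otimes> u' \<ominus> b \<otimes> w \<in> Idl G" by (rule nzd_modD[OF n(1), rotated]) (use u' w abc in simp)
  then have "c \<otimes> u' \<in> Idl (insert b G)" by (rule Idl_insertI[rotated -1]) (use abc u' w G in auto)
  then have "u' \<in> Idl (insert b G)" using n(3) u'(1) nzd_modD by metis
  then obtain v h where v: "v \<in> carrier R" "h \<in> carrier R" "h \<in> Idl G" "u' = b \<otimes> v \<oplus> h"
    by (rule Idl_insertE[OF _ abc(2) G])
  have "u = (a \<otimes> b) \<otimes> v \<oplus> (a \<otimes> h \<oplus> g')" unfolding u'(4) v(4) using abc v(1,2) u'(2) by algebra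
  moreover have "a \<otimes> h \<oplus> g' \<in> Idl G" using Idl_add[OF G Idl_mult[OF G abc(1) v(3)] u'(3)] .
  ultimately show "u \<in> Idl (insert (a \<otimes> b) G)" unfolding mem_Idl_insert[OF ab G] using v(1) by blast
qed

lemma regular_over_mult:
  assumes "G \<subseteq> carrier R" "a \<in> carrier R" "b \<in> carrier R" "set xs \<subseteq> carrier R"
    and "nzd_mod R (Idl G) a" "nzd_mod R (Idl G) b"
    and "regular_over R (insert a G) xs" "regular_over R (insert b G) xs"
  shows "regular_over R (insert (a \<otimes> b) G) xs"
  using assms
proof (induction xs arbitrary: G)
  case (Cons c xs)
  have "regular_over R (insert (a \<otimes> b) (insert c G)) xs"
  proof (rule Cons.IH)
    show "nzd_mod R (Idl (insert c G)) a" "nzd_mod R (Idl (insert c G)) b"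
      using Cons.prems by (auto intro!: nzd_mod_swap)
  qed (use Cons.prems in \<open>auto simp: insert_commute\<close>)
  then show ?case using Cons.prems by (auto simp: insert_commute intro!: nzd_mod_mult)
qed simp

lemma regular_over_pow:
  assumes "G \<subseteq> carrier R" "a \<in> carrier R" "set xs \<subseteq> carrier R"
    and "regular_over R G (a # xs)"
  shows "regular_over R G (a [^] Suc n # xs)"
proof (induction n)
  case 0 then show ?case using assms by simp
next
  case (Suc n)
  have "nzd_mod R (Idl G) (a [^] Suc n \<otimes> a)"
    unfolding nzd_mod_def
  proof (intro ballI impI)
    fix u assume u: "u \<in> carrier R" "a [^] Suc n \<otimes> a \<otimes> u \<in> Idl G"
    then have "a [^] Suc n \<otimes> (a \<otimes> u) \<in> Idl G"
      using m_assoc[of "a [^] Suc n" a u] assms(2) by simp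
    then have "a \<otimes> u \<in> Idl G" using Suc nzd_modD[of R "Idl G" "a [^] Suc n" "a \<otimes> u"] assms(2) u by auto
    then show "u \<in> Idl G" using assms(4) u nzd_modD[of R "Idl G" a u] by auto
  qed
  moreover have "regular_over R (insert (a [^] Suc n \<otimes> a) G) xs"
    using Suc assms by (intro regular_over_mult) auto
  ultimately show ?case by simp
qed

lemma regular_over_powers:
  assumes "G \<subseteq> carrier R" "v ` set ks \<subseteq> carrier R" "regular_over R G (map v ks)"
  shows "regular_over R G (map (\<lambda>i. v i [^] Suc (e i)) ks)"
  using assms
proof (induction ks arbitrary: G)
  case (Cons i ks)
  have "regular_over R (insert (v i) G) (map (\<lambda>i. v i [^] Suc (e i)) ks)"
    by (rule Cons.IH) (use Cons.prems in auto)
  then have "regular_over R G (v i # map (\<lambda>i. v i [^] Suc (e i)) ks)"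
    using Cons.prems by simp
  then show ?case unfolding list.map
    by (rule regular_over_pow[rotated -1]) (use Cons.prems in auto)
qed simp

text \<open>
  Raise all members but \<open>v j\<close> to powers. The result is still regular, and by \<open>nzd_mod_swap\<close> the
  elements after \<open>v j\<close> can be moved in front of it one by one.
\<close>
lemma nzd_mod_other_powers:
  assumes v: "v ` set ks \<subseteq> carrier R" and reg: "regular_over R {} (map v ks)"
    and "distinct ks" "j \<in> set ks"
  shows "nzd_mod R (Idl ((\<lambda>i. v i [^] Suc (e i)) ` (set ks - {j}))) (v j)"
proof -
  obtain as bs where ks: "ks = as @ j # bs" using assms(4) split_list by metis
  \<comment> \<open>The exponent is \<open>Suc (e i)\<close>, so \<open>e j = 0\<close> leaves \<open>v j\<close> as it is.\<close>
  define f where "f = (\<lambda>i. v i [^] Suc ((e(j := 0)) i))"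
  have fj: "f j = v j" using assms by (auto simp: f_def ks)
  have fC: "f i \<in> carrier R" if "i \<in> set ks" for i using v that by (auto simp: f_def)
  have "regular_over R {} (map f ks)" unfolding f_def
    by (rule regular_over_powers) (use v reg in auto)
  then have "nzd_mod R (Idl (set (map f as))) (v j)"
    "regular_over R (insert (v j) (set (map f as))) (map f bs)"
    by (simp_all add: ks regular_over_append fj)
  then have "nzd_mod R (Idl (set (map f as) \<union> set (map f bs))) (v j)"
    by (rule nzd_mod_regular_over[rotated -2]) (use fC v in \<open>auto simp: ks\<close>)
  moreover have "set (map f as) \<union> set (map f bs) = (\<lambda>i. v i [^] Suc (e i)) ` (set ks - {j})"
    using assms(3) unfolding ks f_def by (auto simp: image_Un[symmetric] image_iff)
  ultimately show ?thesis by simp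
qed

text \<open>
  The key estimate for the quasi-completion below: modulo any of the other members, dividing by \<open>v j\<close>
  loses at most one step of the filtration by the ideals generated by the \<open>n\<close>-th powers. If
  \<open>v j * u = v j^(n+1) * c + w\<close> with \<open>w\<close> in the ideal of the other generators, then \<open>v j\<close> times
  \<open>u - v j^n * c\<close> lies in that ideal, and \<open>nzd_mod_other_powers\<close> applies.
\<close>
lemma colon_power_filtration:
  assumes v: "v ` set ks \<subseteq> carrier R" and reg: "regular_over R {} (map v ks)"
    and d: "distinct ks" and j: "j \<in> set ks" and S: "S \<subseteq> set ks" "j \<notin> S"
    and u: "u \<in> carrier R" "v j \<otimes> u \<in> Idl (v ` S \<union> (\<lambda>i. v i [^] Suc n) ` set ks)"
  shows "u \<in> Idl (v ` S \<union> (\<lambda>i. v i [^] n) ` set ks)"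
proof -
  \<comment> \<open>The powers \<open>v i^(n+1)\<close> with \<open>i\<close> in \<open>S\<close> are redundant besides \<open>v i\<close>, so each \<open>i\<close> other
    than \<open>j\<close> contributes a single power.\<close>
  define e where "e = (\<lambda>i. if i \<in> S then 0 else n)"
  define E where "E = (\<lambda>i. v i [^] Suc (e i)) ` (set ks - {j})"
  define T where "T = v ` S \<union> (\<lambda>i. v i [^] n) ` set ks"
  have vC: "v i \<in> carrier R" if "i \<in> set ks" for i using v that by blast
  have EC: "E \<subseteq> carrier R" using vC by (auto simp: E_def)
  have TC: "T \<subseteq> carrier R" using vC S by (auto simp: T_def)
  have vS: "v i \<in> E" if "i \<in> S" for i
  proof -
    have "v i = v i [^] Suc (e i)" using that vC S by (auto simp: e_def)
    then show ?thesis using that S unfolding E_def by blast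
  qed
  have "v ` S \<union> (\<lambda>i. v i [^] Suc n) ` set ks \<subseteq> Idl (insert (v j [^] Suc n) E)"
  proof -
    have "v i [^] Suc n \<in> Idl E" if i: "i \<in> set ks" "i \<noteq> j" for i
    proof (cases "i \<in> S")
      case True
      then have "v i [^] n \<otimes> v i \<in> Idl E"
        by (intro Idl_mult[OF EC] Idl_gen[OF EC vS]) (use vC i in auto)
      then show ?thesis by simp
    next
      case False
      then have "v i [^] Suc n \<in> E" using i by (auto simp: E_def e_def intro!: image_eqI[of _ _ i])
      then show ?thesis by (rule Idl_gen[OF EC])
    qed
    moreover have "v i \<in> Idl E" if "i \<in> S" for i using Idl_gen[OF EC vS[OF that]] .
    moreover have I: "insert (v j [^] Suc n) E \<subseteq> carrier R" using EC vC[OF j] by simp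
    moreover have "w \<in> Idl (insert (v j [^] Suc n) E)" if "w \<in> Idl E" for w
      by (rule Idl_mono[OF I _ that]) blast
    moreover have "v j [^] Suc n \<in> Idl (insert (v j [^] Suc n) E)" by (rule Idl_gen[OF I]) simp
    ultimately show ?thesis using S by (auto simp del: nat_pow_Suc)
  qed
  then have "v j \<otimes> u \<in> Idl (insert (v j [^] Suc n) E)"
    by (rule Idl_subset[rotated 1, OF _ u(2)]) (use EC vC j in simp)
  then obtain c w where cw: "c \<in> carrier R" "w \<in> carrier R" "w \<in> Idl E"
      "v j \<otimes> u = v j [^] Suc n \<otimes> c \<oplus> w"
    by (rule Idl_insertE) (use EC vC j in auto)
  have vn: "v j [^] n \<in> carrier R" using vC j by simp
  have cancel: "a \<otimes> (u \<ominus> b \<otimes> c) = w"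
    if "a \<in> carrier R" "b \<in> carrier R" "a \<otimes> u = (b \<otimes> a) \<otimes> c \<oplus> w" for a b
  proof -
    have "a \<otimes> (u \<ominus> b \<otimes> c) = a \<otimes> u \<ominus> (b \<otimes> a) \<otimes> c" using that(1,2) u(1) cw(1) by algebra
    also have "\<dots> = w" unfolding that(3) using that(1,2) cw(1,2) by algebra
    finally show ?thesis .
  qed
  have "v j \<otimes> (u \<ominus> v j [^] n \<otimes> c) = w"
    using cancel[OF vC[OF j] vn] cw(4) by simp
  then have "v j \<otimes> (u \<ominus> v j [^] n \<otimes> c) \<in> Idl E" using cw(3) by simp
  moreover have "nzd_mod R (Idl E) (v j)"
    unfolding E_def by (rule nzd_mod_other_powers[OF v reg d j])
  moreover have "u \<ominus> v j [^] n \<otimes> c \<in> carrier R" using u(1) cw(1) vn by simp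
  ultimately have "u \<ominus> v j [^] n \<otimes> c \<in> Idl E" by (metis nzd_modD)
  then have 1: "u \<in> Idl (insert (v j [^] n) E)"
    by (rule Idl_insertI[rotated -1]) (use u vn cw EC in auto)
  have "insert (v j [^] n) E \<subseteq> Idl T"
  proof -
    have "v i [^] Suc (e i) \<in> Idl T" if i: "i \<in> set ks" for i
    proof (cases "i \<in> S")
      case True
      then have "v i [^] Suc (e i) \<in> T" using vC i by (auto simp: T_def e_def)
      then show ?thesis by (rule Idl_gen[OF TC])
    next
      case False
      have "v i [^] n \<in> Idl T" by (rule Idl_gen[OF TC]) (use i in \<open>auto simp: T_def\<close>)
      then have "v i \<otimes> v i [^] n \<in> Idl T" by (rule Idl_mult[OF TC, rotated]) (use vC i in simp)
      then show ?thesis using False vC i by (simp add: e_def m_comm)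
    qed
    moreover have "v j [^] n \<in> Idl T" by (rule Idl_gen[OF TC]) (use j in \<open>auto simp: T_def\<close>)
    ultimately show ?thesis by (auto simp: E_def)
  qed
  then show ?thesis using Idl_subset[OF TC _ 1] unfolding T_def by blast
qed

end

section \<open>Directed quotients of products\<close>

lemma ring_hom_zero_cring:
  assumes "cring R" "cring C" "h \<in> ring_hom R C" shows "h \<zero>\<^bsub>R\<^esub> = \<zero>\<^bsub>C\<^esub>"
  using ring_hom_zero[OF assms(3)] cring.axioms(1)[OF assms(1)] cring.axioms(1)[OF assms(2)] by blast

lemma ideal_hom_vimage:
  assumes R: "cring R" and C: "cring C" and h: "h \<in> ring_hom R C" and J: "ideal J C"
  shows "ideal {u \<in> carrier R. h u \<in> J} R"
proof -
  interpret R: cring R by (rule R)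
  interpret C: cring C by (rule C)
  interpret J: ideal J C by (rule J)
  show ?thesis
    by (rule R.idealI_cring)
      (use ring_hom_zero_cring[OF R C h] ring_hom_add[OF h] ring_hom_mult[OF h] ring_hom_closed[OF h]
       in \<open>auto simp: J.I_l_closed\<close>)
qed

lemma hom_Idl:
  assumes R: "cring R" and C: "cring C" and h: "h \<in> ring_hom R C"
    and A: "A \<subseteq> carrier R" and u: "u \<in> genideal R A"
  shows "h u \<in> genideal C (h ` A)"
proof -
  interpret R: cring R by (rule R)
  interpret C: cring C by (rule C)
  have hA: "h ` A \<subseteq> carrier C" using A ring_hom_closed[OF h] by auto
  have "ideal {u \<in> carrier R. h u \<in> genideal C (h ` A)} R"
    by (rule ideal_hom_vimage[OF R C h C.genideal_ideal[OF hA]])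
  moreover have "A \<subseteq> {u \<in> carrier R. h u \<in> genideal C (h ` A)}" using A C.Idl_gen[OF hA] by auto
  ultimately show ?thesis using R.Idl_least u by blast
qed

lemma surj_hom_Idl_iff:
  assumes R: "cring R" and C: "cring C" and h: "h \<in> ring_hom R C" and surj: "h ` carrier R = carrier C"
    and ker: "\<And>a b. a \<in> carrier R \<Longrightarrow> b \<in> carrier R \<Longrightarrow> h a = h b \<longleftrightarrow> a \<ominus>\<^bsub>R\<^esub> b \<in> J"
    and J: "ideal J R" and A: "A \<subseteq> carrier R" and u: "u \<in> carrier R"
  shows "h u \<in> genideal C (h ` A) \<longleftrightarrow> u \<in> genideal R (A \<union> J)"
proof -
  interpret R: cring R by (rule R)
  interpret C: cring C by (rule C)
  interpret J: ideal J R by (rule J)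
  have AJ: "A \<union> J \<subseteq> carrier R" using A J.a_subset by blast
  have hA: "h ` A \<subseteq> carrier C" using A surj by blast
  have hJ: "h x = \<zero>\<^bsub>C\<^esub>" if "x \<in> J" for x
  proof -
    have "x \<ominus>\<^bsub>R\<^esub> \<zero>\<^bsub>R\<^esub> = x" using J.Icarr[OF that] by algebra
    then show ?thesis using ker[of x "\<zero>\<^bsub>R\<^esub>"] that J.Icarr ring_hom_zero_cring[OF R C h] by auto
  qed
  show ?thesis
  proof
    assume hu: "h u \<in> genideal C (h ` A)"
    let ?K = "h ` genideal R (A \<union> J)"
    note c = R.Idl_carrier[OF AJ]
    have "ideal ?K C"
    proof (rule C.idealI_cring)
      show "?K \<subseteq> carrier C" using c surj by blast
      show "\<zero>\<^bsub>C\<^esub> \<in> ?K" using R.Idl_zero[OF AJ] ring_hom_zero_cring[OF R C h] by force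
      show "x \<oplus>\<^bsub>C\<^esub> y \<in> ?K" if xy: "x \<in> ?K" "y \<in> ?K" for x y
      proof -
        obtain a b where ab: "a \<in> genideal R (A \<union> J)" "b \<in> genideal R (A \<union> J)" "x = h a" "y = h b"
          using xy by blast
        then have "x \<oplus>\<^bsub>C\<^esub> y = h (a \<oplus>\<^bsub>R\<^esub> b)" using ring_hom_add[OF h] c by simp
        then show ?thesis using R.Idl_add[OF AJ ab(1,2)] by simp
      qed
      show "x \<otimes>\<^bsub>C\<^esub> y \<in> ?K" if xy: "x \<in> carrier C" "y \<in> ?K" for x y
      proof -
        obtain a b where ab: "a \<in> carrier R" "b \<in> genideal R (A \<union> J)" "x = h a" "y = h b"
          using xy surj by blast
        then have "x \<otimes>\<^bsub>C\<^esub> y = h (a \<otimes>\<^bsub>R\<^esub> b)" using ring_hom_mult[OF h] c by simp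
        then show ?thesis using R.Idl_mult[OF AJ ab(1,2)] by simp
      qed
    qed
    moreover have "h ` A \<subseteq> ?K" using R.Idl_gen[OF AJ] by blast
    ultimately have "h u \<in> ?K" using C.Idl_least hu by blast
    then obtain w where w: "w \<in> genideal R (A \<union> J)" "h u = h w" by blast
    then have "u \<ominus>\<^bsub>R\<^esub> w \<in> J" using ker[OF u c] by simp
    then have d: "u \<ominus>\<^bsub>R\<^esub> w \<in> genideal R (A \<union> J)" by (auto intro: R.Idl_gen[OF AJ])
    have "u = (u \<ominus>\<^bsub>R\<^esub> w) \<oplus>\<^bsub>R\<^esub> w" using u c[OF w(1)] by algebra
    then show "u \<in> genideal R (A \<union> J)" using R.Idl_add[OF AJ d w(1)] by simp
  next
    assume uA: "u \<in> genideal R (A \<union> J)"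
    have "h ` (A \<union> J) \<subseteq> genideal C (h ` A)"
      using C.Idl_gen[OF hA] C.Idl_zero[OF hA] hJ by auto
    then show "h u \<in> genideal C (h ` A)"
      by (rule C.Idl_subset[OF hA _ hom_Idl[OF R C h AJ uA]])
  qed
qed

text \<open>
  The exchange of sequences is an induction in which every step enlarges the ring, whereas the type of
  its elements must stay the same. Therefore all quotients are transported along an injection into a
  given type, by choosing representatives of the cosets.
\<close>
lemma (in cring) quotient_ring_in_type:
  fixes j :: "'a \<Rightarrow> 'h"
  assumes J: "ideal J R" and j: "inj j"
  obtains C :: "'h ring" and h where "cring C" "h \<in> ring_hom R C" "h ` carrier R = carrier C"
    "\<And>a b. a \<in> carrier R \<Longrightarrow> b \<in> carrier R \<Longrightarrow> h a = h b \<longleftrightarrow> a \<ominus> b \<in> J"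
proof -
  interpret J: ideal J R by (rule J)
  define h where "h = (\<lambda>a. j (SOME v. v \<in> J +> a))"
  have ker: "h a = h b \<longleftrightarrow> a \<ominus> b \<in> J" if ab: "a \<in> carrier R" "b \<in> carrier R" for a b
  proof -
    have m: "(SOME v. v \<in> J +> a) \<in> J +> a" if "a \<in> carrier R" for a
      by (rule someI[of _ a]) (rule J.a_rcos_self[OF that])
    have "J +> a = J +> b" if "h a = h b"
    proof -
      have "(SOME v. v \<in> J +> a) = (SOME v. v \<in> J +> b)" using that j by (simp add: h_def inj_eq)
      then have v: "(SOME v. v \<in> J +> a) \<in> J +> a" "(SOME v. v \<in> J +> a) \<in> J +> b"
        using m ab by metis+
      show ?thesis
        using J.a_repr_independence'[OF v(1) ab(1)] J.a_repr_independence'[OF v(2) ab(2)] by simp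
    qed
    then have "h a = h b \<longleftrightarrow> J +> a = J +> b" by (auto simp: h_def)
    then show ?thesis using quotient_eq_iff_same_a_r_cos[OF J ab] by simp
  qed
  then have w: "weak_ring_morphism h J R" by (intro weak_ring_morphismI[OF J])
  have hom: "h \<in> ring_hom R (image_ring h R)" by (rule weak_ring_morphism_is_hom[OF w])
  have car: "carrier (image_ring h R) = h ` carrier R" by (rule image_ring_carrier)
  interpret C: ring "image_ring h R" by (rule image_ring_is_ring[OF w])
  have "cring (image_ring h R)"
  proof (unfold_locales)
    fix x y assume "x \<in> carrier (image_ring h R)" "y \<in> carrier (image_ring h R)"
    then obtain a b where "a \<in> carrier R" "b \<in> carrier R" "x = h a" "y = h b" unfolding car by blast
    then show "x \<otimes>\<^bsub>image_ring h R\<^esub> y = y \<otimes>\<^bsub>image_ring h R\<^esub> x"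
      using ring_hom_mult[OF hom] m_comm by metis
  qed
  then show thesis using that[of "image_ring h R" h] hom car ker by simp
qed

definition prod_ring :: "('i \<Rightarrow> ('b, 'm) ring_scheme) \<Rightarrow> ('i \<Rightarrow> 'b) ring" where
  "prod_ring B = \<lparr>carrier = {f. \<forall>i. f i \<in> carrier (B i)},
     monoid.mult = \<lambda>f g i. f i \<otimes>\<^bsub>B i\<^esub> g i, monoid.one = \<lambda>i. \<one>\<^bsub>B i\<^esub>,
     ring.zero = \<lambda>i. \<zero>\<^bsub>B i\<^esub>, ring.add = \<lambda>f g i. f i \<oplus>\<^bsub>B i\<^esub> g i\<rparr>"

lemma prod_ring_sel [simp]:
  "f \<in> carrier (prod_ring B) \<longleftrightarrow> (\<forall>i. f i \<in> carrier (B i))"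
  "(f \<otimes>\<^bsub>prod_ring B\<^esub> g) = (\<lambda>i. f i \<otimes>\<^bsub>B i\<^esub> g i)"
  "\<one>\<^bsub>prod_ring B\<^esub> = (\<lambda>i. \<one>\<^bsub>B i\<^esub>)"
  "\<zero>\<^bsub>prod_ring B\<^esub> = (\<lambda>i. \<zero>\<^bsub>B i\<^esub>)"
  "(f \<oplus>\<^bsub>prod_ring B\<^esub> g) = (\<lambda>i. f i \<oplus>\<^bsub>B i\<^esub> g i)"
  by (simp_all add: prod_ring_def)

lemma prod_ring_cring:
  assumes "\<And>i. cring (B i)" shows "cring (prod_ring B)"
proof -
  interpret B: cring "B i" for i by (rule assms)
  have "abelian_group (prod_ring B)"
  proof (rule abelian_groupI)
    fix f assume "f \<in> carrier (prod_ring B)"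
    then show "\<exists>g\<in>carrier (prod_ring B). g \<oplus>\<^bsub>prod_ring B\<^esub> f = \<zero>\<^bsub>prod_ring B\<^esub>"
      by (intro bexI[of _ "\<lambda>i. \<ominus>\<^bsub>B i\<^esub> f i"]) (auto simp: B.l_neg)
  qed (auto simp: B.a_ac)
  moreover have "comm_monoid (prod_ring B)"
    by (rule comm_monoidI) (auto simp: B.m_ac)
  ultimately show ?thesis by (rule cringI) (auto simp: B.l_distr)
qed

text \<open>
  The common construction behind the quasi-completion of a single ring (where \<open>Q\<close> is the set of natural
  numbers) and the reduced product along a chain (where \<open>Q\<close> is the chain): the product of the \<open>B i\<close>
  modulo the union over \<open>p\<close> in \<open>Q\<close> of the products of the ideals \<open>N p i\<close>. The union is an ideal since it
  is directed. Membership in a finitely generated ideal of the quotient can be tested in each factor with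
  the same \<open>p\<close>, as the finitely many coefficients can be chosen factor by factor.
\<close>
lemma directed_quotient_of_product:
  fixes B :: "'i \<Rightarrow> ('b, 'm) ring_scheme" and j :: "('i \<Rightarrow> 'b) \<Rightarrow> 'h"
  assumes B: "\<And>i. cring (B i)" and N: "\<And>p i. p \<in> Q \<Longrightarrow> ideal (N p i) (B i)"
    and Q: "Q \<noteq> {}"
    and directed: "\<And>p q. p \<in> Q \<Longrightarrow> q \<in> Q \<Longrightarrow> \<exists>r\<in>Q. \<forall>i. N p i \<union> N q i \<subseteq> N r i"
    and j: "inj j"
  obtains C :: "'h ring" and h where "cring C" "h \<in> ring_hom (prod_ring B) C"
    "h ` carrier (prod_ring B) = carrier C"
    "\<And>A u. finite A \<Longrightarrow> A \<subseteq> carrier (prod_ring B) \<Longrightarrow> u \<in> carrier (prod_ring B) \<Longrightarrow>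
       h u \<in> genideal C (h ` A) \<longleftrightarrow>
       (\<exists>p\<in>Q. \<forall>i. u i \<in> genideal (B i) ((\<lambda>a. a i) ` A \<union> N p i))"
proof -
  let ?P = "prod_ring B"
  interpret B: cring "B i" for i by (rule B)
  interpret P: cring ?P by (rule prod_ring_cring[OF B])
  have NC: "N p i \<subseteq> carrier (B i)" if "p \<in> Q" for p i
    using ideal.Icarr[OF N[OF that]] by blast
  define K where "K = (\<lambda>A. {u. \<exists>p\<in>Q. \<forall>i. u i \<in> genideal (B i) ((\<lambda>a. a i) ` A \<union> N p i)})"
  have AC: "(\<lambda>a. a i) ` A \<union> N p i \<subseteq> carrier (B i)" if "A \<subseteq> carrier ?P" "p \<in> Q" for A p i
    using that NC by auto
  have up: "x \<in> genideal (B i) ((\<lambda>a. a i) ` A \<union> N r i)"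
    if "A \<subseteq> carrier ?P" "r \<in> Q" "N p i \<subseteq> N r i" "x \<in> genideal (B i) ((\<lambda>a. a i) ` A \<union> N p i)"
    for A p r i x
    by (rule B.Idl_mono[OF AC[OF that(1,2)] _ that(4)]) (use that(3) in blast)
  have Kid: "ideal (K A) ?P" if A: "A \<subseteq> carrier ?P" for A
  proof (rule P.idealI_cring)
    show "K A \<subseteq> carrier ?P" using B.Idl_carrier[OF AC[OF A]] by (fastforce simp: K_def)
    show "\<zero>\<^bsub>?P\<^esub> \<in> K A" using Q B.Idl_zero[OF AC[OF A]] by (auto simp: K_def)
    show "x \<oplus>\<^bsub>?P\<^esub> y \<in> K A" if xy: "x \<in> K A" "y \<in> K A" for x y
    proof -
      obtain p q where pq: "p \<in> Q" "q \<in> Q"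
        "\<And>i. x i \<in> genideal (B i) ((\<lambda>a. a i) ` A \<union> N p i)"
        "\<And>i. y i \<in> genideal (B i) ((\<lambda>a. a i) ` A \<union> N q i)"
        using xy unfolding K_def by blast
      obtain r where r: "r \<in> Q" "\<And>i. N p i \<union> N q i \<subseteq> N r i" using directed[OF pq(1,2)] by blast
      have "x i \<oplus>\<^bsub>B i\<^esub> y i \<in> genideal (B i) ((\<lambda>a. a i) ` A \<union> N r i)" for i
        using B.Idl_add[OF AC[OF A r(1)]] up[OF A r(1) _ pq(3)] up[OF A r(1) _ pq(4)] r(2) by simp
      then show ?thesis using r(1) by (auto simp: K_def)
    qed
    show "a \<otimes>\<^bsub>?P\<^esub> x \<in> K A" if "a \<in> carrier ?P" "x \<in> K A" for a x
      using that B.Idl_mult[OF AC[OF A]] unfolding K_def prod_ring_sel mem_Collect_eq by metis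
  qed
  define J where "J = K {}"
  have J: "ideal J ?P" unfolding J_def by (rule Kid) simp
  interpret J: ideal J ?P by (rule J)
  obtain C :: "'h ring" and h where C: "cring C" "h \<in> ring_hom ?P C" "h ` carrier ?P = carrier C"
    and ker: "\<And>a b. a \<in> carrier ?P \<Longrightarrow> b \<in> carrier ?P \<Longrightarrow> h a = h b \<longleftrightarrow> a \<ominus>\<^bsub>?P\<^esub> b \<in> J"
    using P.quotient_ring_in_type[OF J j] by blast
  have sub: "u \<in> genideal ?P (A \<union> J)"
    if "finite A" "A \<subseteq> carrier ?P" "u \<in> K A" for A u
    using that
  proof (induction A arbitrary: u rule: finite_induct)
    case empty
    then show ?case using P.Idl_gen[OF J.a_subset] by (simp add: J_def)
  next
    case (insert a A)
    have A: "A \<subseteq> carrier ?P" and a: "a \<in> carrier ?P" using insert.prems by auto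
    obtain p where p: "p \<in> Q" "\<And>i. u i \<in> genideal (B i) (insert (a i) ((\<lambda>a. a i) ` A \<union> N p i))"
      using insert.prems(2) by (auto simp: K_def)
    have "\<exists>c w. c \<in> carrier (B i) \<and> w \<in> genideal (B i) ((\<lambda>a. a i) ` A \<union> N p i) \<and>
        u i = a i \<otimes>\<^bsub>B i\<^esub> c \<oplus>\<^bsub>B i\<^esub> w" for i
    proof -
      have "a i \<in> carrier (B i)" using a by simp
      then show ?thesis using p(2)[of i] B.mem_Idl_insert[OF _ AC[OF A p(1)]] by metis
    qed
    then obtain c w where cw: "\<And>i. c i \<in> carrier (B i)"
      "\<And>i. w i \<in> genideal (B i) ((\<lambda>a. a i) ` A \<union> N p i)" "\<And>i. u i = a i \<otimes>\<^bsub>B i\<^esub> c i \<oplus>\<^bsub>B i\<^esub> w i"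
      by metis
    have "w \<in> genideal ?P (A \<union> J)" by (rule insert.IH[OF A]) (use cw p in \<open>auto simp: K_def\<close>)
    moreover have "u = a \<otimes>\<^bsub>?P\<^esub> c \<oplus>\<^bsub>?P\<^esub> w" using cw(3) by auto
    moreover have "c \<in> carrier ?P" using cw(1) by simp
    moreover have "A \<union> J \<subseteq> carrier ?P" using A J.a_subset by blast
    ultimately show ?case using P.mem_Idl_insert[OF a, of "A \<union> J" u] by auto
  qed
  have "h u \<in> genideal C (h ` A) \<longleftrightarrow> u \<in> K A"
    if A: "finite A" "A \<subseteq> carrier ?P" and u: "u \<in> carrier ?P" for A u
  proof -
    have AJ: "A \<union> J \<subseteq> K A"
    proof -
      have "a \<in> K A" if "a \<in> A" for a
        using that Q B.Idl_gen[OF AC[OF A(2)]] by (auto simp: K_def)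
      moreover have "a \<in> K A" if "a \<in> J" for a
      proof -
        obtain p where p: "p \<in> Q" "\<And>i. a i \<in> genideal (B i) (N p i)"
          using \<open>a \<in> J\<close> by (auto simp: J_def K_def)
        have "a i \<in> genideal (B i) ((\<lambda>a. a i) ` A \<union> N p i)" for i
          by (rule B.Idl_mono[OF AC[OF A(2) p(1)] _ p(2)]) blast
        then show ?thesis using p(1) by (auto simp: K_def)
      qed
      ultimately show ?thesis by blast
    qed
    have "h u \<in> genideal C (h ` A) \<longleftrightarrow> u \<in> genideal ?P (A \<union> J)"
      by (rule surj_hom_Idl_iff[OF P.cring_axioms C ker J A(2) u])
    also have "\<dots> \<longleftrightarrow> u \<in> K A"
      using sub[OF A] P.Idl_least[OF Kid[OF A(2)] AJ] by blast
    finally show ?thesis .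
  qed
  then show thesis using that[OF C] by (simp add: K_def)
qed

section \<open>Making a regular sequence permutable\<close>

text \<open>
  A family is regular in every order exactly if each member is a nonzerodivisor modulo the ideal of any
  subfamily without it. This form is visibly independent of the order and passes to subfamilies.
\<close>
definition permutable_regular :: "('a, 'm) ring_scheme \<Rightarrow> 'i set \<Rightarrow> ('i \<Rightarrow> 'a) \<Rightarrow> bool" where
  "permutable_regular R I v \<longleftrightarrow>
     (\<forall>S\<subseteq>I. \<forall>j\<in>I - S. nzd_mod R (genideal R (v ` S)) (v j))"

lemma permutable_regularD:
  "permutable_regular R I v \<Longrightarrow> S \<subseteq> I \<Longrightarrow> j \<in> I \<Longrightarrow> j \<notin> S \<Longrightarrow> nzd_mod R (genideal R (v ` S)) (v j)"
  by (simp add: permutable_regular_def)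

lemma (in cring) Idl_Un_Idl:
  assumes "A \<subseteq> carrier R" "D \<subseteq> carrier R"
  shows "Idl (A \<union> Idl D) = Idl (A \<union> D)"
proof -
  have c: "A \<union> Idl D \<subseteq> carrier R" "A \<union> D \<subseteq> carrier R" using assms Idl_carrier by auto
  have "A \<union> Idl D \<subseteq> Idl (A \<union> D)" using Idl_gen[OF c(2)] Idl_mono[OF c(2), of D] by auto
  moreover have "A \<union> D \<subseteq> Idl (A \<union> Idl D)" using Idl_gen[OF c(1)] Idl_gen[OF assms(2)] by auto
  ultimately show ?thesis using Idl_subset[OF c(1)] Idl_subset[OF c(2)] by blast
qed

text \<open>
  The ring \<open>C\<close> consists of the sequences in \<open>B\<close> modulo the union over \<open>m\<close> of the ideals of those
  sequences whose \<open>k\<close>-th term lies in the \<open>(k - m)\<close>-th ideal of the power filtration for all \<open>k\<close>. By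
  \<open>colon_power_filtration\<close>, dividing by \<open>v j\<close> replaces \<open>m\<close> by \<open>Suc m\<close>, which is harmless in the
  union. A completion would serve as well, but without a Cauchy condition on the sequences no closedness
  of ideals has to be proved. The unit ideal is tracked so that proper sequences stay proper. The
  injection \<open>inc\<close> prescribes the type of \<open>C\<close>.
\<close>
lemma regular_imp_permutable_extension:
  fixes B :: "('b, 'm) ring_scheme" and inc :: "(nat \<Rightarrow> 'b) \<Rightarrow> 'h"
  assumes B: "cring B" and v: "v ` set ks \<subseteq> carrier B" and reg: "regular_over B {} (map v ks)"
    and d: "distinct ks" and inc: "inj inc"
  obtains C :: "'h ring" and h where "cring C" "h \<in> ring_hom B C"
    "permutable_regular C (set ks) (h \<circ> v)"
    "\<one>\<^bsub>C\<^esub> \<in> genideal C ((h \<circ> v) ` set ks) \<Longrightarrow> \<one>\<^bsub>B\<^esub> \<in> genideal B (v ` set ks)"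
proof -
  interpret B: cring B by (rule B)
  define D where "D = (\<lambda>n::nat. (\<lambda>i. v i [^]\<^bsub>B\<^esub> n) ` set ks)"
  \<comment> \<open>For \<open>k \<le> m\<close> this is the ideal of zeroth powers, which imposes no condition on the \<open>k\<close>-th term
    (unless the family is empty).\<close>
  define N where "N = (\<lambda>m k. genideal B (D (k - m)))"
  have vC: "v i \<in> carrier B" if "i \<in> set ks" for i using v that by blast
  have DC: "D n \<subseteq> carrier B" for n using vC by (auto simp: D_def)
  have Dmono: "genideal B (D n') \<subseteq> genideal B (D n)" if "n \<le> n'" for n n'
  proof -
    have "v i [^]\<^bsub>B\<^esub> n' \<in> genideal B (D n)" if i: "i \<in> set ks" for i
    proof -
      have "v i [^]\<^bsub>B\<^esub> n' = v i [^]\<^bsub>B\<^esub> (n' - n) \<otimes>\<^bsub>B\<^esub> v i [^]\<^bsub>B\<^esub> n"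
        using \<open>n \<le> n'\<close> vC[OF i] by (simp add: B.nat_pow_mult)
      then show ?thesis
        using B.Idl_mult[OF DC _ B.Idl_gen[OF DC], of _ "v i [^]\<^bsub>B\<^esub> n" n] vC[OF i] i
        by (auto simp: D_def)
    qed
    then have "D n' \<subseteq> genideal B (D n)" by (auto simp: D_def)
    then show ?thesis using B.Idl_subset[OF DC] by blast
  qed
  have 1: "\<And>i::nat. cring B" by (rule B)
  have 2: "ideal (N m k) B" for m k unfolding N_def by (rule B.genideal_ideal[OF DC])
  have 3: "\<exists>r\<in>UNIV. \<forall>i. N p i \<union> N q i \<subseteq> N r i" for p q
  proof (rule bexI[of _ "max p q"])
    show "\<forall>i. N p i \<union> N q i \<subseteq> N (max p q) i"
      unfolding N_def using Dmono[OF diff_le_mono2] by (meson Un_least max.cobounded1 max.cobounded2)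
  qed simp
  let ?P = "prod_ring (\<lambda>_::nat. B)"
  obtain C :: "'h ring" and H where C: "cring C" "H \<in> ring_hom ?P C" "H ` carrier ?P = carrier C"
    and H: "\<And>A u. finite A \<Longrightarrow> A \<subseteq> carrier ?P \<Longrightarrow> u \<in> carrier ?P \<Longrightarrow>
       H u \<in> genideal C (H ` A) \<longleftrightarrow>
       (\<exists>p\<in>UNIV. \<forall>i. u i \<in> genideal B ((\<lambda>a. a i) ` A \<union> N p i))"
    using directed_quotient_of_product[OF 1 2 UNIV_not_empty 3 inc] by metis
  define h where "h = (\<lambda>b. H (\<lambda>_. b))"
  have hom: "h \<in> ring_hom B C"
    using ring_hom_add[OF C(2)] ring_hom_mult[OF C(2)] ring_hom_one[OF C(2)] ring_hom_closed[OF C(2)]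
    by (intro ring_hom_memI) (fastforce simp: h_def)+
  have HS: "H u \<in> genideal C ((h \<circ> v) ` S) \<longleftrightarrow> (\<exists>m. \<forall>k. u k \<in> genideal B (v ` S \<union> D (k - m)))"
    if S: "S \<subseteq> set ks" and u: "\<And>k. u k \<in> carrier B" for S u
  proof -
    have SC: "v ` S \<subseteq> carrier B" using S vC by blast
    let ?A = "(\<lambda>b _. b) ` v ` S"
    have "finite ?A" "?A \<subseteq> carrier ?P" using finite_subset[OF S] S vC by auto
    then have "H u \<in> genideal C (H ` ?A) \<longleftrightarrow>
        (\<exists>p\<in>UNIV. \<forall>i. u i \<in> genideal B ((\<lambda>a. a i) ` ?A \<union> N p i))"
      by (rule H) (use u in simp)
    moreover have "H ` ?A = (h \<circ> v) ` S" by (auto simp: h_def image_image)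
    moreover have "(\<lambda>a. a i) ` ?A = v ` S" for i :: nat by (simp add: image_image)
    ultimately show ?thesis by (simp add: N_def B.Idl_Un_Idl[OF SC DC])
  qed
  have "permutable_regular C (set ks) (h \<circ> v)"
    unfolding permutable_regular_def nzd_mod_def
  proof (intro allI impI ballI)
    fix S j c
    assume S: "S \<subseteq> set ks" and j: "j \<in> set ks - S" and c: "c \<in> carrier C"
      and m: "(h \<circ> v) j \<otimes>\<^bsub>C\<^esub> c \<in> genideal C ((h \<circ> v) ` S)"
    obtain u where u: "u \<in> carrier ?P" "c = H u" using c C(3) by blast
    have uC: "u k \<in> carrier B" for k using u(1) by simp
    have "(h \<circ> v) j \<otimes>\<^bsub>C\<^esub> c = H (\<lambda>k. v j \<otimes>\<^bsub>B\<^esub> u k)"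
      using ring_hom_mult[OF C(2), of "\<lambda>_. v j" u] u vC j by (simp add: h_def)
    then obtain m where m: "\<And>k. v j \<otimes>\<^bsub>B\<^esub> u k \<in> genideal B (v ` S \<union> D (k - m))"
      using m HS[OF S, of "\<lambda>k. v j \<otimes>\<^bsub>B\<^esub> u k"] uC vC j by auto
    have "u k \<in> genideal B (v ` S \<union> D (k - Suc m))" for k
    proof (cases "k - m")
      case 0
      have "v ` S \<union> D (k - Suc m) \<subseteq> carrier B" using DC S vC by blast
      moreover have "\<one>\<^bsub>B\<^esub> \<in> v ` S \<union> D (k - Suc m)" using 0 j by (auto simp: D_def)
      ultimately show ?thesis
        using B.Idl_mult[OF _ uC B.Idl_gen, of "v ` S \<union> D (k - Suc m)" "\<one>\<^bsub>B\<^esub>" k] uC[of k] by simp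
    next
      case (Suc n)
      then have n: "k - Suc m = n" by simp
      show ?thesis unfolding n D_def
        by (rule B.colon_power_filtration[OF v reg d]) (use j S uC m[of k] Suc in \<open>auto simp: D_def\<close>)
    qed
    then show "c \<in> genideal C ((h \<circ> v) ` S)" using HS[OF S, of u] uC u(2) by blast
  qed
  moreover have "\<one>\<^bsub>B\<^esub> \<in> genideal B (v ` set ks)" if one: "\<one>\<^bsub>C\<^esub> \<in> genideal C ((h \<circ> v) ` set ks)"
  proof -
    have "H (\<lambda>_. \<one>\<^bsub>B\<^esub>) = \<one>\<^bsub>C\<^esub>" using ring_hom_one[OF C(2)] by simp
    then have "\<exists>m. \<forall>k. \<one>\<^bsub>B\<^esub> \<in> genideal B (v ` set ks \<union> D (k - m))"
      using HS[OF subset_refl B.one_closed] one by simp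
    then obtain m where m: "\<And>k. \<one>\<^bsub>B\<^esub> \<in> genideal B (v ` set ks \<union> D (k - m))" by blast
    have "D 1 = v ` set ks" using vC by (auto simp: D_def)
    then show ?thesis using m[of "Suc m"] by simp
  qed
  ultimately show thesis using that[OF C(1) hom] by blast
qed

section \<open>McCoy's theorem and generic combinations\<close>

lemma (in cring) finsum_in_ideal:
  assumes A: "ideal A R" and "finite F" and "\<And>i. i \<in> F \<Longrightarrow> f i \<in> A"
  shows "finsum R f F \<in> A"
  using assms(2,3)
proof (induction F rule: finite_induct)
  case empty
  then show ?case using additive_subgroup.zero_closed[OF ideal.axioms(1)[OF A]] by simp
next
  case (insert i F)
  have "f k \<in> carrier R" if "k \<in> insert i F" for k
    using insert.prems[OF that] ideal.Icarr[OF A] by blast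
  then have "finsum R f (insert i F) = f i \<oplus> finsum R f F" using insert.hyps by (simp add: Pi_def)
  then show ?case
    using insert additive_subgroup.a_closed[OF ideal.axioms(1)[OF A]] by simp
qed

definition coeff_ideal :: "('a, 'm) ring_scheme \<Rightarrow> 'a set \<Rightarrow> (nat \<Rightarrow> 'a) set" where
  "coeff_ideal R A = {p \<in> carrier (UP R). \<forall>n. up_ring.coeff (UP R) p n \<in> A}"

text \<open>
  The polynomial \<open>y 0 + y 1 T + y 2 T^2 + \<dots>\<close>, in Horner form so that McCoy's theorem can be proved by
  induction on the list of coefficients.
\<close>
primrec generic_combination :: "('a, 'm) ring_scheme \<Rightarrow> 'a list \<Rightarrow> (nat \<Rightarrow> 'a)" where
  "generic_combination R [] = \<zero>\<^bsub>UP R\<^esub>"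
| "generic_combination R (y # ys) = up_ring.monom (UP R) y 0 \<oplus>\<^bsub>UP R\<^esub>
     up_ring.monom (UP R) \<one>\<^bsub>R\<^esub> 1 \<otimes>\<^bsub>UP R\<^esub> generic_combination R ys"

context UP_cring
begin

abbreviation cf :: "(nat \<Rightarrow> 'a) \<Rightarrow> nat \<Rightarrow> 'a" where "cf \<equiv> up_ring.coeff P"
abbreviation const :: "'a \<Rightarrow> nat \<Rightarrow> 'a" where "const a \<equiv> up_ring.monom P a 0"
abbreviation var :: "nat \<Rightarrow> 'a" where "var \<equiv> up_ring.monom P \<one> 1"

(* Otherwise simp turns every product of polynomials into a convolution sum. *)
declare coeff_mult [simp del]

lemma coeff_ideal_iff: "p \<in> coeff_ideal R A \<longleftrightarrow> p \<in> carrier P \<and> (\<forall>n. cf p n \<in> A)"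
  by (simp add: coeff_ideal_def P_def)

lemma coeff_const_mult: "c \<in> carrier R \<Longrightarrow> p \<in> carrier P \<Longrightarrow> cf (const c \<otimes>\<^bsub>P\<^esub> p) n = c \<otimes> cf p n"
  using coeff_monom_mult[of c p 0 n] by simp

lemma coeff_X_mult:
  assumes "p \<in> carrier P"
  shows "cf (var \<otimes>\<^bsub>P\<^esub> p) 0 = \<zero>" "cf (var \<otimes>\<^bsub>P\<^esub> p) (Suc n) = cf p n"
  using assms coeff_monom_mult[of \<one> p 1 n] by (simp_all add: coeff_mult)

lemma coeff_ideal_ideal:
  assumes A: "ideal A R" shows "ideal (coeff_ideal R A) P"
proof (rule P.idealI_cring)
  interpret A: ideal A R by (rule A)
  show "coeff_ideal R A \<subseteq> carrier P" by (auto simp: coeff_ideal_iff)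
  show "\<zero>\<^bsub>P\<^esub> \<in> coeff_ideal R A" by (simp add: coeff_ideal_iff)
  show "x \<oplus>\<^bsub>P\<^esub> y \<in> coeff_ideal R A" if "x \<in> coeff_ideal R A" "y \<in> coeff_ideal R A" for x y
    using that by (simp add: coeff_ideal_iff)
  show "a \<otimes>\<^bsub>P\<^esub> x \<in> coeff_ideal R A" if "a \<in> carrier P" "x \<in> coeff_ideal R A" for a x
    using that by (auto simp: coeff_ideal_iff coeff_mult intro!: R.finsum_in_ideal[OF A] A.I_l_closed)
qed

lemma Idl_const_iff:
  assumes A: "A \<subseteq> carrier R" and p: "p \<in> carrier P"
  shows "p \<in> genideal P (const ` A) \<longleftrightarrow> (\<forall>n. cf p n \<in> genideal R A)"
proof
  note id = R.genideal_ideal[OF A]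
  have "const ` A \<subseteq> coeff_ideal R (genideal R A)"
    using A R.Idl_gen[OF A] R.Idl_zero[OF A] by (auto simp: coeff_ideal_iff)
  moreover assume "p \<in> genideal P (const ` A)"
  ultimately have "p \<in> coeff_ideal R (genideal R A)"
    using P.Idl_least[OF coeff_ideal_ideal[OF id]] by blast
  then show "\<forall>n. cf p n \<in> genideal R A" by (simp add: coeff_ideal_iff)
next
  have AP: "const ` A \<subseteq> carrier P" using A by auto
  assume *: "\<forall>n. cf p n \<in> genideal R A"
  have "up_ring.monom P (cf p i) i \<in> genideal P (const ` A)" for i
  proof -
    have "const (cf p i) \<in> genideal P (const ` A)"
      by (rule hom_Idl[OF R.cring_axioms P.cring_axioms const_ring_hom A]) (use * in simp)
    moreover have "up_ring.monom P (cf p i) i = up_ring.monom P \<one> i \<otimes>\<^bsub>P\<^esub> const (cf p i)"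
      using monom_mult[of \<one> "cf p i" i 0] p by simp
    ultimately show ?thesis using P.Idl_mult[OF AP, of "up_ring.monom P \<one> i"] by simp
  qed
  then have "(\<Oplus>\<^bsub>P\<^esub> i \<in> {..deg R p}. up_ring.monom P (cf p i) i) \<in> genideal P (const ` A)"
    by (intro P.finsum_in_ideal[OF P.genideal_ideal[OF AP]]) auto
  then show "p \<in> genideal P (const ` A)" using up_repr[OF p] by simp
qed

lemma generic_combination_closed: "set ys \<subseteq> carrier R \<Longrightarrow> generic_combination R ys \<in> carrier P"
  by (induction ys) (auto simp: P_def[symmetric])

text \<open>
  If \<open>(y + T f) q\<close> vanishes modulo \<open>A\<close>, so does \<open>y^s q\<close> for some \<open>s\<close>: comparing the lowest
  coefficients that do not yet vanish shows that multiplication by \<open>y\<close> kills one more coefficient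
  each time, and \<open>q\<close> has only finitely many.
\<close>
lemma mccoy_nilpotent:
  assumes A: "ideal A R" and y: "y \<in> carrier R" and f: "f \<in> carrier P" and q: "q \<in> carrier P"
    and F: "(const y \<oplus>\<^bsub>P\<^esub> var \<otimes>\<^bsub>P\<^esub> f) \<otimes>\<^bsub>P\<^esub> q \<in> coeff_ideal R A"
  shows "\<exists>s. const (y [^] (s::nat)) \<otimes>\<^bsub>P\<^esub> q \<in> coeff_ideal R A"
proof -
  interpret A: ideal A R by (rule A)
  interpret AP: ideal "coeff_ideal R A" P by (rule coeff_ideal_ideal[OF A])
  let ?F = "const y \<oplus>\<^bsub>P\<^esub> var \<otimes>\<^bsub>P\<^esub> f"
  have FP: "?F \<in> carrier P" using y f by simp
  have "\<forall>n<k. y [^] k \<otimes> cf q n \<in> A" for k :: nat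
  proof (induction k)
    case (Suc k)
    define q' where "q' = const (y [^] k) \<otimes>\<^bsub>P\<^esub> q"
    have q': "q' \<in> carrier P" using y q by (simp add: q'_def)
    have cq': "cf q' n = y [^] k \<otimes> cf q n" for n
      unfolding q'_def by (rule coeff_const_mult) (use y q in auto)
    have low: "cf q' n \<in> A" if "n < k" for n using Suc that by (simp add: cq')
    have "?F \<otimes>\<^bsub>P\<^esub> q' = const (y [^] k) \<otimes>\<^bsub>P\<^esub> (?F \<otimes>\<^bsub>P\<^esub> q)"
      unfolding q'_def by (rule P.m_lcomm) (use FP y q in auto)
    then have "?F \<otimes>\<^bsub>P\<^esub> q' \<in> coeff_ideal R A" using AP.I_l_closed[OF F, of "const (y [^] k)"] y by simp
    then have F1: "cf (?F \<otimes>\<^bsub>P\<^esub> q') k \<in> A" unfolding coeff_ideal_iff by blast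
    have F2: "?F \<otimes>\<^bsub>P\<^esub> q' = const y \<otimes>\<^bsub>P\<^esub> q' \<oplus>\<^bsub>P\<^esub> var \<otimes>\<^bsub>P\<^esub> (f \<otimes>\<^bsub>P\<^esub> q')"
      using y f q' by (simp add: P.l_distr P.m_assoc)
    have "cf (const y \<otimes>\<^bsub>P\<^esub> q' \<oplus>\<^bsub>P\<^esub> var \<otimes>\<^bsub>P\<^esub> (f \<otimes>\<^bsub>P\<^esub> q')) k \<in> A"
      using F1 unfolding F2 .
    then have e: "y \<otimes> cf q' k \<oplus> cf (var \<otimes>\<^bsub>P\<^esub> (f \<otimes>\<^bsub>P\<^esub> q')) k \<in> A"
      using y f q' coeff_const_mult[OF y q', of k] by simp
    have "cf (var \<otimes>\<^bsub>P\<^esub> (f \<otimes>\<^bsub>P\<^esub> q')) k \<in> A"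
    proof (cases k)
      case 0
      then show ?thesis using coeff_X_mult(1)[of "f \<otimes>\<^bsub>P\<^esub> q'"] f q' A.zero_closed by simp
    next
      case (Suc k')
      have "cf (f \<otimes>\<^bsub>P\<^esub> q') k' \<in> A"
        unfolding coeff_mult[OF f q']
        by (rule R.finsum_in_ideal[OF A]) (use low Suc f in \<open>auto intro!: A.I_l_closed\<close>)
      then show ?thesis using coeff_X_mult(2)[of "f \<otimes>\<^bsub>P\<^esub> q'"] f q' Suc by simp
    qed
    then have "y \<otimes> cf q' k \<in> A"
      using e y q' R.Idl_rearrange[OF A.a_subset, of "cf (var \<otimes>\<^bsub>P\<^esub> (f \<otimes>\<^bsub>P\<^esub> q')) k" _ "y \<otimes> cf q' k"]
        R.Idl_least[OF A subset_refl] R.Idl_gen[OF A.a_subset] by (metis R.m_closed coeff_closed)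
    then have top: "y [^] Suc k \<otimes> cf q k \<in> A"
      using y q by (simp add: cq' R.m_ac)
    have "y [^] Suc k \<otimes> cf q n \<in> A" if "n < k" for n
      using A.I_l_closed[OF low[OF that], of y] y q by (simp add: cq' R.m_ac)
    then show ?case using top less_antisym by blast
  qed simp
  then have low: "y [^] Suc (deg R q) \<otimes> cf q n \<in> A" if "n < Suc (deg R q)" for n using that by blast
  have "y [^] Suc (deg R q) \<otimes> cf q n \<in> A" for n
    using low[of n] deg_aboveD[OF _ q, of n] y q A.zero_closed
    by (cases "n < Suc (deg R q)") (simp_all only: R.r_null R.nat_pow_closed less_Suc_eq_le not_le)
  then have "const (y [^] Suc (deg R q)) \<otimes>\<^bsub>P\<^esub> q \<in> coeff_ideal R A"
    unfolding coeff_ideal_iff using y q coeff_const_mult[of "y [^] Suc (deg R q)" q] by simp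
  then show ?thesis by blast
qed

text \<open>
  McCoy's theorem modulo an ideal. Choose the last multiple \<open>y^t q\<close> that does not vanish modulo \<open>A\<close>.
  It is killed by \<open>y\<close>, hence also by \<open>T f\<close> and by \<open>f\<close>, and the induction hypothesis applies to it.
\<close>
lemma mccoy:
  assumes A: "ideal A R"
  shows "set ys \<subseteq> carrier R \<Longrightarrow> q \<in> carrier P \<Longrightarrow> q \<notin> coeff_ideal R A \<Longrightarrow>
    generic_combination R ys \<otimes>\<^bsub>P\<^esub> q \<in> coeff_ideal R A \<Longrightarrow>
    \<exists>b\<in>carrier R. const b \<otimes>\<^bsub>P\<^esub> q \<notin> coeff_ideal R A \<and>
      (\<forall>y\<in>set ys. const y \<otimes>\<^bsub>P\<^esub> (const b \<otimes>\<^bsub>P\<^esub> q) \<in> coeff_ideal R A)"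
proof (induction ys arbitrary: q)
  case Nil
  then show ?case by (auto intro!: bexI[of _ \<one>])
next
  case (Cons y ys)
  interpret AP: ideal "coeff_ideal R A" P by (rule coeff_ideal_ideal[OF A])
  define f where "f = generic_combination R ys"
  have y: "y \<in> carrier R" and f: "f \<in> carrier P" and q: "q \<in> carrier P"
    using Cons.prems generic_combination_closed by (auto simp: f_def)
  let ?F = "const y \<oplus>\<^bsub>P\<^esub> var \<otimes>\<^bsub>P\<^esub> f"
  have F: "?F \<otimes>\<^bsub>P\<^esub> q \<in> coeff_ideal R A" using Cons.prems(4) by (simp add: f_def P_def)
  define s where "s = (LEAST s::nat. const (y [^] s) \<otimes>\<^bsub>P\<^esub> q \<in> coeff_ideal R A)"
  have s: "const (y [^] s) \<otimes>\<^bsub>P\<^esub> q \<in> coeff_ideal R A"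
    unfolding s_def by (rule LeastI_ex) (rule mccoy_nilpotent[OF A y f q F])
  have "s \<noteq> 0"
  proof
    assume "s = 0"
    then have "\<one>\<^bsub>P\<^esub> \<otimes>\<^bsub>P\<^esub> q \<in> coeff_ideal R A" using s by (simp only: R.nat_pow_0 monom_one)
    then show False using Cons.prems(3) q by simp
  qed
  then obtain t where t: "s = Suc t" using not0_implies_Suc by blast
  define q' where "q' = const (y [^] t) \<otimes>\<^bsub>P\<^esub> q"
  have q': "q' \<in> carrier P" using y q by (simp add: q'_def)
  have q'n: "q' \<notin> coeff_ideal R A"
    unfolding q'_def using not_less_Least[of t "\<lambda>s::nat. const (y [^] s) \<otimes>\<^bsub>P\<^esub> q \<in> coeff_ideal R A"] t
    by (simp add: s_def)
  have const_mult: "const (a \<otimes> b) = const a \<otimes>\<^bsub>P\<^esub> const b"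
    if "a \<in> carrier R" "b \<in> carrier R" for a b using monom_mult[OF that, of 0 0] by simp
  have yq': "const y \<otimes>\<^bsub>P\<^esub> q' \<in> coeff_ideal R A"
  proof -
    have "const y \<otimes>\<^bsub>P\<^esub> q' = const (y \<otimes> y [^] t) \<otimes>\<^bsub>P\<^esub> q"
      unfolding q'_def using const_mult[of y "y [^] t"] y q P.m_assoc by simp
    then show ?thesis using s y by (simp add: t R.m_comm)
  qed
  have "?F \<otimes>\<^bsub>P\<^esub> q' = const (y [^] t) \<otimes>\<^bsub>P\<^esub> (?F \<otimes>\<^bsub>P\<^esub> q)"
    unfolding q'_def by (rule P.m_lcomm) (use f y q in auto)
  then have Fq': "?F \<otimes>\<^bsub>P\<^esub> q' \<in> coeff_ideal R A"
    using AP.I_l_closed[OF F, of "const (y [^] t)"] y by simp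
  have Tf: "var \<otimes>\<^bsub>P\<^esub> (f \<otimes>\<^bsub>P\<^esub> q') \<in> coeff_ideal R A"
  proof -
    have C: "const y \<otimes>\<^bsub>P\<^esub> q' \<in> carrier P" "var \<otimes>\<^bsub>P\<^esub> (f \<otimes>\<^bsub>P\<^esub> q') \<in> carrier P"
      using y f q' by auto
    have "var \<otimes>\<^bsub>P\<^esub> (f \<otimes>\<^bsub>P\<^esub> q') = ?F \<otimes>\<^bsub>P\<^esub> q' \<ominus>\<^bsub>P\<^esub> const y \<otimes>\<^bsub>P\<^esub> q'"
    proof -
      have "?F \<otimes>\<^bsub>P\<^esub> q' = const y \<otimes>\<^bsub>P\<^esub> q' \<oplus>\<^bsub>P\<^esub> var \<otimes>\<^bsub>P\<^esub> (f \<otimes>\<^bsub>P\<^esub> q')"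
        using y f q' by (simp add: P.l_distr P.m_assoc)
      then show ?thesis using C by (simp add: a_minus_def P.a_comm P.r_neg1)
    qed
    then show ?thesis using Fq' yq' by (simp add: a_minus_def AP.a_closed)
  qed
  have "f \<otimes>\<^bsub>P\<^esub> q' \<in> coeff_ideal R A"
    unfolding coeff_ideal_iff
  proof (intro conjI allI)
    fix n
    show "cf (f \<otimes>\<^bsub>P\<^esub> q') n \<in> A"
      using Tf coeff_X_mult(2)[of "f \<otimes>\<^bsub>P\<^esub> q'" n] f q' unfolding coeff_ideal_iff
      by (metis P.m_closed)
  qed (use f q' in simp)
  then obtain b where b: "b \<in> carrier R" "const b \<otimes>\<^bsub>P\<^esub> q' \<notin> coeff_ideal R A"
    "\<And>z. z \<in> set ys \<Longrightarrow> const z \<otimes>\<^bsub>P\<^esub> (const b \<otimes>\<^bsub>P\<^esub> q') \<in> coeff_ideal R A"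
    using Cons.IH[OF _ q' q'n] Cons.prems(1) by (auto simp: f_def)
  have e: "const (b \<otimes> y [^] t) \<otimes>\<^bsub>P\<^esub> q = const b \<otimes>\<^bsub>P\<^esub> q'"
    unfolding q'_def using const_mult[of b "y [^] t"] b(1) y q P.m_assoc by simp
  have "const y \<otimes>\<^bsub>P\<^esub> (const b \<otimes>\<^bsub>P\<^esub> q') = const b \<otimes>\<^bsub>P\<^esub> (const y \<otimes>\<^bsub>P\<^esub> q')"
    by (rule P.m_lcomm) (use y b q' in auto)
  then have "const y \<otimes>\<^bsub>P\<^esub> (const b \<otimes>\<^bsub>P\<^esub> q') \<in> coeff_ideal R A"
    using AP.I_l_closed[OF yq'] b(1) by simp
  then show ?case using b y by (intro bexI[of _ "b \<otimes> y [^] t"]) (auto simp: e)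
qed

text \<open>
  The multiple of \<open>q\<close> that \<open>mccoy\<close> provides is killed by all \<open>y\<close>, so the hypothesis on the ideal \<open>(G)\<close>
  forces its coefficients to vanish.
\<close>
lemma nzd_mod_generic_combination:
  assumes G: "G \<subseteq> carrier R" and ys: "set ys \<subseteq> carrier R"
    and colon: "\<And>u. u \<in> carrier R \<Longrightarrow> (\<And>y. y \<in> set ys \<Longrightarrow> y \<otimes> u \<in> genideal R G) \<Longrightarrow> u \<in> genideal R G"
  shows "nzd_mod P (genideal P (const ` G)) (generic_combination R ys)"
proof -
  have "coeff_ideal R (genideal R G) = genideal P (const ` G)"
  proof (rule Set.set_eqI)
    fix q
    have "q \<in> carrier P" if "q \<in> genideal P (const ` G)"
      by (rule P.Idl_carrier[OF _ that]) (use G in auto)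
    then show "q \<in> coeff_ideal R (genideal R G) \<longleftrightarrow> q \<in> genideal P (const ` G)"
      using Idl_const_iff[OF G, of q] unfolding coeff_ideal_iff by blast
  qed
  moreover have "q \<in> coeff_ideal R (genideal R G)"
    if q: "q \<in> carrier P" "generic_combination R ys \<otimes>\<^bsub>P\<^esub> q \<in> coeff_ideal R (genideal R G)" for q
  proof (rule ccontr)
    assume "q \<notin> coeff_ideal R (genideal R G)"
    then obtain b where b: "b \<in> carrier R" "const b \<otimes>\<^bsub>P\<^esub> q \<notin> coeff_ideal R (genideal R G)"
      "\<And>y. y \<in> set ys \<Longrightarrow> const y \<otimes>\<^bsub>P\<^esub> (const b \<otimes>\<^bsub>P\<^esub> q) \<in> coeff_ideal R (genideal R G)"
      using mccoy[OF R.genideal_ideal[OF G] ys q(1) _ q(2)] by blast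
    have bq: "const b \<otimes>\<^bsub>P\<^esub> q \<in> carrier P" using b q by simp
    have "cf (const b \<otimes>\<^bsub>P\<^esub> q) n \<in> genideal R G" for n
    proof (rule colon)
      fix y assume y: "y \<in> set ys"
      have "cf (const y \<otimes>\<^bsub>P\<^esub> (const b \<otimes>\<^bsub>P\<^esub> q)) n \<in> genideal R G"
        using b(3)[OF y] unfolding coeff_ideal_iff by blast
      then show "y \<otimes> cf (const b \<otimes>\<^bsub>P\<^esub> q) n \<in> genideal R G"
        using coeff_const_mult[OF _ bq, of y n] y ys by (simp only: subset_eq)
    qed (rule coeff_closed[OF bq])
    then show False using b(2) bq by (simp add: coeff_ideal_iff)
  qed
  ultimately show ?thesis by (simp add: nzd_mod_def)
qed

end

section \<open>Exchanging regular sequences\<close>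

lemma nzd_mod_surj_hom:
  assumes "h \<in> ring_hom R C" "h ` carrier R = carrier C" "x \<in> carrier R"
    and "\<And>u. u \<in> carrier R \<Longrightarrow> h u \<in> K \<longleftrightarrow> u \<in> J" and "monoid R"
  shows "nzd_mod C K (h x) \<longleftrightarrow> nzd_mod R J x"
proof -
  have "h x \<otimes>\<^bsub>C\<^esub> h u = h (x \<otimes>\<^bsub>R\<^esub> u)" "x \<otimes>\<^bsub>R\<^esub> u \<in> carrier R" if "u \<in> carrier R" for u
    using ring_hom_mult[OF assms(1,3) that] monoid.m_closed[OF assms(5,3) that] by simp_all
  then show ?thesis
    unfolding nzd_mod_def assms(2)[symmetric] ball_simps using assms(4) by auto
qed

lemma cring_in_type:
  fixes inc :: "'a \<Rightarrow> 'h" and R :: "('a, 'm) ring_scheme"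
  assumes R: "cring R" and inc: "inj inc"
  obtains C :: "'h ring" and h where "cring C" "h \<in> ring_hom R C" "h ` carrier R = carrier C"
    "\<And>A u. A \<subseteq> carrier R \<Longrightarrow> u \<in> carrier R \<Longrightarrow> h u \<in> genideal C (h ` A) \<longleftrightarrow> u \<in> genideal R A"
proof -
  interpret R: cring R by (rule R)
  obtain C :: "'h ring" and h where C: "cring C" "h \<in> ring_hom R C" "h ` carrier R = carrier C"
    "\<And>a b. a \<in> carrier R \<Longrightarrow> b \<in> carrier R \<Longrightarrow> h a = h b \<longleftrightarrow> a \<ominus>\<^bsub>R\<^esub> b \<in> {\<zero>\<^bsub>R\<^esub>}"
    by (rule R.quotient_ring_in_type[OF R.zeroideal inc]) (rule that)
  have "h u \<in> genideal C (h ` A) \<longleftrightarrow> u \<in> genideal R A" if A: "A \<subseteq> carrier R" and u: "u \<in> carrier R" for A u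
  proof -
    have "h u \<in> genideal C (h ` A) \<longleftrightarrow> u \<in> genideal R (A \<union> {\<zero>\<^bsub>R\<^esub>})"
      by (rule surj_hom_Idl_iff[OF R C R.zeroideal A u])
    also have "genideal R (A \<union> {\<zero>\<^bsub>R\<^esub>}) = genideal R A"
    proof -
      have "genideal R {} = {\<zero>\<^bsub>R\<^esub>}"
        using R.genideal_minimal[OF R.zeroideal, of "{}"] R.Idl_zero[of "{}"] by blast
      then show ?thesis using R.Idl_Un_Idl[OF A, of "{}"] by simp
    qed
    finally show ?thesis .
  qed
  then show thesis using that C by blast
qed

text \<open>
  One member of a permutable family may be replaced by any \<open>z\<close> that is a nonzerodivisor modulo all
  subfamilies of the others. That the others remain nonzerodivisors when \<open>z\<close> is among the generators is
  an instance of \<open>nzd_mod_swap\<close>.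
\<close>
lemma (in cring) permutable_regular_replace:
  assumes v: "v ` I \<subseteq> carrier R" and pr: "permutable_regular R I v" and k: "k \<in> I" and z: "z \<in> carrier R"
    and zn: "\<And>S. S \<subseteq> I - {k} \<Longrightarrow> nzd_mod R (Idl (v ` S)) z"
  shows "permutable_regular R I (v(k := z))"
  unfolding permutable_regular_def
proof (intro allI impI ballI)
  fix S j assume S: "S \<subseteq> I" and j: "j \<in> I - S"
  define T where "T = S - {k}"
  have T: "v ` T \<subseteq> carrier R" "T \<subseteq> I - {k}" using S v by (auto simp: T_def)
  have vT: "v(k := z) ` T = v ` T" by (auto simp: T_def)
  show "nzd_mod R (Idl ((v(k := z)) ` S)) ((v(k := z)) j)"
  proof (cases "k \<in> S")
    case False
    then have "S = T" by (auto simp: T_def)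
    then show ?thesis using zn[OF T(2)] permutable_regularD[OF pr S, of j] j vT by (cases "j = k") auto
  next
    case True
    then have kS: "S = insert k T" and jk: "j \<noteq> k" using j by (auto simp: T_def)
    have "nzd_mod R (Idl (insert z (v ` T))) (v j)"
    proof (rule nzd_mod_swap[OF T(1)])
      show "nzd_mod R (Idl (v ` T)) (v j)" by (rule permutable_regularD[OF pr]) (use T j S T_def in auto)
      show "nzd_mod R (Idl (insert (v j) (v ` T))) z" using zn[of "insert j T"] T j jk by auto
    qed (use z v j in auto)
    moreover have "(v(k := z)) ` S = insert z (v ` T)" unfolding kS image_insert vT by simp
    ultimately show ?thesis using jk by simp
  qed
qed

lemma (in cring) nzd_mod_of_pow_mem:
  assumes G: "G \<subseteq> carrier R" and x: "x \<in> carrier R" "nzd_mod R (Idl G) x"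
    and W: "W \<subseteq> carrier R" "x [^] (n::nat) \<in> Idl W"
    and u: "u \<in> carrier R" "\<And>w. w \<in> W \<Longrightarrow> w \<otimes> u \<in> Idl G"
  shows "u \<in> Idl G"
proof -
  let ?J = "{a \<in> carrier R. a \<otimes> u \<in> Idl G}"
  have "ideal ?J R"
  proof (rule idealI_cring)
    show "a \<oplus> b \<in> ?J" if "a \<in> ?J" "b \<in> ?J" for a b
      using that u(1) Idl_add[OF G, of "a \<otimes> u" "b \<otimes> u"] by (simp add: l_distr)
    show "a \<otimes> b \<in> ?J" if "a \<in> carrier R" "b \<in> ?J" for a b
      using that u(1) Idl_mult[OF G, of a "b \<otimes> u"] by (simp add: m_assoc)
  qed (use u(1) Idl_zero[OF G] in auto)
  moreover have "W \<subseteq> ?J" using W u by auto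
  ultimately have "x [^] n \<otimes> u \<in> Idl G" using Idl_least[OF _ _ W(2)] by blast
  then show ?thesis
  proof (induction n)
    case (Suc n)
    then have "x \<otimes> (x [^] n \<otimes> u) \<in> Idl G" using x u by (simp add: m_ac)
    moreover have "x [^] n \<otimes> u \<in> carrier R" using x(1) u(1) by simp
    ultimately have "x [^] n \<otimes> u \<in> Idl G" using nzd_modD[OF x(2)] by metis
    then show ?case by (rule Suc.IH)
  qed (use u in simp)
qed

text \<open>
  In \<open>B[T]\<close>, transported to the type \<open>'h\<close>, the generic combination \<open>z\<close> of \<open>w\<close> and \<open>ws\<close> can take
  the place of \<open>v k\<close>. The equation \<open>z = h w + t\<close> with \<open>t\<close> in the ideal of \<open>ws\<close> makes it possible to
  replace \<open>z\<close> by \<open>w\<close> later on.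
\<close>
lemma permutable_regular_generic_extension:
  fixes B :: "('b, 'm) ring_scheme" and inc :: "(nat \<Rightarrow> 'b) \<Rightarrow> 'h"
  assumes B: "cring B" and inc: "inj inc" and v: "v ` I \<subseteq> carrier B"
    and pr: "permutable_regular B I v" and k: "k \<in> I" and w: "w \<in> carrier B" and ws: "set ws \<subseteq> carrier B"
    and rad: "v k [^]\<^bsub>B\<^esub> (n::nat) \<in> genideal B (set (w # ws))"
  obtains C :: "'h ring" and h z t where "cring C" "h \<in> ring_hom B C"
    "\<And>A u. A \<subseteq> carrier B \<Longrightarrow> u \<in> carrier B \<Longrightarrow> h u \<in> genideal C (h ` A) \<longleftrightarrow> u \<in> genideal B A"
    "permutable_regular C I ((h \<circ> v)(k := z))"
    "t \<in> genideal C (h ` set ws)" "z = h w \<oplus>\<^bsub>C\<^esub> t"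
proof -
  define P where "P = UP B"
  interpret B: cring B by (rule B)
  interpret U: UP_cring B P by (simp_all add: UP_cring_def UP_def P_def B)
  define f where "f = generic_combination B (w # ws)"
  define t where "t = U.var \<otimes>\<^bsub>P\<^esub> generic_combination B ws"
  have tP: "t \<in> carrier P" using U.generic_combination_closed[OF ws] by (simp add: t_def)
  have f: "f = U.const w \<oplus>\<^bsub>P\<^esub> t" by (simp add: f_def t_def P_def)
  have fP: "f \<in> carrier P" using f tP w by simp
  have vC: "v i \<in> carrier B" if "i \<in> I" for i using v that by blast
  have constP: "U.const ` A \<subseteq> carrier P" if "A \<subseteq> carrier B" for A using that by auto
  have cI: "U.const u \<in> genideal P (U.const ` A) \<longleftrightarrow> u \<in> genideal B A" if "A \<subseteq> carrier B" "u \<in> carrier B" for A u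
    using U.Idl_const_iff[OF that(1), of "U.const u"] that B.Idl_zero[OF that(1)] by auto
  have SC: "v ` S \<subseteq> carrier B" if "S \<subseteq> I" for S using that vC by blast
  have pr1: "permutable_regular P I (U.const \<circ> v)"
    unfolding permutable_regular_def
  proof (intro allI impI ballI)
    fix S j assume S: "S \<subseteq> I" and j: "j \<in> I - S"
    have nz: "nzd_mod B (genideal B (v ` S)) (v j)" using permutable_regularD[OF pr S] j by blast
    show "nzd_mod P (genideal P ((U.const \<circ> v) ` S)) ((U.const \<circ> v) j)"
      unfolding nzd_mod_def image_comp[symmetric] o_apply
    proof (intro ballI impI)
      fix p assume p: "p \<in> carrier P" "U.const (v j) \<otimes>\<^bsub>P\<^esub> p \<in> genideal P (U.const ` v ` S)"
      have "v j \<otimes>\<^bsub>B\<^esub> U.cf p i \<in> genideal B (v ` S)" for i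
      proof -
        have "U.const (v j) \<otimes>\<^bsub>P\<^esub> p \<in> carrier P" using p(1) vC[of j] j by simp
        then have "U.cf (U.const (v j) \<otimes>\<^bsub>P\<^esub> p) i \<in> genideal B (v ` S)"
          using U.Idl_const_iff[OF SC[OF S]] p(2) by blast
        then show ?thesis using U.coeff_const_mult[of "v j" p i] p(1) vC[of j] j by simp
      qed
      then show "p \<in> genideal P (U.const ` v ` S)"
        using U.Idl_const_iff[OF SC[OF S] p(1)] nzd_modD[OF nz] p(1) by simp
    qed
  qed
  have pr2: "permutable_regular P I ((U.const \<circ> v)(k := f))"
  proof (rule U.P.permutable_regular_replace[OF _ pr1 k fP])
    show "(U.const \<circ> v) ` I \<subseteq> carrier P" using vC by auto
    fix S assume S: "S \<subseteq> I - {k}"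
    then have S': "S \<subseteq> I" "k \<notin> S" by auto
    have "nzd_mod P (genideal P (U.const ` v ` S)) f"
      unfolding f_def
    proof (rule U.nzd_mod_generic_combination[OF SC[OF S'(1)]])
      fix u assume u: "u \<in> carrier B" "\<And>y. y \<in> set (w # ws) \<Longrightarrow> y \<otimes>\<^bsub>B\<^esub> u \<in> genideal B (v ` S)"
      show "u \<in> genideal B (v ` S)"
        by (rule B.nzd_mod_of_pow_mem[OF SC[OF S'(1)] vC[OF k] permutable_regularD[OF pr S'(1) k S'(2)] _ rad u])
          (use w ws in auto)
    qed (use w ws in auto)
    then show "nzd_mod P (genideal P ((U.const \<circ> v) ` S)) f" by (simp add: image_comp)
  qed
  have t: "t \<in> genideal P (U.const ` set ws)"
  proof -
    have "generic_combination B ys \<in> genideal P (U.const ` set ws)" if "set ys \<subseteq> set ws" for ys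
      using that
    proof (induction ys)
      case Nil
      then show ?case using U.P.Idl_zero[OF constP[OF ws]] by (simp add: P_def)
    next
      case (Cons y ys)
      have "U.const y \<oplus>\<^bsub>P\<^esub> U.var \<otimes>\<^bsub>P\<^esub> generic_combination B ys \<in> genideal P (U.const ` set ws)"
      proof (rule U.P.Idl_add[OF constP[OF ws]])
        show "U.const y \<in> genideal P (U.const ` set ws)"
          by (rule U.P.Idl_gen[OF constP[OF ws]]) (use Cons.prems in simp)
        show "U.var \<otimes>\<^bsub>P\<^esub> generic_combination B ys \<in> genideal P (U.const ` set ws)"
          by (rule U.P.Idl_mult[OF constP[OF ws]]) (use Cons in simp_all)
      qed
      then show ?case by (simp add: P_def)
    qed
    then show ?thesis using U.P.Idl_mult[OF constP[OF ws]] by (simp add: t_def)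
  qed
  obtain C :: "'h ring" and g where C: "cring C" "g \<in> ring_hom P C" "g ` carrier P = carrier C"
    and g: "\<And>A u. A \<subseteq> carrier P \<Longrightarrow> u \<in> carrier P \<Longrightarrow> g u \<in> genideal C (g ` A) \<longleftrightarrow> u \<in> genideal P A"
    by (rule cring_in_type[OF U.P.cring_axioms inc]) (rule that)
  define h where "h = g \<circ> U.const"
  have v'P: "((U.const \<circ> v)(k := f)) i \<in> carrier P" if "i \<in> I" for i using that vC fP by auto
  have v'g: "(h \<circ> v)(k := g f) = g \<circ> ((U.const \<circ> v)(k := f))" by (auto simp: h_def)
  show thesis
  proof (rule that)
    show "cring C" by (rule C)
    show "h \<in> ring_hom B C" unfolding h_def by (rule ring_hom_trans[OF U.const_ring_hom C(2)])
    show "h u \<in> genideal C (h ` A) \<longleftrightarrow> u \<in> genideal B A" if "A \<subseteq> carrier B" "u \<in> carrier B" for A u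
      using g[OF constP[OF that(1)], of "U.const u"] cI[OF that] that by (simp add: h_def image_comp)
    show "permutable_regular C I ((h \<circ> v)(k := g f))"
      unfolding v'g permutable_regular_def
    proof (intro allI impI ballI)
      fix S j assume S: "S \<subseteq> I" and j: "j \<in> I - S"
      let ?v = "(U.const \<circ> v)(k := f)"
      have "nzd_mod C (genideal C (g ` ?v ` S)) (g (?v j)) \<longleftrightarrow> nzd_mod P (genideal P (?v ` S)) (?v j)"
      proof (rule nzd_mod_surj_hom[OF C(2,3) _ g])
        show "?v ` S \<subseteq> carrier P" using v'P S by (meson image_subsetI subsetD)
        show "?v j \<in> carrier P" using v'P j by blast
      qed (auto intro: U.P.monoid_axioms)
      then show "nzd_mod C (genideal C ((g \<circ> ?v) ` S)) ((g \<circ> ?v) j)"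
        using permutable_regularD[OF pr2 S] j by (simp only: image_comp o_apply) blast
    qed
    show "g t \<in> genideal C (h ` set ws)"
      using g[OF constP[OF ws] tP] t by (simp add: h_def image_comp)
    show "g f = h w \<oplus>\<^bsub>C\<^esub> g t"
      unfolding f h_def o_apply by (rule ring_hom_add[OF C(2)]) (use w tP in auto)
  qed
qed

lemma permutable_regular_imp_regular_over:
  assumes "permutable_regular R I v" "distinct ks" "set ks \<subseteq> I" "S \<subseteq> I" "S \<inter> set ks = {}"
  shows "regular_over R (v ` S) (map v ks)"
  using assms(2-)
proof (induction ks arbitrary: S)
  case (Cons i ks)
  have "regular_over R (v ` insert i S) (map v ks)"
    by (rule Cons.IH) (use Cons.prems in auto)
  then show ?case using permutable_regularD[OF assms(1), of S i] Cons.prems by auto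
qed simp

lemma (in cring) nzd_mod_add_mem:
  assumes G: "G \<subseteq> carrier R" and "x \<in> carrier R" "t \<in> Idl G"
    and "nzd_mod R (Idl G) (x \<oplus> t)"
  shows "nzd_mod R (Idl G) x"
  unfolding nzd_mod_def
proof (intro ballI impI)
  fix u assume u: "u \<in> carrier R" "x \<otimes> u \<in> Idl G"
  have t: "t \<in> carrier R" by (rule Idl_carrier[OF G assms(3)])
  have "(x \<oplus> t) \<otimes> u = x \<otimes> u \<oplus> u \<otimes> t" using u(1) t assms(2) by algebra
  then have "(x \<oplus> t) \<otimes> u \<in> Idl G" using Idl_add[OF G u(2) Idl_mult[OF G u(1) assms(3)]] by simp
  then show "u \<in> Idl G" using nzd_modD[OF assms(4) u(1)] by simp
qed

text \<open>
  Elements with a power in an ideal generate, together with it, the unit ideal only if the ideal is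
  already the unit ideal. If \<open>1 = a c + w\<close>, then \<open>a^m = c a^(m+1) + a^m w\<close>, so the exponent of a
  power of \<open>a\<close> in the ideal can be lowered to \<open>0\<close>.
\<close>
lemma (in cring) one_mem_of_nilpotent_mod:
  assumes "finite Y" "G \<subseteq> carrier R" "Y \<subseteq> carrier R"
    and "\<And>y. y \<in> Y \<Longrightarrow> \<exists>n::nat. y [^] n \<in> Idl G" and "\<one> \<in> Idl (G \<union> Y)"
  shows "\<one> \<in> Idl G"
  using assms
proof (induction Y arbitrary: G rule: finite_induct)
  case (insert a Y)
  have a: "a \<in> carrier R" and G: "G \<subseteq> carrier R" using insert.prems by auto
  have "\<one> \<in> Idl (insert a G)"
  proof (rule insert.IH)
    show "\<exists>n::nat. y [^] n \<in> Idl (insert a G)" if y: "y \<in> Y" for y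
    proof -
      obtain n :: nat where "y [^] n \<in> Idl G" using insert.prems(3)[of y] y by blast
      then have "y [^] n \<in> Idl (insert a G)" by (rule Idl_mono[rotated 2]) (use a G in auto)
      then show ?thesis ..
    qed
  qed (use insert.prems in auto)
  then obtain c w where cw: "c \<in> carrier R" "w \<in> carrier R" "w \<in> Idl G" "\<one> = a \<otimes> c \<oplus> w"
    by (rule Idl_insertE[OF _ a G])
  obtain n :: nat where n: "a [^] n \<in> Idl G" using insert.prems(3)[of a] by blast
  have step: "a [^] m \<in> Idl G" if m: "a [^] Suc m \<in> Idl G" for m :: nat
  proof -
    have "b = c \<otimes> (b \<otimes> a) \<oplus> b \<otimes> w" if b: "b \<in> carrier R" for b
    proof -
      have "b = b \<otimes> (a \<otimes> c \<oplus> w)" using b unfolding cw(4)[symmetric] by simp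
      also have "\<dots> = c \<otimes> (b \<otimes> a) \<oplus> b \<otimes> w" using a b cw(1,2) by algebra
      finally show ?thesis .
    qed
    from this[of "a [^] m"] have "a [^] m = c \<otimes> a [^] Suc m \<oplus> a [^] m \<otimes> w" using a by simp
    also have "\<dots> \<in> Idl G"
      by (rule Idl_add[OF G Idl_mult[OF G cw(1) m] Idl_mult[OF G _ cw(3)]]) (use a in simp)
    finally show ?thesis .
  qed
  have "a [^] (0::nat) \<in> Idl G" using n
  proof (induction n)
    case (Suc n)
    show ?case by (rule Suc.IH[OF step[OF Suc.prems]])
  qed
  then show ?case by simp
qed simp

lemma ring_hom_nat_pow:
  assumes "cring R" "cring C" "h \<in> ring_hom R C" "x \<in> carrier R"
  shows "h (x [^]\<^bsub>R\<^esub> (n::nat)) = h x [^]\<^bsub>C\<^esub> n"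
proof -
  interpret R: cring R by fact
  interpret C: cring C by fact
  show ?thesis
    using assms(4) ring_hom_one[OF assms(3)] ring_hom_mult[OF assms(3)] by (induction n) auto
qed

text \<open>
  The members with index in \<open>K\<close> are exchanged by induction on \<open>K\<close>. To exchange \<open>v k\<close> for \<open>y k\<close>,
  it is first replaced by a generic combination \<open>z\<close> of \<open>y k\<close> and of all members \<open>u i\<close>, \<open>i \<noteq> k\<close>, of the
  final family. The radical hypothesis is inherited, as \<open>z\<close> and the \<open>u i\<close> generate the same ideal as
  \<open>y k\<close> and the \<open>u i\<close>. After the induction hypothesis has brought in the \<open>u i\<close>, the last member \<open>z\<close>
  can be replaced by \<open>y k\<close>, which differs from it by an element of the ideal of the \<open>u i\<close>. This
  destroys permutability, which \<open>regular_imp_permutable_extension\<close> restores.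

  Since \<open>inc\<close> embeds the sequences of elements of \<open>'h\<close> into \<open>'h\<close>, all rings have the same element type.
\<close>
lemma exchange_permutable_regular:
  fixes inc :: "(nat \<Rightarrow> 'h) \<Rightarrow> 'h" and B :: "'h ring"
  assumes inc: "inj inc" and I: "finite I" and K: "K \<subseteq> I"
    and B: "cring B" and v: "v ` I \<subseteq> carrier B" and y: "y ` K \<subseteq> carrier B"
    and pr: "permutable_regular B I v"
    and rad: "\<And>i. i \<in> K \<Longrightarrow> \<exists>n::nat. v i [^]\<^bsub>B\<^esub> n \<in> genideal B (v ` (I - K) \<union> y ` K)"
  shows "\<exists>(C :: 'h ring) h. cring C \<and> h \<in> ring_hom B C \<and>
    permutable_regular C I (\<lambda>i. h (if i \<in> K then y i else v i)) \<and>
    (\<one>\<^bsub>C\<^esub> \<in> genideal C ((\<lambda>i. h (if i \<in> K then y i else v i)) ` I) \<longrightarrow>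
     \<one>\<^bsub>B\<^esub> \<in> genideal B ((\<lambda>i. if i \<in> K then y i else v i) ` I))"
proof -
  have "finite K" using I K by (rule finite_subset[rotated])
  then show ?thesis using K B v y pr rad
  proof (induction K arbitrary: B v y rule: finite_induct)
    case empty
    have "id \<in> ring_hom B B" by (rule ring_hom_memI) auto
    then show ?case using empty.prems(2,5) by (intro exI[of _ B] exI[of _ id]) (simp add: id_def)
  next
    case (insert k K)
    note BI = insert.prems(2) and v = insert.prems(3) and y = insert.prems(4) and pr = insert.prems(5)
    have kI: "k \<in> I" and KI: "K \<subseteq> I" using insert.prems(1) by auto
    interpret B: cring B by (rule BI)
    define L where "L = I - insert k K"
    \<comment> \<open>The final family; \<open>js\<close> below enumerates the indices other than \<open>k\<close>.\<close>
    define u where "u = (\<lambda>i. if i \<in> insert k K then y i else v i)"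
    have uC: "u i \<in> carrier B" if "i \<in> I" for i using that v y by (auto simp: u_def)
    have uk: "u k = y k" and uK: "u ` K = y ` K" and uL: "u ` L = v ` L" by (auto simp: u_def L_def)
    have LK: "I - {k} = K \<union> L" using insert.hyps KI by (auto simp: L_def)
    have "finite (I - {k})" using I by simp
    then obtain js where js: "set js = I - {k}" "distinct js" using finite_distinct_list by blast
    have W: "set (map u js) = v ` L \<union> y ` K" using js(1) LK uK uL by auto
    have Wk: "set (u k # map u js) = v ` (I - insert k K) \<union> y ` insert k K"
      using W by (auto simp: uk L_def)
    obtain n :: nat where n: "v k [^]\<^bsub>B\<^esub> n \<in> genideal B (set (u k # map u js))"
      using insert.prems(6)[of k] unfolding Wk by blast
    have uisC: "set (map u js) \<subseteq> carrier B" using uC js(1) by auto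
    obtain C1 :: "'h ring" and h1 z t where C1: "cring C1" and h1: "h1 \<in> ring_hom B C1"
      and iff1: "\<And>A u. A \<subseteq> carrier B \<Longrightarrow> u \<in> carrier B \<Longrightarrow> h1 u \<in> genideal C1 (h1 ` A) \<longleftrightarrow> u \<in> genideal B A"
      and pr1: "permutable_regular C1 I ((h1 \<circ> v)(k := z))"
      and t: "t \<in> genideal C1 (h1 ` set (map u js))" and z: "z = h1 (u k) \<oplus>\<^bsub>C1\<^esub> t"
      by (rule permutable_regular_generic_extension[OF BI inc v pr kI uC[OF kI] uisC n]) (rule that)
    interpret C1: cring C1 by (rule C1)
    have h1C: "h1 b \<in> carrier C1" if "b \<in> carrier B" for b using ring_hom_closed[OF h1 that] .
    have huC: "h1 ` u ` I \<subseteq> carrier C1" using uC h1C by auto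
    have "set (map u js) \<subseteq> u ` I" using js(1) by auto
    then have huisC: "h1 ` set (map u js) \<subseteq> carrier C1" "h1 ` set (map u js) \<subseteq> h1 ` u ` I" using huC by auto
    have tC: "t \<in> carrier C1" by (rule C1.Idl_carrier[OF huisC(1) t])
    have zC: "z \<in> carrier C1" using z tC h1C uC kI by simp
    define v1 where "v1 = (h1 \<circ> v)(k := z)"
    have v1C: "v1 ` I \<subseteq> carrier C1" using zC h1C v by (auto simp: v1_def)
    have y1C: "(h1 \<circ> y) ` K \<subseteq> carrier C1" using h1C y by auto
    define G where "G = v1 ` (I - K) \<union> (h1 \<circ> y) ` K"
    have GC: "G \<subseteq> carrier C1" using v1C y1C by (auto simp: G_def)
    have v1L: "v1 ` L = h1 ` v ` L" by (auto simp: v1_def L_def)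
    have WG: "h1 ` set (map u js) \<subseteq> G" using v1L unfolding W G_def L_def by auto
    have uG: "h1 ` set (u k # map u js) \<subseteq> genideal C1 G"
    proof -
      have "z \<in> G" using insert.hyps kI by (auto simp: G_def v1_def)
      then have zG: "z \<in> genideal C1 G" by (rule C1.Idl_gen[OF GC])
      have "t \<in> genideal C1 G" by (rule C1.Idl_mono[OF GC WG t])
      then have "h1 (u k) \<in> genideal C1 G"
        by (rule C1.Idl_rearrange[OF GC _ zG]) (use z h1C uC kI in auto)
      then show ?thesis using WG C1.Idl_gen[OF GC] by auto
    qed
    have uksC: "set (u k # map u js) \<subseteq> carrier B" using uisC uC kI by simp
    have rad1: "\<exists>n::nat. v1 i [^]\<^bsub>C1\<^esub> n \<in> genideal C1 G" if i: "i \<in> K" for i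
    proof -
      obtain n :: nat where "v i [^]\<^bsub>B\<^esub> n \<in> genideal B (set (u k # map u js))"
        using insert.prems(6)[of i] i unfolding Wk by blast
      then have "h1 (v i [^]\<^bsub>B\<^esub> n) \<in> genideal C1 (h1 ` set (u k # map u js))"
        by (rule hom_Idl[OF BI C1 h1 uksC])
      then have "h1 (v i [^]\<^bsub>B\<^esub> n) \<in> genideal C1 G" by (rule C1.Idl_subset[OF GC uG])
      moreover have "v i \<in> carrier B" using v i KI by blast
      then have "h1 (v i [^]\<^bsub>B\<^esub> n) = h1 (v i) [^]\<^bsub>C1\<^esub> n"
        by (rule ring_hom_nat_pow[OF BI C1 h1])
      moreover have "v1 i = h1 (v i)" using i insert.hyps by (auto simp: v1_def)
      ultimately show ?thesis by metis
    qed
    \<comment> \<open>The family after the induction hypothesis: it agrees with \<open>u\<close> except for \<open>z\<close> at \<open>k\<close>.\<close>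
    define w where "w = (\<lambda>i. if i \<in> K then (h1 \<circ> y) i else v1 i)"
    have wu: "w i = h1 (u i)" if "i \<in> I" "i \<noteq> k" for i using that by (auto simp: w_def u_def v1_def)
    have wk: "w k = z" using insert.hyps by (simp add: w_def v1_def)
    have wC: "w i \<in> carrier C1" if "i \<in> I" for i
      using that wu[of i] wk zC h1C uC by (cases "i = k") auto
    have "\<exists>(C2 :: 'h ring) h2. cring C2 \<and> h2 \<in> ring_hom C1 C2 \<and>
        permutable_regular C2 I (\<lambda>i. h2 (w i)) \<and>
        (\<one>\<^bsub>C2\<^esub> \<in> genideal C2 ((\<lambda>i. h2 (w i)) ` I) \<longrightarrow> \<one>\<^bsub>C1\<^esub> \<in> genideal C1 (w ` I))"
      unfolding w_def
      by (rule insert.IH[OF KI C1 v1C y1C pr1[folded v1_def]]) (rule rad1[unfolded G_def])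
    then obtain C2 :: "'h ring" and h2 where C2: "cring C2" and h2: "h2 \<in> ring_hom C1 C2"
      and pr2: "permutable_regular C2 I (\<lambda>i. h2 (w i))"
      and one2: "\<one>\<^bsub>C2\<^esub> \<in> genideal C2 ((\<lambda>i. h2 (w i)) ` I) \<longrightarrow> \<one>\<^bsub>C1\<^esub> \<in> genideal C1 (w ` I)"
      by (elim exE conjE) (rule that)
    interpret C2: cring C2 by (rule C2)
    have h2C: "h2 b \<in> carrier C2" if "b \<in> carrier C1" for b using ring_hom_closed[OF h2 that] .
    \<comment> \<open>With \<open>k\<close> in the last place, only the ideal of all the others matters for the replacement of \<open>z\<close>.\<close>
    define w2 where "w2 = (\<lambda>i. h2 (h1 (u i)))"
    have w2C: "w2 i \<in> carrier C2" if "i \<in> I" for i using that h2C h1C uC by (simp add: w2_def)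
    have w2is: "map w2 js = map (\<lambda>i. h2 (w i)) js" using js(1) wu by (auto simp: w2_def)
    have w2isC: "set (map w2 js) \<subseteq> carrier C2" using js(1) w2C by auto
    have t2: "h2 t \<in> genideal C2 (set (map w2 js))"
      using hom_Idl[OF C1 C2 h2 huisC(1) t] by (simp add: w2_def image_image)
    have z2: "h2 (w k) = w2 k \<oplus>\<^bsub>C2\<^esub> h2 t"
      unfolding wk z w2_def by (rule ring_hom_add[OF h2]) (use tC h1C uC kI in auto)
    have "regular_over C2 {} (map w2 (js @ [k]))"
    proof -
      have "regular_over C2 ((\<lambda>i. h2 (w i)) ` {}) (map (\<lambda>i. h2 (w i)) js)"
        by (rule permutable_regular_imp_regular_over[OF pr2]) (use js in auto)
      then have "regular_over C2 {} (map w2 js)" by (simp only: w2is image_empty)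
      moreover have "nzd_mod C2 (genideal C2 (set (map w2 js))) (w2 k)"
      proof (rule C2.nzd_mod_add_mem[OF w2isC w2C[OF kI] t2])
        have "nzd_mod C2 (genideal C2 ((\<lambda>i. h2 (w i)) ` set js)) (h2 (w k))"
          by (rule permutable_regularD[OF pr2]) (use js kI in auto)
        then show "nzd_mod C2 (genideal C2 (set (map w2 js))) (w2 k \<oplus>\<^bsub>C2\<^esub> h2 t)"
          by (simp only: w2is z2 set_map)
      qed
      ultimately show ?thesis unfolding map_append regular_over_append by simp
    qed
    moreover have setk: "set (js @ [k]) = I" using js(1) kI by auto
    moreover have "distinct (js @ [k])" using js by simp
    moreover have "w2 ` I \<subseteq> carrier C2" using w2C by auto
    ultimately obtain C3 :: "'h ring" and h3 where C3: "cring C3" and h3: "h3 \<in> ring_hom C2 C3"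
      and pr3: "permutable_regular C3 I (h3 \<circ> w2)"
      and one3: "\<one>\<^bsub>C3\<^esub> \<in> genideal C3 ((h3 \<circ> w2) ` I) \<Longrightarrow> \<one>\<^bsub>C2\<^esub> \<in> genideal C2 (w2 ` I)"
      using regular_imp_permutable_extension[OF C2, of w2 "js @ [k]" inc] inc by metis
    define h where "h = h3 \<circ> (h2 \<circ> h1)"
    have hom: "h \<in> ring_hom B C3"
      unfolding h_def by (intro ring_hom_trans[OF ring_hom_trans[OF h1 h2] h3])
    have hu: "(\<lambda>i. h (u i)) = h3 \<circ> w2" by (auto simp: h_def w2_def)
    have "\<one>\<^bsub>B\<^esub> \<in> genideal B (u ` I)" if "\<one>\<^bsub>C3\<^esub> \<in> genideal C3 ((\<lambda>i. h (u i)) ` I)"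
    proof -
      have 1: "\<one>\<^bsub>C2\<^esub> \<in> genideal C2 (w2 ` I)" using one3 that unfolding hu by blast
      have hwC: "(\<lambda>i. h2 (w i)) ` I \<subseteq> carrier C2" using wC h2C by auto
      have Ik: "I = insert k (set js)" using setk by simp
      have "w2 ` I \<subseteq> genideal C2 ((\<lambda>i. h2 (w i)) ` I)"
      proof -
        have "set (map w2 js) \<subseteq> (\<lambda>i. h2 (w i)) ` I" unfolding w2is Ik by auto
        then have s: "set (map w2 js) \<subseteq> genideal C2 ((\<lambda>i. h2 (w i)) ` I)"
          and t': "h2 t \<in> genideal C2 ((\<lambda>i. h2 (w i)) ` I)"
          using C2.Idl_gen[OF hwC] C2.Idl_mono[OF hwC _ t2] by auto
        have "h2 (w k) \<in> genideal C2 ((\<lambda>i. h2 (w i)) ` I)" by (rule C2.Idl_gen[OF hwC]) (use kI in simp)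
        then have "w2 k \<in> genideal C2 ((\<lambda>i. h2 (w i)) ` I)"
          by (rule C2.Idl_rearrange[OF hwC t' _ w2C[OF kI] z2[symmetric]])
        then show ?thesis using s unfolding Ik by simp
      qed
      then have "\<one>\<^bsub>C2\<^esub> \<in> genideal C2 ((\<lambda>i. h2 (w i)) ` I)" by (rule C2.Idl_subset[OF hwC _ 1])
      then have 2: "\<one>\<^bsub>C1\<^esub> \<in> genideal C1 (w ` I)" by (rule one2[rule_format])
      have "w ` I \<subseteq> genideal C1 (h1 ` u ` I)"
      proof -
        have "w i \<in> genideal C1 (h1 ` u ` I)" if i: "i \<in> I" for i
        proof (cases "i = k")
          case True
          have "t \<in> genideal C1 (h1 ` u ` I)" by (rule C1.Idl_mono[OF huC huisC(2) t])
          moreover have "h1 (u k) \<in> genideal C1 (h1 ` u ` I)" by (rule C1.Idl_gen[OF huC]) (use kI in simp)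
          ultimately show ?thesis using C1.Idl_add[OF huC] True wk z by simp
        next
          case False
          then show ?thesis using C1.Idl_gen[OF huC, of "w i"] wu[OF i] i by simp
        qed
        then show ?thesis by blast
      qed
      then have "\<one>\<^bsub>C1\<^esub> \<in> genideal C1 (h1 ` u ` I)" by (rule C1.Idl_subset[OF huC _ 2])
      then have "h1 \<one>\<^bsub>B\<^esub> \<in> genideal C1 (h1 ` u ` I)" by (simp add: ring_hom_one[OF h1])
      moreover have "u ` I \<subseteq> carrier B" using uC by auto
      ultimately show ?thesis using iff1[of "u ` I" "\<one>\<^bsub>B\<^esub>"] by simp
    qed
    then show ?case using C3 hom pr3 unfolding hu[symmetric] u_def by blast
  qed
qed

text \<open>
  Sequences of length \<open>n\<close> are families over \<open>{..<n}\<close>. The first ring makes \<open>xs\<close> permutable, and then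
  all its members are exchanged. The last hypothesis keeps \<open>ys\<close> proper, because the ideal of \<open>ys\<close> could be
  the unit ideal only together with that of \<open>xs\<close>.
\<close>
lemma exchange_regular:
  fixes B :: "('b, 'm) ring_scheme"
  assumes B: "cring B" and x: "set xs \<subseteq> carrier B" and y: "set ys \<subseteq> carrier B"
    and len: "length xs = length ys" and reg: "regular_over B {} xs"
    and one: "\<one>\<^bsub>B\<^esub> \<notin> genideal B (set xs)"
    and xy: "\<And>a. a \<in> set xs \<Longrightarrow> \<exists>n::nat. a [^]\<^bsub>B\<^esub> n \<in> genideal B (set ys)"
    and yx: "\<And>a. a \<in> set ys \<Longrightarrow> \<exists>n::nat. a [^]\<^bsub>B\<^esub> n \<in> genideal B (set xs)"
  obtains C :: "(nat \<Rightarrow> 'b) ring" and h where "cring C" "h \<in> ring_hom B C"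
    "regular_over C {} (map h ys)" "\<one>\<^bsub>C\<^esub> \<notin> genideal C (h ` set ys)"
proof -
  interpret B: cring B by (rule B)
  define n where "n = length xs"
  define v where "v = (\<lambda>i. xs ! i)"
  define u where "u = (\<lambda>i. ys ! i)"
  have xs: "map v [0..<n] = xs" and ys: "map u [0..<n] = ys"
    unfolding v_def u_def n_def len by (simp_all only: map_nth) (simp add: len[symmetric] map_nth)
  define I where "I = {..<n}"
  have I: "set [0..<n] = I" by (auto simp: I_def)
  have vI: "v ` I = set xs" and uI: "u ` I = set ys"
    using arg_cong[OF xs, of set] arg_cong[OF ys, of set] by (simp_all only: set_map I)
  obtain C0 :: "(nat \<Rightarrow> 'b) ring" and h0 where C0: "cring C0" "h0 \<in> ring_hom B C0"
    "permutable_regular C0 I (h0 \<circ> v)"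
    and one0: "\<one>\<^bsub>C0\<^esub> \<in> genideal C0 ((h0 \<circ> v) ` I) \<Longrightarrow> \<one>\<^bsub>B\<^esub> \<in> genideal B (v ` I)"
    using regular_imp_permutable_extension[of B v "[0..<n]" id] B x reg unfolding I xs vI
    by (metis distinct_upt inj_on_id)
  interpret C0: cring C0 by (rule C0)
  have h0C: "h0 b \<in> carrier C0" if "b \<in> carrier B" for b using ring_hom_closed[OF C0(2) that] .
  have pow0: "h0 (b [^]\<^bsub>B\<^esub> (n::nat)) = h0 b [^]\<^bsub>C0\<^esub> n" if "b \<in> carrier B" for b n
    by (rule ring_hom_nat_pow[OF B C0(1,2) that])
  define inc :: "(nat \<Rightarrow> nat \<Rightarrow> 'b) \<Rightarrow> nat \<Rightarrow> 'b"
    where "inc = (\<lambda>f n. f (fst (prod_decode n)) (snd (prod_decode n)))"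
  have inc: "inj inc"
  proof (rule injI)
    fix f g assume "inc f = inc g"
    then have "inc f (prod_encode (i, j)) = inc g (prod_encode (i, j))" for i j by simp
    then show "f = g" by (simp add: inc_def fun_eq_iff)
  qed
  have fI: "finite I" by (simp add: I_def)
  have v0: "(h0 \<circ> v) ` I \<subseteq> carrier C0" and u0: "(h0 \<circ> u) ` I \<subseteq> carrier C0"
    using h0C x y unfolding vI[symmetric] uI[symmetric] by auto
  have rad: "\<exists>n::nat. (h0 \<circ> v) i [^]\<^bsub>C0\<^esub> n \<in> genideal C0 ((h0 \<circ> v) ` (I - I) \<union> (h0 \<circ> u) ` I)" if i: "i \<in> I" for i
  proof -
    have vi: "v i \<in> set xs" using i vI by blast
    then obtain n :: nat where "v i [^]\<^bsub>B\<^esub> n \<in> genideal B (set ys)" using xy by blast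
    then have "h0 (v i [^]\<^bsub>B\<^esub> n) \<in> genideal C0 (h0 ` set ys)" by (rule hom_Idl[OF B C0(1,2) y])
    then have "(h0 \<circ> v) i [^]\<^bsub>C0\<^esub> n \<in> genideal C0 ((h0 \<circ> u) ` I)"
      using pow0[of "v i" n] vi x unfolding uI[symmetric] by (simp add: image_comp subset_eq)
    then show ?thesis by (intro exI[of _ n]) simp
  qed
  define w where "w = (\<lambda>i. if i \<in> I then (h0 \<circ> u) i else (h0 \<circ> v) i)"
  have "\<exists>(C :: (nat \<Rightarrow> 'b) ring) h. cring C \<and> h \<in> ring_hom C0 C \<and>
      permutable_regular C I (\<lambda>i. h (w i)) \<and>
      (\<one>\<^bsub>C\<^esub> \<in> genideal C ((\<lambda>i. h (w i)) ` I) \<longrightarrow> \<one>\<^bsub>C0\<^esub> \<in> genideal C0 (w ` I))"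
    unfolding w_def
    by (rule exchange_permutable_regular[OF inc fI subset_refl C0(1) v0 u0 C0(3)]) (rule rad)
  then obtain C :: "(nat \<Rightarrow> 'b) ring" and h where C: "cring C" "h \<in> ring_hom C0 C"
    "permutable_regular C I (\<lambda>i. h (w i))"
    and one1: "\<one>\<^bsub>C\<^esub> \<in> genideal C ((\<lambda>i. h (w i)) ` I) \<longrightarrow> \<one>\<^bsub>C0\<^esub> \<in> genideal C0 (w ` I)"
    by (elim exE conjE) (rule that)
  let ?w = "\<lambda>i. h (w i)"
  have "regular_over C (?w ` {}) (map ?w [0..<n])"
    by (rule permutable_regular_imp_regular_over[OF C(3)]) (auto simp: I_def)
  moreover have "map ?w [0..<n] = map (h \<circ> h0) ys" unfolding ys[symmetric] by (auto simp: I_def w_def)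
  ultimately have "regular_over C {} (map (h \<circ> h0) ys)" by simp
  moreover have "\<one>\<^bsub>C\<^esub> \<notin> genideal C ((h \<circ> h0) ` set ys)"
  proof
    assume a: "\<one>\<^bsub>C\<^esub> \<in> genideal C ((h \<circ> h0) ` set ys)"
    have "?w ` I = (h \<circ> h0) ` set ys" unfolding uI[symmetric] by (auto simp: image_image w_def)
    moreover have "w ` I = h0 ` set ys" unfolding uI[symmetric] by (auto simp: image_image w_def)
    ultimately have 1: "\<one>\<^bsub>C0\<^esub> \<in> genideal C0 (h0 ` set ys)" using one1 a by simp
    have c: "h0 ` set xs \<union> h0 ` set ys \<subseteq> carrier C0" using h0C x y by auto
    have "\<one>\<^bsub>C0\<^esub> \<in> genideal C0 (h0 ` set xs)"
    proof (rule C0.one_mem_of_nilpotent_mod[of "h0 ` set ys"])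
      show "\<one>\<^bsub>C0\<^esub> \<in> genideal C0 (h0 ` set xs \<union> h0 ` set ys)"
        by (rule C0.Idl_mono[OF c _ 1]) blast
      fix b assume "b \<in> h0 ` set ys"
      then obtain a where a: "a \<in> set ys" "b = h0 a" by blast
      then obtain n :: nat where "a [^]\<^bsub>B\<^esub> n \<in> genideal B (set xs)" using yx by blast
      then have "h0 (a [^]\<^bsub>B\<^esub> n) \<in> genideal C0 (h0 ` set xs)" by (rule hom_Idl[OF B C0(1,2) x])
      then show "\<exists>n::nat. b [^]\<^bsub>C0\<^esub> n \<in> genideal C0 (h0 ` set xs)" using pow0[of a n] a y by (metis subsetD)
    qed (use c in auto)
    then show False using one0 one unfolding vI[symmetric] by (simp add: image_comp)
  qed
  ultimately show thesis using that[OF C(1) ring_hom_trans[OF C0(2) C(2)]] by simp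
qed

section \<open>Seeds and ring homomorphisms\<close>

lemma regular_over_iff_nth:
  "regular_over R G xs \<longleftrightarrow>
     (\<forall>i<length xs. nzd_mod R (genideal R (G \<union> set (take i xs))) (xs ! i))"
proof (induction xs arbitrary: G)
  case (Cons x xs)
  show ?case by (simp add: Cons.IH All_less_Suc2)
qed simp

lemma regular_sequence_iff_regular_over:
  assumes B: "algebra R B" and xs: "set xs \<subseteq> carrier R"
  shows "regular_sequence B xs \<longleftrightarrow>
    regular_over B {} (map (\<lambda>r. r \<odot>\<^bsub>B\<^esub> \<one>\<^bsub>B\<^esub>) xs) \<and>
    \<one>\<^bsub>B\<^esub> \<notin> genideal B ((\<lambda>r. r \<odot>\<^bsub>B\<^esub> \<one>\<^bsub>B\<^esub>) ` set xs)"
proof -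
  have m: "xs ! i \<odot>\<^bsub>B\<^esub> b = (xs ! i \<odot>\<^bsub>B\<^esub> \<one>\<^bsub>B\<^esub>) \<otimes>\<^bsub>B\<^esub> b" if "i < length xs" "b \<in> carrier B" for i b
    by (rule smult_conv_mult[OF B _ that(2)]) (use xs that nth_mem in blast)
  have "(\<forall>i<length xs. \<forall>b\<in>carrier B. xs ! i \<odot>\<^bsub>B\<^esub> b \<in> expansion B (set (take i xs)) \<longrightarrow>
       b \<in> expansion B (set (take i xs))) \<longleftrightarrow>
      regular_over B {} (map (\<lambda>r. r \<odot>\<^bsub>B\<^esub> \<one>\<^bsub>B\<^esub>) xs)"
    unfolding regular_over_iff_nth nzd_mod_def expansion_def
    by (simp add: m take_map)
  then show ?thesis unfolding regular_sequence_iff[OF assms] expansion_def by simp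
qed

text \<open>
  A ring homomorphism from the algebra \<open>S\<close> turns its target into an algebra over the base ring of \<open>S\<close>,
  and every algebra to which \<open>S\<close> maps arises in this way. So the search for big Cohen-Macaulay algebras
  below \<open>S\<close> is a matter of ring homomorphisms from \<open>S\<close>.
\<close>
definition algebra_along ::
    "('r, 's, 'n) module_scheme \<Rightarrow> ('s \<Rightarrow> 'c) \<Rightarrow> ('c, 'k) ring_scheme \<Rightarrow> ('r, 'c) module" where
  "algebra_along S g C = \<lparr>carrier = carrier C, monoid.mult = monoid.mult C, monoid.one = \<one>\<^bsub>C\<^esub>,
     ring.zero = \<zero>\<^bsub>C\<^esub>, ring.add = ring.add C, smult = \<lambda>r b. g (r \<odot>\<^bsub>S\<^esub> \<one>\<^bsub>S\<^esub>) \<otimes>\<^bsub>C\<^esub> b\<rparr>"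

lemma algebra_along_sel [simp]:
  "carrier (algebra_along S g C) = carrier C"
  "monoid.mult (algebra_along S g C) = monoid.mult C"
  "monoid.one (algebra_along S g C) = monoid.one C"
  "ring.zero (algebra_along S g C) = ring.zero C"
  "ring.add (algebra_along S g C) = ring.add C"
  "r \<odot>\<^bsub>algebra_along S g C\<^esub> b = g (r \<odot>\<^bsub>S\<^esub> \<one>\<^bsub>S\<^esub>) \<otimes>\<^bsub>C\<^esub> b"
  by (simp_all add: algebra_along_def)

lemma smult_one_hom:
  assumes S: "algebra R S" shows "(\<lambda>r. r \<odot>\<^bsub>S\<^esub> \<one>\<^bsub>S\<^esub>) \<in> ring_hom R S"
proof -
  interpret S: cring S using S by (rule algebra.M_cring)
  interpret algebra R S by (rule S)
  show ?thesis
    by (rule ring_hom_memI) (simp_all add: smult_l_distr smult_assoc1 smult_assoc2)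
qed

lemma structure_hom:
  assumes "algebra R S" "g \<in> ring_hom S C"
  shows "(\<lambda>r. g (r \<odot>\<^bsub>S\<^esub> \<one>\<^bsub>S\<^esub>)) \<in> ring_hom R C"
  using ring_hom_trans[OF smult_one_hom[OF assms(1)] assms(2)] by (simp add: comp_def)

lemma algebra_along:
  assumes S: "algebra R S" and C: "cring C" and g: "g \<in> ring_hom S C"
  shows "algebra R (algebra_along S g C)" "g \<in> alg_hom R S (algebra_along S g C)"
    "genideal (algebra_along S g C) A = genideal C A"
proof -
  interpret S: cring S using S by (rule algebra.M_cring)
  interpret algebra R S by (rule S)
  interpret C: cring C by (rule C)
  let ?C = "algebra_along S g C"
  have C': "cring ?C" by (rule cring_cong[OF C]) simp_all
  interpret C': cring ?C by (rule C')
  note r = structure_hom[OF S g]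
  have rC: "g (a \<odot>\<^bsub>S\<^esub> \<one>\<^bsub>S\<^esub>) \<in> carrier C" if "a \<in> carrier R" for a using ring_hom_closed[OF r that] .
  show "algebra R ?C"
    by (rule algebraI[OF R_cring C'])
      (use ring_hom_add[OF r] ring_hom_mult[OF r] ring_hom_one[OF r] rC
       in \<open>simp_all add: C.l_distr C.r_distr C.m_assoc\<close>)
  have "g \<in> ring_hom S ?C" using g by (simp add: ring_hom_def)
  moreover have "g (a \<odot>\<^bsub>S\<^esub> s) = g (a \<odot>\<^bsub>S\<^esub> \<one>\<^bsub>S\<^esub>) \<otimes>\<^bsub>C\<^esub> g s" if "a \<in> carrier R" "s \<in> carrier S" for a s
    using smult_conv_mult[OF S that] ring_hom_mult[OF g, of "a \<odot>\<^bsub>S\<^esub> \<one>\<^bsub>S\<^esub>" s] that by simp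
  ultimately show "g \<in> alg_hom R S ?C" unfolding alg_hom_def algebra_along_sel by blast
  have id_eq: "ideal J ?C \<longleftrightarrow> ideal J C" for J
  proof
    assume "ideal J ?C"
    then have "ideal {u \<in> carrier C. id u \<in> J} C"
      by (intro ideal_hom_vimage[OF C C']) (auto simp: ring_hom_def)
    moreover have "J \<subseteq> carrier C" using ideal.Icarr[OF \<open>ideal J ?C\<close>] by auto
    then have "{u \<in> carrier C. id u \<in> J} = J" by auto
    ultimately show "ideal J C" by simp
  next
    assume "ideal J C"
    then have "ideal {u \<in> carrier ?C. id u \<in> J} ?C"
      by (intro ideal_hom_vimage[OF C' C]) (auto simp: ring_hom_def)
    moreover have "J \<subseteq> carrier C" using ideal.Icarr[OF \<open>ideal J C\<close>] by auto
    then have "{u \<in> carrier ?C. id u \<in> J} = J" by auto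
    ultimately show "ideal J ?C" by simp
  qed
  show "genideal ?C A = genideal C A" unfolding genideal_def id_eq ..
qed

text \<open>
  What it takes for \<open>S / I\<close> to be a seed: a ring homomorphism from \<open>S\<close> that kills \<open>I\<close> and maps \<open>xs\<close> to a
  proper regular sequence. Unlike in the definition of a seed, the sequence \<open>xs\<close> is part of the data, and
  the quotient \<open>S / I\<close> is avoided.
\<close>
definition seed_witness ::
    "('r, 's, 'n) module_scheme \<Rightarrow> 's set \<Rightarrow> 'r list \<Rightarrow> ('c, 'k) ring_scheme \<Rightarrow> ('s \<Rightarrow> 'c) \<Rightarrow> bool" where
  "seed_witness S I xs C g \<longleftrightarrow> cring C \<and> g \<in> ring_hom S C \<and> (\<forall>s\<in>I. g s = \<zero>\<^bsub>C\<^esub>) \<and>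
     regular_over C {} (map (\<lambda>r. g (r \<odot>\<^bsub>S\<^esub> \<one>\<^bsub>S\<^esub>)) xs) \<and>
     \<one>\<^bsub>C\<^esub> \<notin> genideal C ((\<lambda>r. g (r \<odot>\<^bsub>S\<^esub> \<one>\<^bsub>S\<^esub>)) ` set xs)"

lemma sop_carrier:
  assumes "system_of_parameters R xs" shows "set xs \<subseteq> carrier R"
proof -
  obtain m where "maximalideal m R" "set xs \<subseteq> m"
    using assms unfolding system_of_parameters_def by blast
  then show ?thesis using ideal.Icarr[OF maximalideal.axioms(1)[OF \<open>maximalideal m R\<close>]] by blast
qed

lemma seed_witness_of_big_cohen_macaulay:
  assumes S: "algebra R S" and B: "big_cohen_macaulay R B" and f: "f \<in> alg_hom R S B"
    and kill: "\<And>s. s \<in> I \<Longrightarrow> f s = \<zero>\<^bsub>B\<^esub>"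
  obtains xs where "system_of_parameters R xs" "seed_witness S I xs B f"
proof -
  have AB: "algebra R B" using B by (simp add: big_cohen_macaulay_def)
  interpret S: cring S using S by (rule algebra.M_cring)
  obtain xs where xs: "system_of_parameters R xs" "regular_sequence B xs"
    using B by (auto simp: big_cohen_macaulay_def)
  have fh: "f \<in> ring_hom S B" using f by (simp add: alg_hom_def)
  have e: "r \<odot>\<^bsub>B\<^esub> \<one>\<^bsub>B\<^esub> = f (r \<odot>\<^bsub>S\<^esub> \<one>\<^bsub>S\<^esub>)" if "r \<in> set xs" for r
    using f that sop_carrier[OF xs(1)] ring_hom_one[OF fh] by (auto simp: alg_hom_def)
  have m: "map (\<lambda>r. r \<odot>\<^bsub>B\<^esub> \<one>\<^bsub>B\<^esub>) xs = map (\<lambda>r. f (r \<odot>\<^bsub>S\<^esub> \<one>\<^bsub>S\<^esub>)) xs"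
    "(\<lambda>r. r \<odot>\<^bsub>B\<^esub> \<one>\<^bsub>B\<^esub>) ` set xs = (\<lambda>r. f (r \<odot>\<^bsub>S\<^esub> \<one>\<^bsub>S\<^esub>)) ` set xs"
    using e by (auto intro: image_cong)
  have "seed_witness S I xs B f"
    using xs(2) kill fh algebra.M_cring[OF AB]
    unfolding regular_sequence_iff_regular_over[OF AB sop_carrier[OF xs(1)]] m seed_witness_def by blast
  then show thesis using that xs(1) by blast
qed

lemma big_cohen_macaulay_of_seed_witness:
  assumes S: "algebra R S" and xs: "system_of_parameters R xs" and w: "seed_witness S I xs C g"
  shows "big_cohen_macaulay R (algebra_along S g C)"
proof -
  have C: "cring C" and g: "g \<in> ring_hom S C" using w by (auto simp: seed_witness_def)
  interpret C: cring C by (rule C)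
  note al = algebra_along[OF S C g]
  have r: "g (r \<odot>\<^bsub>S\<^esub> \<one>\<^bsub>S\<^esub>) \<otimes>\<^bsub>C\<^esub> \<one>\<^bsub>C\<^esub> = g (r \<odot>\<^bsub>S\<^esub> \<one>\<^bsub>S\<^esub>)" if "r \<in> set xs" for r
    using ring_hom_closed[OF structure_hom[OF S g], of r] that sop_carrier[OF xs] by auto
  have m: "map (\<lambda>r. g (r \<odot>\<^bsub>S\<^esub> \<one>\<^bsub>S\<^esub>) \<otimes>\<^bsub>C\<^esub> \<one>\<^bsub>C\<^esub>) xs = map (\<lambda>r. g (r \<odot>\<^bsub>S\<^esub> \<one>\<^bsub>S\<^esub>)) xs"
    "(\<lambda>r. g (r \<odot>\<^bsub>S\<^esub> \<one>\<^bsub>S\<^esub>) \<otimes>\<^bsub>C\<^esub> \<one>\<^bsub>C\<^esub>) ` set xs = (\<lambda>r. g (r \<odot>\<^bsub>S\<^esub> \<one>\<^bsub>S\<^esub>)) ` set xs"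
    using r by (auto intro: image_cong)
  have "regular_over (algebra_along S g C) {} us \<longleftrightarrow> regular_over C {} us" for us
    by (simp add: regular_over_iff_nth nzd_mod_def al(3))
  then have "regular_sequence (algebra_along S g C) xs"
    using w unfolding regular_sequence_iff_regular_over[OF al(1) sop_carrier[OF xs]]
      algebra_along_sel al(3) m seed_witness_def by blast
  then show ?thesis using al(1) xs by (auto simp: big_cohen_macaulay_def)
qed

lemma alg_hom_factor:
  assumes S: "algebra R S" and B: "algebra R B" and I: "ideal I S"
    and f: "f \<in> alg_hom R S B" and kill: "\<And>s. s \<in> I \<Longrightarrow> f s = \<zero>\<^bsub>B\<^esub>"
  shows "(\<lambda>Y. the_elem (f ` Y)) \<in> alg_hom R (quot_algebra S I) B"
proof -
  interpret S: cring S using S by (rule algebra.M_cring)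
  interpret B: cring B using B by (rule algebra.M_cring)
  interpret A: algebra R S by (rule S)
  interpret I: ideal I S by (rule I)
  have fh: "f \<in> ring_hom S B" and fs: "\<And>r s. r \<in> carrier R \<Longrightarrow> s \<in> carrier S \<Longrightarrow> f (r \<odot>\<^bsub>S\<^esub> s) = r \<odot>\<^bsub>B\<^esub> f s"
    using f by (auto simp: alg_hom_def)
  note fC = ring_hom_closed[OF fh]
  have val: "the_elem (f ` (I +>\<^bsub>S\<^esub> s)) = f s" if s: "s \<in> carrier S" for s
  proof -
    have "f x = f s" if "x \<in> I +>\<^bsub>S\<^esub> s" for x
    proof -
      obtain i where "i \<in> I" "x = i \<oplus>\<^bsub>S\<^esub> s" using \<open>x \<in> _\<close> by (auto simp: a_r_coset_def')
      then show ?thesis using ring_hom_add[OF fh, of i s] kill fC s I.Icarr by simp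
    qed
    moreover have "s \<in> I +>\<^bsub>S\<^esub> s" by (rule I.a_rcos_self[OF s])
    ultimately have "f ` (I +>\<^bsub>S\<^esub> s) = {f s}" by blast
    then show ?thesis by simp
  qed
  have q: "(\<lambda>b. I +>\<^bsub>S\<^esub> b) \<in> ring_hom S (quot_algebra S I)"
    using quot_map_alg_hom[OF S I] by (simp add: alg_hom_def)
  show ?thesis
    unfolding alg_hom_def
  proof (intro CollectI conjI ballI)
    show "(\<lambda>Y. the_elem (f ` Y)) \<in> ring_hom (quot_algebra S I) B"
      by (rule ring_hom_memI)
        (auto simp: quot_carrier val ring_hom_add[OF q, symmetric] ring_hom_mult[OF q, symmetric]
          ring_hom_one[OF q, symmetric] ring_hom_add[OF fh] ring_hom_mult[OF fh] ring_hom_one[OF fh] fC)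
    show "the_elem (f ` (r \<odot>\<^bsub>quot_algebra S I\<^esub> Y)) = r \<odot>\<^bsub>B\<^esub> the_elem (f ` Y)"
      if "r \<in> carrier R" "Y \<in> carrier (quot_algebra S I)" for r Y
      using that by (auto simp: quot_carrier quot_algebra_smult[OF S I] val fs)
  qed
qed

lemma alg_hom_comp: "f \<in> alg_hom R S T \<Longrightarrow> g \<in> alg_hom R T B \<Longrightarrow> g \<circ> f \<in> alg_hom R S B"
  using ring_hom_trans[of f S T g B] ring_hom_closed[of f S T] by (auto simp: alg_hom_def)

lemma seed_quotI:
  assumes S: "algebra R S" and I: "ideal I S" and B: "big_cohen_macaulay R B"
    and f: "f \<in> alg_hom R S B" and kill: "\<And>s. s \<in> I \<Longrightarrow> f s = \<zero>\<^bsub>B\<^esub>"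
  shows "seed R (quot_algebra S I)"
proof (rule seedI[OF quot_algebra_is_algebra[OF S I] B])
  show "(\<lambda>Y. the_elem (f ` Y)) \<in> alg_hom R (quot_algebra S I) B"
    by (rule alg_hom_factor[OF S _ I f kill]) (use B in \<open>simp add: big_cohen_macaulay_def\<close>)
qed

lemma seed_quotE:
  fixes S :: "('r, 's, 'n) module_scheme"
  assumes S: "algebra R S" and I: "ideal I S" and seed: "seed R (quot_algebra S I)"
  obtains B :: "('r, 's set list) module" and F where "big_cohen_macaulay R B"
    "F \<in> alg_hom R (quot_algebra S I) B" "F \<circ> (\<lambda>s. I +>\<^bsub>S\<^esub> s) \<in> alg_hom R S B"
    "\<And>s. s \<in> I \<Longrightarrow> (F \<circ> (\<lambda>s. I +>\<^bsub>S\<^esub> s)) s = \<zero>\<^bsub>B\<^esub>"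
proof -
  interpret S: cring S using S by (rule algebra.M_cring)
  obtain B :: "('r, 's set list) module" and F where B: "big_cohen_macaulay R B"
    and F: "F \<in> alg_hom R (quot_algebra S I) B"
    using seed unfolding seed_def by blast
  have "cring (quot_algebra S I)" "cring B"
    using algebra.M_cring[OF quot_algebra_is_algebra[OF S I]] algebra.M_cring[of R B] B
    by (auto simp: big_cohen_macaulay_def)
  then have F0: "F \<zero>\<^bsub>quot_algebra S I\<^esub> = \<zero>\<^bsub>B\<^esub>"
    by (rule ring_hom_zero_cring) (use F in \<open>simp add: alg_hom_def\<close>)
  have "(F \<circ> (\<lambda>s. I +>\<^bsub>S\<^esub> s)) s = \<zero>\<^bsub>B\<^esub>" if "s \<in> I" for s
    using S.a_rcos_zero[OF I that] F0 by (simp add: quot_algebra_sel(4) FactRing_def)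
  then show thesis by (rule that[OF B F alg_hom_comp[OF quot_map_alg_hom[OF S I] F]])
qed

text \<open>
  Two systems of parameters have the same length, namely the Krull dimension, and both generate ideals
  with radical the maximal ideal. Hence \<open>exchange_regular\<close> applies to their images.
\<close>
lemma seed_witness_change_parameters:
  fixes S :: "('r, 's, 'n) module_scheme" and C :: "('c, 'k) ring_scheme"
  assumes R: "local_ring R" and S: "algebra R S" and w: "seed_witness S I xs C g"
    and xs: "system_of_parameters R xs" and ys: "system_of_parameters R ys"
  shows "\<exists>(C' :: (nat \<Rightarrow> 'c) ring) g'. seed_witness S I ys C' g'"
proof -
  have C: "cring C" and g: "g \<in> ring_hom S C" and kill: "\<And>s. s \<in> I \<Longrightarrow> g s = \<zero>\<^bsub>C\<^esub>"
    using w by (auto simp: seed_witness_def)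
  have RC: "cring R" using S by (rule algebra.axioms(1)[THEN module.axioms(1)])
  define \<rho> where "\<rho> = (\<lambda>r. g (r \<odot>\<^bsub>S\<^esub> \<one>\<^bsub>S\<^esub>))"
  have \<rho>: "\<rho> \<in> ring_hom R C" unfolding \<rho>_def by (rule structure_hom[OF S g])
  have len: "length xs = length ys" using xs ys by (metis system_of_parameters_def enat.inject)
  have rad: "\<exists>n::nat. \<rho> a [^]\<^bsub>C\<^esub> n \<in> genideal C (\<rho> ` set us)"
    if us: "system_of_parameters R us" and vs: "system_of_parameters R vs" and a: "a \<in> set vs" for us vs a
  proof -
    obtain m where m: "maximalideal m R" "radical R (genideal R (set us)) = m"
      using us unfolding system_of_parameters_def by blast
    obtain m' where m': "maximalideal m' R" "set vs \<subseteq> m'"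
      using vs unfolding system_of_parameters_def by blast
    have "m = m'" using local_ring.unique_maximalideal[OF R] m(1) m'(1) by blast
    then have "a \<in> radical R (genideal R (set us))" using m m' a by blast
    then obtain n :: nat where n: "a \<in> carrier R" "a [^]\<^bsub>R\<^esub> n \<in> genideal R (set us)"
      by (auto simp: radical_def)
    then have "\<rho> (a [^]\<^bsub>R\<^esub> n) \<in> genideal C (\<rho> ` set us)"
      using hom_Idl[OF RC C \<rho> sop_carrier[OF us]] by blast
    then show ?thesis using ring_hom_nat_pow[OF RC C \<rho> n(1)] by metis
  qed
  have cx: "set (map \<rho> xs) \<subseteq> carrier C" and cy: "set (map \<rho> ys) \<subseteq> carrier C"
    using sop_carrier[OF xs] sop_carrier[OF ys] ring_hom_closed[OF \<rho>] by auto
  obtain C' :: "(nat \<Rightarrow> 'c) ring" and h where C': "cring C'" "h \<in> ring_hom C C'"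
    "regular_over C' {} (map h (map \<rho> ys))" "\<one>\<^bsub>C'\<^esub> \<notin> genideal C' (h ` set (map \<rho> ys))"
  proof (rule exchange_regular[OF C cx cy])
    show "length (map \<rho> xs) = length (map \<rho> ys)" using len by simp
    show "regular_over C {} (map \<rho> xs)" "\<one>\<^bsub>C\<^esub> \<notin> genideal C (set (map \<rho> xs))"
      using w by (simp_all add: seed_witness_def \<rho>_def)
    show "\<exists>n::nat. a [^]\<^bsub>C\<^esub> n \<in> genideal C (set (map \<rho> ys))" if "a \<in> set (map \<rho> xs)" for a
      using rad[OF ys xs] that by auto
    show "\<exists>n::nat. a [^]\<^bsub>C\<^esub> n \<in> genideal C (set (map \<rho> xs))" if "a \<in> set (map \<rho> ys)" for a
      using rad[OF xs ys] that by auto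
  qed (rule that)
  have "seed_witness S I ys C' (h \<circ> g)"
    using C' ring_hom_trans[OF g C'(2)] kill ring_hom_zero_cring[OF C C'(1,2)]
    by (simp add: seed_witness_def \<rho>_def comp_def image_image)
  then show ?thesis by blast
qed

text \<open>
  The reduced product along the chain: two families are identified if they agree at all \<open>I\<close> above some
  member \<open>J\<close> of the chain. An element of \<open>J\<close> goes to zero at all these \<open>I\<close>.
\<close>
lemma seed_witness_Union:
  fixes C :: "'s set \<Rightarrow> ('c, 'k) ring_scheme"
  assumes S: "algebra R S" and xs: "set xs \<subseteq> carrier R" and ne: "\<I> \<noteq> {}"
    and sub: "\<And>I. I \<in> \<I> \<Longrightarrow> I \<subseteq> carrier S"
    and chain: "\<And>I J. I \<in> \<I> \<Longrightarrow> J \<in> \<I> \<Longrightarrow> I \<subseteq> J \<or> J \<subseteq> I"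
    and w: "\<And>I. I \<in> \<I> \<Longrightarrow> seed_witness S I xs (C I) (g I)"
  shows "\<exists>(D :: ('s set \<Rightarrow> 'c) ring) h. seed_witness S (\<Union>\<I>) xs D h"
proof -
  interpret S: cring S using S by (rule algebra.M_cring)
  obtain I0 where I0: "I0 \<in> \<I>" using ne by blast
  \<comment> \<open>The product is indexed by all sets. At the indices outside the chain a fixed factor is used,
    and the ideals \<open>N J I\<close> below are the unit ideals there.\<close>
  define \<iota> where "\<iota> = (\<lambda>I. if I \<in> \<I> then I else I0)"
  define B where "B = (\<lambda>I. C (\<iota> I))"
  define k where "k = (\<lambda>I. g (\<iota> I))"
  have \<iota>: "\<iota> I \<in> \<I>" for I using I0 by (simp add: \<iota>_def)
  have B: "cring (B I)" and k: "k I \<in> ring_hom S (B I)" for I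
    using w[OF \<iota>[of I]] by (simp_all add: seed_witness_def B_def k_def)
  interpret B: cring "B I" for I by (rule B)
  define \<rho> where "\<rho> = (\<lambda>r I. k I (r \<odot>\<^bsub>S\<^esub> \<one>\<^bsub>S\<^esub>))"
  have \<rho>C: "\<rho> r I \<in> carrier (B I)" if "r \<in> carrier R" for r I
    unfolding \<rho>_def using ring_hom_closed[OF structure_hom[OF S k] that] .
  have reg: "regular_over (B I) {} (map (\<lambda>r. \<rho> r I) xs)"
    and one: "\<one>\<^bsub>B I\<^esub> \<notin> genideal (B I) ((\<lambda>r. \<rho> r I) ` set xs)" for I
    using w[OF \<iota>[of I]] by (simp_all add: seed_witness_def B_def k_def \<rho>_def)
  have kill: "k I s = \<zero>\<^bsub>B I\<^esub>" if "I \<in> \<I>" "s \<in> I" for I s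
    using w[OF that(1)] that by (simp add: seed_witness_def B_def k_def \<iota>_def)
  define N where "N = (\<lambda>J I. if I \<in> \<I> \<and> J \<subseteq> I then {\<zero>\<^bsub>B I\<^esub>} else carrier (B I))"
  have N: "ideal (N J I) (B I)" for J I
    using B.zeroideal B.oneideal by (simp add: N_def)
  have dir: "\<exists>K\<in>\<I>. \<forall>I. N J I \<union> N J' I \<subseteq> N K I" if "J \<in> \<I>" "J' \<in> \<I>" for J J'
  proof -
    have "\<forall>I. N J I \<union> N J' I \<subseteq> N (J \<union> J') I" by (auto simp: N_def)
    moreover have "J \<union> J' \<in> \<I>" using chain[OF that] that by (metis Un_absorb1 Un_absorb2)
    ultimately show ?thesis by blast
  qed
  let ?P = "prod_ring B"
  obtain D :: "('s set \<Rightarrow> 'c) ring" and h where D: "cring D" "h \<in> ring_hom ?P D" "h ` carrier ?P = carrier D"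
    and h: "\<And>A u. finite A \<Longrightarrow> A \<subseteq> carrier ?P \<Longrightarrow> u \<in> carrier ?P \<Longrightarrow>
       h u \<in> genideal D (h ` A) \<longleftrightarrow>
       (\<exists>J\<in>\<I>. \<forall>I. u I \<in> genideal (B I) ((\<lambda>a. a I) ` A \<union> N J I))"
    by (rule directed_quotient_of_product[of B \<I> N id, OF B N ne _ inj_on_id])
      (erule (1) dir, rule that)
  interpret D: cring D by (rule D(1))
  have hmem: "h u \<in> genideal D ((\<lambda>r. h (\<rho> r)) ` E) \<longleftrightarrow>
      (\<exists>J\<in>\<I>. \<forall>I\<in>\<I>. J \<subseteq> I \<longrightarrow> u I \<in> genideal (B I) ((\<lambda>r. \<rho> r I) ` E))"
    if E: "E \<subseteq> set xs" and u: "\<And>I. u I \<in> carrier (B I)" for u E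
  proof -
    have EC: "(\<lambda>r. \<rho> r I) ` E \<subseteq> carrier (B I)" for I using E xs \<rho>C by blast
    have "finite (\<rho> ` E)" "\<rho> ` E \<subseteq> carrier ?P" "u \<in> carrier ?P"
      using finite_subset[OF E] E xs \<rho>C u by auto
    note * = h[OF this]
    have pt: "u I \<in> genideal (B I) ((\<lambda>r. \<rho> r I) ` E \<union> N J I) \<longleftrightarrow>
        (I \<in> \<I> \<longrightarrow> J \<subseteq> I \<longrightarrow> u I \<in> genideal (B I) ((\<lambda>r. \<rho> r I) ` E))" for J I
    proof (cases "I \<in> \<I> \<and> J \<subseteq> I")
      case True
      have "genideal (B I) {} = {\<zero>\<^bsub>B I\<^esub>}"
        using B.genideal_minimal[OF B.zeroideal, of "{}" I] B.Idl_zero[of "{}" I] by blast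
      then show ?thesis using True B.Idl_Un_Idl[OF EC, of "{}" I] by (simp add: N_def)
    next
      case False
      have "u I \<in> genideal (B I) ((\<lambda>r. \<rho> r I) ` E \<union> carrier (B I))"
        by (rule B.Idl_gen) (use EC u in auto)
      then show ?thesis using False by (auto simp: N_def)
    qed
    show ?thesis unfolding *[unfolded image_image] pt by (simp only: Ball_def)
  qed
  define G where "G = (\<lambda>s. h (\<lambda>I. k I s))"
  have G: "G \<in> ring_hom S D"
  proof (rule ring_hom_memI)
    fix s t assume s: "s \<in> carrier S" and t: "t \<in> carrier S"
    have C: "(\<lambda>I. k I s) \<in> carrier ?P" "(\<lambda>I. k I t) \<in> carrier ?P"
      using s t ring_hom_closed[OF k] by auto
    show "G (s \<otimes>\<^bsub>S\<^esub> t) = G s \<otimes>\<^bsub>D\<^esub> G t" "G (s \<oplus>\<^bsub>S\<^esub> t) = G s \<oplus>\<^bsub>D\<^esub> G t"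
      using ring_hom_mult[OF D(2) C] ring_hom_add[OF D(2) C] s t
      by (simp_all add: G_def ring_hom_mult[OF k] ring_hom_add[OF k])
  next
    show "G s \<in> carrier D" if "s \<in> carrier S" for s
      unfolding G_def by (rule ring_hom_closed[OF D(2)]) (use that ring_hom_closed[OF k] in simp)
    show "G \<one>\<^bsub>S\<^esub> = \<one>\<^bsub>D\<^esub>" using ring_hom_one[OF D(2)] by (simp add: G_def ring_hom_one[OF k])
  qed
  have G\<rho>: "G (r \<odot>\<^bsub>S\<^esub> \<one>\<^bsub>S\<^esub>) = h (\<rho> r)" for r by (simp add: G_def \<rho>_def)
  have "G s = \<zero>\<^bsub>D\<^esub>" if s: "s \<in> \<Union>\<I>" and sS: "s \<in> carrier S" for s
  proof -
    obtain J where J: "J \<in> \<I>" "s \<in> J" using s by blast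
    have "k I s \<in> genideal (B I) {}" if "I \<in> \<I>" "J \<subseteq> I" for I
      using kill[OF that(1)] that(2) J(2) B.Idl_zero[of "{}" I] by auto
    then have "G s \<in> genideal D ((\<lambda>r. h (\<rho> r)) ` {})"
      unfolding G_def using hmem[of "{}" "\<lambda>I. k I s"] J(1) ring_hom_closed[OF k sS] by auto
    then show ?thesis using D.genideal_minimal[OF D.zeroideal, of "{}"] by auto
  qed
  moreover have "\<Union>\<I> \<subseteq> carrier S" using sub by blast
  moreover have "regular_over D {} (map (\<lambda>r. h (\<rho> r)) xs)"
    unfolding regular_over_iff_nth nzd_mod_def
  proof (intro allI impI ballI)
    fix i d
    let ?E = "set (take i xs)"
    assume i: "i < length (map (\<lambda>r. h (\<rho> r)) xs)" and d: "d \<in> carrier D"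
      and m: "map (\<lambda>r. h (\<rho> r)) xs ! i \<otimes>\<^bsub>D\<^esub> d \<in> genideal D ({} \<union> set (take i (map (\<lambda>r. h (\<rho> r)) xs)))"
    obtain u where u: "u \<in> carrier ?P" "d = h u" using d D(3) by blast
    have uC: "u I \<in> carrier (B I)" for I using u(1) by simp
    have xi: "xs ! i \<in> carrier R" using i xs by (auto simp: subset_eq)
    have E: "?E \<subseteq> set xs" by (rule set_take_subset)
    have "h (\<lambda>I. \<rho> (xs ! i) I \<otimes>\<^bsub>B I\<^esub> u I) = h (\<rho> (xs ! i)) \<otimes>\<^bsub>D\<^esub> d"
      using ring_hom_mult[OF D(2), of "\<rho> (xs ! i)" u] u \<rho>C[OF xi] by simp
    then have "h (\<lambda>I. \<rho> (xs ! i) I \<otimes>\<^bsub>B I\<^esub> u I) \<in> genideal D ((\<lambda>r. h (\<rho> r)) ` ?E)"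
      using m i by (simp add: take_map)
    then obtain J where J: "J \<in> \<I>"
      "\<And>I. I \<in> \<I> \<Longrightarrow> J \<subseteq> I \<Longrightarrow> \<rho> (xs ! i) I \<otimes>\<^bsub>B I\<^esub> u I \<in> genideal (B I) ((\<lambda>r. \<rho> r I) ` ?E)"
      using hmem[OF E, of "\<lambda>I. \<rho> (xs ! i) I \<otimes>\<^bsub>B I\<^esub> u I"] \<rho>C[OF xi] uC by auto
    have "u I \<in> genideal (B I) ((\<lambda>r. \<rho> r I) ` ?E)" if "I \<in> \<I>" "J \<subseteq> I" for I
    proof -
      have "nzd_mod (B I) (genideal (B I) ((\<lambda>r. \<rho> r I) ` ?E)) (\<rho> (xs ! i) I)"
        using reg[of I] i unfolding regular_over_iff_nth by (auto simp: take_map)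
      then show ?thesis using J(2)[OF that] uC[of I] by (metis nzd_modD)
    qed
    then have "d \<in> genideal D ((\<lambda>r. h (\<rho> r)) ` ?E)" using hmem[OF E uC] J(1) u(2) by blast
    then show "d \<in> genideal D ({} \<union> set (take i (map (\<lambda>r. h (\<rho> r)) xs)))" by (simp add: take_map)
  qed
  moreover have "\<one>\<^bsub>D\<^esub> \<notin> genideal D ((\<lambda>r. h (\<rho> r)) ` set xs)"
  proof
    assume "\<one>\<^bsub>D\<^esub> \<in> genideal D ((\<lambda>r. h (\<rho> r)) ` set xs)"
    then have "h (\<lambda>I. \<one>\<^bsub>B I\<^esub>) \<in> genideal D ((\<lambda>r. h (\<rho> r)) ` set xs)"
      using ring_hom_one[OF D(2)] by simp
    then obtain J where "J \<in> \<I>" "\<one>\<^bsub>B J\<^esub> \<in> genideal (B J) ((\<lambda>r. \<rho> r J) ` set xs)"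
      using hmem[OF subset_refl, of "\<lambda>I. \<one>\<^bsub>B I\<^esub>"] by auto
    then show False using one by blast
  qed
  ultimately have "seed_witness S (\<Union>\<I>) xs D G"
    unfolding seed_witness_def using D(1) G by (auto simp: G\<rho>)
  then show ?thesis by blast
qed

lemma ideal_Union_chain:
  assumes S: "cring S" and ne: "\<I> \<noteq> {}" and id: "\<And>I. I \<in> \<I> \<Longrightarrow> ideal I S"
    and chain: "\<And>I J. I \<in> \<I> \<Longrightarrow> J \<in> \<I> \<Longrightarrow> I \<subseteq> J \<or> J \<subseteq> I"
  shows "ideal (\<Union>\<I>) S"
proof (rule cring.idealI_cring[OF S])
  show "\<Union>\<I> \<subseteq> carrier S" using ideal.Icarr[OF id] by blast
  show "\<zero>\<^bsub>S\<^esub> \<in> \<Union>\<I>" using ne additive_subgroup.zero_closed[OF ideal.axioms(1)[OF id]] by blast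
  show "x \<oplus>\<^bsub>S\<^esub> y \<in> \<Union>\<I>" if xy: "x \<in> \<Union>\<I>" "y \<in> \<Union>\<I>" for x y
  proof -
    obtain I J where IJ: "I \<in> \<I>" "J \<in> \<I>" "x \<in> I" "y \<in> J" using xy by blast
    then obtain K where "K \<in> \<I>" "x \<in> K" "y \<in> K" using chain[of I J] by blast
    then show ?thesis using additive_subgroup.a_closed[OF ideal.axioms(1)[OF id]] by blast
  qed
  show "a \<otimes>\<^bsub>S\<^esub> x \<in> \<Union>\<I>" if "a \<in> carrier S" "x \<in> \<Union>\<I>" for a x
    using that ideal.I_l_closed[OF id] by blast
qed

section \<open>Existence of minimal seeds\<close>

theorem proposition5p4:
  fixes R :: "('r, 'm) ring_scheme" and S :: "('r, 's, 'n) module_scheme"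
  assumes "noetherian_local_ring R" and "seed R S"
  shows "\<exists>I. ideal I S \<and> minimal_seed R (quot_algebra S I)"
proof -
  have R: "local_ring R" using assms(1) by (rule noetherian_local_ring.axioms(2))
  have S: "algebra R S" using assms(2) by (simp add: seed_def)
  interpret S: cring S using S by (rule algebra.M_cring)
  define \<A> where "\<A> = {I. ideal I S \<and> seed R (quot_algebra S I)}"
  obtain B0 :: "('r, 's list) module" and f0 where B0: "big_cohen_macaulay R B0" "f0 \<in> alg_hom R S B0"
    using assms(2) unfolding seed_def by blast
  obtain xs where xs: "system_of_parameters R xs" using B0(1) by (auto simp: big_cohen_macaulay_def)
  have "seed R (quot_algebra S {\<zero>\<^bsub>S\<^esub>})"
  proof (rule seed_quotI[OF S S.zeroideal B0])
    have "f0 \<zero>\<^bsub>S\<^esub> = \<zero>\<^bsub>B0\<^esub>"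
      by (rule ring_hom_zero_cring[OF S.cring_axioms algebra.M_cring[of R]])
        (use B0 in \<open>auto simp: big_cohen_macaulay_def alg_hom_def\<close>)
    then show "f0 s = \<zero>\<^bsub>B0\<^esub>" if "s \<in> {\<zero>\<^bsub>S\<^esub>}" for s using that by simp
  qed
  then have "\<A> \<noteq> {}" using S.zeroideal by (auto simp: \<A>_def)
  then have "\<exists>M\<in>\<A>. \<forall>E\<in>\<A>. M \<subseteq> E \<longrightarrow> E = M"
  proof (rule subset_Zorn_nonempty)
    fix \<I> assume ne: "\<I> \<noteq> {}" and "subset.chain \<A> \<I>"
    then have sub: "\<I> \<subseteq> \<A>" and ch: "\<And>I J. I \<in> \<I> \<Longrightarrow> J \<in> \<I> \<Longrightarrow> I \<subseteq> J \<or> J \<subseteq> I"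
      by (auto simp: subset_chain_def)
    have U: "ideal (\<Union>\<I>) S"
      by (rule ideal_Union_chain[OF S.cring_axioms ne _ ch]) (use sub in \<open>auto simp: \<A>_def\<close>)
    have "\<exists>(C :: (nat \<Rightarrow> 's set list) ring) g. seed_witness S I xs C g" if "I \<in> \<I>" for I
    proof -
      have I: "ideal I S" "seed R (quot_algebra S I)" using that sub by (auto simp: \<A>_def)
      obtain B :: "('r, 's set list) module" and F where B: "big_cohen_macaulay R B"
        "F \<circ> (\<lambda>s. I +>\<^bsub>S\<^esub> s) \<in> alg_hom R S B"
        "\<And>s. s \<in> I \<Longrightarrow> (F \<circ> (\<lambda>s. I +>\<^bsub>S\<^esub> s)) s = \<zero>\<^bsub>B\<^esub>"
        by (rule seed_quotE[OF S I]) (rule that)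
      obtain ys where "system_of_parameters R ys" "seed_witness S I ys B (F \<circ> (\<lambda>s. I +>\<^bsub>S\<^esub> s))"
        by (rule seed_witness_of_big_cohen_macaulay[OF S B(1,2)]) (erule B(3), rule that)
      then show ?thesis using seed_witness_change_parameters[OF R S _ _ xs] by blast
    qed
    then obtain C :: "'s set \<Rightarrow> (nat \<Rightarrow> 's set list) ring" and g
      where w: "\<And>I. I \<in> \<I> \<Longrightarrow> seed_witness S I xs (C I) (g I)"
      by metis
    have "\<exists>(D :: ('s set \<Rightarrow> nat \<Rightarrow> 's set list) ring) h. seed_witness S (\<Union>\<I>) xs D h"
    proof (rule seed_witness_Union[OF S sop_carrier[OF xs] ne _ ch w])
      show "I \<subseteq> carrier S" if "I \<in> \<I>" for I
        using that sub ideal.Icarr[of I S] by (auto simp: \<A>_def)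
    qed
    then obtain D :: "('s set \<Rightarrow> nat \<Rightarrow> 's set list) ring" and h where Dh: "seed_witness S (\<Union>\<I>) xs D h"
      by blast
    have "seed R (quot_algebra S (\<Union>\<I>))"
    proof (rule seed_quotI[OF S U big_cohen_macaulay_of_seed_witness[OF S xs Dh]])
      show "h s = \<zero>\<^bsub>algebra_along S h D\<^esub>" if "s \<in> \<Union>\<I>" for s
        using Dh algebra_along(2)[OF S] that by (auto simp: seed_witness_def)
      show "h \<in> alg_hom R S (algebra_along S h D)"
        using Dh algebra_along(2)[OF S] by (auto simp: seed_witness_def)
    qed
    then show "\<Union>\<I> \<in> \<A>" using U by (simp add: \<A>_def)
  qed
  then obtain M where M: "ideal M S" "seed R (quot_algebra S M)"
    and max: "\<And>I. ideal I S \<Longrightarrow> seed R (quot_algebra S I) \<Longrightarrow> M \<subseteq> I \<Longrightarrow> I = M"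
    by (auto simp: \<A>_def)
  let ?T = "quot_algebra S M"
  have T: "algebra R ?T" by (rule quot_algebra_is_algebra[OF S M(1)])
  note q = quot_map_alg_hom[OF S M(1)]
  have zero: "\<zero>\<^bsub>?T\<^esub> = M" by (simp add: quot_algebra_sel(4) FactRing_def)
  have "J = {\<zero>\<^bsub>?T\<^esub>}" if J: "ideal J ?T" and sJ: "seed R (quot_algebra ?T J)" for J
  proof -
    \<comment> \<open>\<open>(S / M) / J\<close> is the quotient of \<open>S\<close> by the preimage of \<open>J\<close>, to which maximality applies.\<close>
    let ?I = "{s \<in> carrier S. M +>\<^bsub>S\<^esub> s \<in> J}"
    interpret J: ideal J ?T by (rule J)
    have I: "ideal ?I S"
      by (rule ideal_hom_vimage[OF S.cring_axioms algebra.M_cring[OF T] _ J])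
        (use q in \<open>simp add: alg_hom_def\<close>)
    obtain B :: "('r, 's set set list) module" and F where B: "big_cohen_macaulay R B"
      "F \<circ> (\<lambda>t. J +>\<^bsub>?T\<^esub> t) \<in> alg_hom R ?T B"
      "\<And>t. t \<in> J \<Longrightarrow> (F \<circ> (\<lambda>t. J +>\<^bsub>?T\<^esub> t)) t = \<zero>\<^bsub>B\<^esub>"
      by (rule seed_quotE[OF T J sJ]) (rule that)
    have "seed R (quot_algebra S ?I)"
      by (rule seed_quotI[OF S I B(1) alg_hom_comp[OF q B(2)]]) (use B(3) in simp)
    moreover have "M \<subseteq> ?I"
    proof
      fix s assume s: "s \<in> M"
      then have "M +>\<^bsub>S\<^esub> s = \<zero>\<^bsub>?T\<^esub>" using S.a_rcos_zero[OF M(1)] zero by simp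
      then show "s \<in> ?I" using J.zero_closed ideal.Icarr[OF M(1) s] by simp
    qed
    ultimately have IM: "?I = M" using max[OF I] by blast
    have "E = \<zero>\<^bsub>?T\<^esub>" if E: "E \<in> J" for E
    proof -
      obtain s where s: "s \<in> carrier S" "E = M +>\<^bsub>S\<^esub> s" using J.Icarr[OF E] by (auto simp: quot_carrier)
      then have "s \<in> M" using E IM by blast
      then show ?thesis using S.a_rcos_zero[OF M(1)] zero s(2) by simp
    qed
    then have "J \<subseteq> {\<zero>\<^bsub>?T\<^esub>}" by (simp add: subset_iff)
    moreover have "{\<zero>\<^bsub>?T\<^esub>} \<subseteq> J" using J.zero_closed by simp
    ultimately show ?thesis by (rule subset_antisym)
  qed
  then have "minimal_seed R ?T" using M(2) unfolding minimal_seed_def by blast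
  then show ?thesis using M(1) by blast
qed

end
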